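(* Assume that the i.i.d. random variables $\{\Theta_z\}_{z\in\mathbb{Z}}$ are nonconstant with essential infimum $\theta_*>0$, let $\bar\theta=\mathbb{E}[\Theta_0]$, $\bar\sigma(1)=\sigma_W\sqrt{\bar\theta}$ and $\sigma_*=\sigma_W\sqrt{\theta_*}$. There is a nonincreasing continuous function $\check\sigma:[0,\infty]\to[\sigma_*,\bar\sigma(1)]$ such that if $\epsilon\mapsto\delta(\epsilon)>0$ is any choice of scaling such that $\epsilon^{-1}\delta(\epsilon)\to0$ as $\epsilon\to0$ and for which there is a constant $\kappa\in[0,\infty]$ with $$\lim_{\epsilon\downarrow0}\frac{\delta(\epsilon)|\log\epsilon|}{\epsilon}=\kappa,$$ then, for any bounded interval $I$, $$\lim_{\epsilon\downarrow0}\sigma_{\epsilon,\delta(\epsilon)}(1;I)=\lim_{\epsilon\downarrow0}\sigma_{\epsilon,\delta(\epsilon)}(-1;I)=\check\sigma(\kappa)\quad\text{in probability.}$$ Further, $\check\sigma(0)=\bar\sigma(1)$, $\check\sigma(\kappa)<\bar\sigma(1)$ for any $\kappa>0$, and $\check\sigma(\infty)=\sigma_*$.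
   Context: Let $W:\mathbb{R}\to[0,\infty)$ be continuous with zeros precisely at $-1$ and $1$, and let $\sigma_W=\int_{-1}^{1}\sqrt{2W(u)}\,du$. 1D random checkerboard with $a\equiv1$: $\{\Theta_z\}_{z\in\mathbb{Z}}$ are i.i.d. real random variables with $\theta_*\le\Theta_z\le\theta^*$ almost surely for some $0<\theta_*\le\theta^*<\infty$, and $\theta(x)=\sum_{z\in\mathbb{Z}}\Theta_z\mathbf{1}_{z+(-1/2,1/2)}(x)$. For $\epsilon,\delta>0$ and an interval $U$, $$\mathscr{F}_{\epsilon,\delta}(u;U)=\int_U\Big(\frac{\epsilon}{2}|u'(x)|^2+\frac1\epsilon\theta(\delta^{-1}x)W(u(x))\Big)dx.$$ Fix an arbitrary smooth function $q:\mathbb{R}\to[-1,1]$ with $q(\infty)=1$ and $q(-\infty)=-1$. For a bounded interval $I$ (nonempty interior) with midpoint $x$ and $n\in\{-1,1\}$, the finite-volume surface tension is $$\sigma_{\epsilon,\delta}(n;I)=\min\{\mathscr{F}_{\epsilon,\delta}(u;I)\mid u\in H^1(I),\ u(x')=q(\epsilon^{-1}(x'-x)n)\text{ for }x'\in\partial I\}.$$ *)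

theory Defs
  imports "HOL-Probability.Probability"
begin

definition smooth :: "(real \<Rightarrow> real) \<Rightarrow> bool" where
  "smooth f \<longleftrightarrow> (\<forall>n x. ((deriv ^^ n) f) differentiable (at x))"

definition L2 :: "real set \<Rightarrow> (real \<Rightarrow> real) set" where
  "L2 U = {f. set_borel_measurable lebesgue U f \<and> set_integrable lebesgue U (\<lambda>x. (f x)\<^sup>2)}"

definition test_functions :: "real set \<Rightarrow> (real \<Rightarrow> real) set" where
  "test_functions U =
    {\<phi>. \<phi> C1_differentiable_on UNIV \<and> compact (closure {x. \<phi> x \<noteq> 0}) \<and> closure {x. \<phi> x \<noteq> 0} \<subseteq> U}"

definition has_L2_weak_deriv :: "real set \<Rightarrow> (real \<Rightarrow> real) \<Rightarrow> (real \<Rightarrow> real) \<Rightarrow> bool" where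
  "has_L2_weak_deriv U u v \<longleftrightarrow> v \<in> L2 U \<and>
    (\<forall>\<phi>\<in>test_functions U.
      (LINT x:U|lebesgue. u x * deriv \<phi> x) = - (LINT x:U|lebesgue. v x * \<phi> x))"

(* Sobolev space of an interval I, with test functions of class C^1_c on the interior as in
   Brezis, Functional Analysis, Sobolev Spaces and PDE, Section 8.2. On a bounded interval each
   class has exactly one representative continuous up to the closure; we work with that one, so
   that boundary values of u are pointwise values. Values of u off the closure are irrelevant. *)
definition H1 :: "real set \<Rightarrow> (real \<Rightarrow> real) set" where
  "H1 I = {u. continuous_on (closure I) u \<and> u \<in> L2 (interior I) \<and>
              (\<exists>v. has_L2_weak_deriv (interior I) u v)}"

(* The weak derivative is unique almost everywhere, so integrals do not depend on the choice. *)
definition weak_deriv :: "real set \<Rightarrow> (real \<Rightarrow> real) \<Rightarrow> real \<Rightarrow> real" where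
  "weak_deriv I u = (SOME v. has_L2_weak_deriv (interior I) u v)"

definition checkerboard :: "(int \<Rightarrow> real) \<Rightarrow> real \<Rightarrow> real" where
  "checkerboard \<Theta> x =
    (\<Sum>\<^sub>\<infinity>z\<in>UNIV. \<Theta> z * indicator {of_int z - 1/2 <..< of_int z + 1/2} x)"

definition energy ::
  "(real \<Rightarrow> real) \<Rightarrow> (int \<Rightarrow> real) \<Rightarrow> real \<Rightarrow> real \<Rightarrow> real set \<Rightarrow> (real \<Rightarrow> real) \<Rightarrow> real" where
  "energy W \<Theta> \<epsilon> \<delta> I u =
    (LINT x:I|lebesgue. \<epsilon> / 2 * (weak_deriv I u x)\<^sup>2 + 1 / \<epsilon> * checkerboard \<Theta> (x / \<delta>) * W (u x))"

definition midpoint_of :: "real set \<Rightarrow> real" where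
  "midpoint_of I = (Inf I + Sup I) / 2"

definition admissible :: "(real \<Rightarrow> real) \<Rightarrow> real \<Rightarrow> real \<Rightarrow> real set \<Rightarrow> (real \<Rightarrow> real) set" where
  "admissible q \<epsilon> n I = {u \<in> H1 I. \<forall>y\<in>frontier I. u y = q ((y - midpoint_of I) * n / \<epsilon>)}"

(* The minimum of the energy, written as an infimum (it is attained when \<Theta> is positive). *)
definition surface_tension ::
  "(real \<Rightarrow> real) \<Rightarrow> (real \<Rightarrow> real) \<Rightarrow> (int \<Rightarrow> real) \<Rightarrow> real \<Rightarrow> real \<Rightarrow> real \<Rightarrow> real set \<Rightarrow> real" where
  "surface_tension W q \<Theta> \<epsilon> \<delta> n I = (INF u\<in>admissible q \<epsilon> n I. energy W \<Theta> \<epsilon> \<delta> I u)"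

definition sigma_W :: "(real \<Rightarrow> real) \<Rightarrow> real" where
  "sigma_W W = (LINT u:{-1..1}|lebesgue. sqrt (2 * W u))"

definition essinf :: "'a measure \<Rightarrow> ('a \<Rightarrow> ereal) \<Rightarrow> ereal" where
  "essinf M f = - esssup M (\<lambda>x. - f x)"

definition tendsto_in_probability ::
  "'a measure \<Rightarrow> ('b \<Rightarrow> 'a \<Rightarrow> real) \<Rightarrow> real \<Rightarrow> 'b filter \<Rightarrow> bool" where
  "tendsto_in_probability M X c F \<longleftrightarrow>
    (\<forall>\<^sub>F i in F. X i \<in> borel_measurable M) \<and>
    (\<forall>\<eta>>0. ((\<lambda>i. measure M {\<omega> \<in> space M. \<bar>X i \<omega> - c\<bar> > \<eta>}) \<longlongrightarrow> 0) F)"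

end

theory Submission
  imports Defs "HOL-Real_Asymp.Real_Asymp"
begin

text \<open>
  Measured in units of \<open>\<epsilon>\<close>, an interface sees \<open>N = \<epsilon> / \<delta>\<close> cells per unit of length, and \<open>N\<close> tends to
  infinity. On a stretch of length \<open>h\<close> the energy depends on the environment only through the
  average \<open>m\<close> of the roughly \<open>h * N\<close> variables met there. The law of large numbers makes \<open>m\<close> equal to
  the mean, but the interface may choose its position, and there are about \<open>1 / \<epsilon>\<close> independent
  positions. An average at most \<open>m\<close> has probability \<open>exp (- h * N * rate m)\<close> to leading order, and
  \<open>1 / \<epsilon> = exp (\<bar>ln \<epsilon>\<bar>)\<close> with \<open>\<bar>ln \<epsilon>\<bar> / N\<close> tending to \<open>\<kappa>\<close>. Hence exactly those macroscopic
  coefficient profiles occur somewhere in the interval for which the integral of \<open>rate m\<close> along the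
  interface is at most \<open>\<kappa>\<close>, and the limit is the least one-dimensional transition energy with a
  coefficient from this class.

  The variational problem is stated in a discrete form (\<open>check_sigma\<close>). The range from \<open>-1\<close> to \<open>1\<close> is
  cut into \<open>n\<close> equal slots; the interface crosses slot \<open>j\<close> linearly over a length \<open>h j\<close> in a medium of
  coefficient \<open>m j\<close>, and the potential is replaced by its maximum over the slot. This suffices because
  a convexity inequality bounds the gradient energy of any crossing from below by that of the linear
  one, while the maximum and the minimum of the potential over a slot differ by a factor close to one
  away from the wells.

  The rate function is defined by superadditivity: the probability that \<open>r\<close> variables have average
  at most \<open>m\<close> is supermultiplicative in \<open>r\<close>, so the upper bound \<open>exp (- r * rate m)\<close> holds for every
  \<open>r\<close> and is sharp as \<open>r\<close> grows (\<open>tail_prob_upper\<close>, \<open>tail_prob_lower\<close>). Hoeffding's inequality shows that the rate vanishes above the mean and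
  grows at least quadratically below it.

  \<^item> Lower bound (\<open>prob_low_energy\<close>): a function of bounded energy crosses each slot in a disjoint
    interval, so its energy dominates that of a discrete profile whose coefficients are the actual
    averages. If this were too small, the blocks would be more costly than \<open>\<kappa>\<close> permits, and a union
    bound over the position and the polynomially many shapes of the blocks excludes that.
  \<^item> Upper bound (\<open>prob_high_energy\<close>): of the order of \<open>1 / \<epsilon>\<close> disjoint windows are independent and
    each realises a given profile of cost below \<open>\<kappa>\<close> with probability much larger than \<open>\<epsilon>\<close>; the piecewise
    linear interface through a good window is the competitor.
  \<^item> The properties of the limit come from the discrete problem: stretching all widths by a factor
    changes the cost by this factor and the energy at most by it, which gives continuity at positive
    \<open>\<kappa>\<close>; the quadratic growth of the rate gives continuity at \<open>0\<close>; lowering the coefficient on a short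
    central piece gives strictness; constant coefficients give the two extreme values.
  \<^item> The orientation \<open>-1\<close> follows from \<open>1\<close> by the reflection of \<open>u\<close> to \<open>- u\<close>.
\<close>

section \<open>Weak derivatives on an interval\<close>

lemma max_zero_square_derivative:
  "((\<lambda>x::real. (max 0 x)\<^sup>2) has_real_derivative 2 * max 0 x) (at x)"
proof -
  consider "x < 0" | "x = 0" | "x > 0" by linarith
  then show ?thesis
  proof cases
    case 1
    have "((\<lambda>x::real. 0) has_real_derivative 0) (at x)" by simp
    then have "((\<lambda>x::real. (max 0 x)\<^sup>2) has_real_derivative 0) (at x)"
      by (rule has_field_derivative_transform_within_open[where S="{..<0}"]) (use 1 in auto)
    then show ?thesis using 1 by simp
  next
    case 2
    have "((\<lambda>h::real. ((max 0 h)\<^sup>2 - 0) / h) \<longlongrightarrow> 0) (at 0)"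
    proof (rule tendsto_sandwich[where f="\<lambda>h. -\<bar>h\<bar>" and h="\<lambda>h. \<bar>h\<bar>"])
      show "\<forall>\<^sub>F h in at 0. -\<bar>h\<bar> \<le> ((max 0 h)\<^sup>2 - 0) / (h::real)"
        by (auto simp: eventually_at_filter max_def power2_eq_square)
      show "\<forall>\<^sub>F h in at 0. ((max 0 h)\<^sup>2 - 0) / (h::real) \<le> \<bar>h\<bar>"
        by (auto simp: eventually_at_filter max_def power2_eq_square)
    qed (auto intro!: tendsto_eq_intros)
    then show ?thesis using 2 by (simp add: DERIV_def)
  next
    case 3
    have "((\<lambda>x::real. x\<^sup>2) has_real_derivative 2 * x) (at x)" by (auto intro!: derivative_eq_intros)
    then have "((\<lambda>x::real. (max 0 x)\<^sup>2) has_real_derivative 2 * x) (at x)"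
      by (rule has_field_derivative_transform_within_open[where S="{0<..}"]) (use 3 in auto)
    then show ?thesis using 3 by simp
  qed
qed

text \<open>A continuously differentiable step from 0 to 1, made of three shifted copies of the square of the
  positive part; its derivative is the tent function \<open>hat\<close>. Differences of two scaled steps are the
  test functions that detect the values of \<open>u\<close> at two points.\<close>

definition smoothstep :: "real \<Rightarrow> real" where
  "smoothstep t = 2 * ((max 0 t)\<^sup>2 - 2 * (max 0 (t - 1/2))\<^sup>2 + (max 0 (t - 1))\<^sup>2)"

definition hat :: "real \<Rightarrow> real" where
  "hat t = 4 * (max 0 t - 2 * max 0 (t - 1/2) + max 0 (t - 1))"

lemma smoothstep_derivative: "(smoothstep has_real_derivative hat t) (at t)"
proof -
  have D: "((\<lambda>x::real. (max 0 (x - c))\<^sup>2) has_real_derivative 2 * max 0 (t - c)) (at t)" for c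
    using DERIV_chain2[where f="\<lambda>x. (max 0 x)\<^sup>2" and g="\<lambda>x. x - c" and x=t and s=UNIV,
        OF max_zero_square_derivative DERIV_diff[OF DERIV_ident DERIV_const]] by simp
  show ?thesis
    unfolding smoothstep_def[abs_def] hat_def
    using DERIV_cmult[OF DERIV_add[OF DERIV_diff[OF max_zero_square_derivative[of t] DERIV_cmult[OF D[of "1/2"], of 2]] D[of 1]], of 2]
    by (simp add: algebra_simps)
qed

lemma hat_nonneg: "hat t \<ge> 0" and hat_outside: "t \<le> 0 \<or> t \<ge> 1 \<Longrightarrow> hat t = 0"
  unfolding hat_def max_def by (auto split: if_splits)

lemma smoothstep_left: "t \<le> 0 \<Longrightarrow> smoothstep t = 0"
  and smoothstep_right: "t \<ge> 1 \<Longrightarrow> smoothstep t = 1"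
  unfolding smoothstep_def max_def by (auto simp: power2_eq_square algebra_simps)

lemma continuous_on_hat: "continuous_on S hat"
  unfolding hat_def[abs_def] by (intro continuous_intros)

lemma smoothstep_bounds: "0 \<le> smoothstep t" "smoothstep t \<le> 1"
proof -
  have mono: "smoothstep x \<le> smoothstep y" if "x \<le> y" for x y
    by (rule DERIV_nonneg_imp_nondecreasing[OF that]) (blast intro: smoothstep_derivative hat_nonneg)
  show "0 \<le> smoothstep t"
    using mono[of 0 t] smoothstep_left[of 0] smoothstep_left[of t] by (cases "t \<le> 0") auto
  show "smoothstep t \<le> 1"
    using mono[of t 1] smoothstep_right[of 1] smoothstep_right[of t] by (cases "t \<ge> 1") auto
qed

lemma smoothstep_scaled_derivative:
  assumes "k > 0"
  shows "((\<lambda>x. smoothstep ((x - c) / k)) has_real_derivative hat ((x - c) / k) / k) (at x)"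
proof -
  have "((\<lambda>x. (x - c) / k) has_real_derivative 1 / k) (at x)"
    using assms by (auto intro!: derivative_eq_intros)
  from DERIV_chain2[OF smoothstep_derivative this] show ?thesis by simp
qed

text \<open>A scaled tent has integral 1, so it averages \<open>u\<close> over a short interval to the right of \<open>a\<close>.\<close>

lemma hat_average:
  assumes k: "k > 0" and u: "continuous_on {a..a+k} u"
    and e: "\<And>x. x \<in> {a..a+k} \<Longrightarrow> \<bar>u x - u a\<bar> \<le> e"
    and U: "{a..a+k} \<subseteq> U"
  shows "set_integrable lebesgue U (\<lambda>x. u x * (hat ((x - a) / k) / k))"
    and "\<bar>(LINT x:U|lebesgue. u x * (hat ((x - a) / k) / k)) - u a\<bar> \<le> e"
proof -
  let ?g = "\<lambda>x. hat ((x - a) / k) / k"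
  have gc: "continuous_on {a..a+k} ?g"
    using k by (intro continuous_intros continuous_on_compose2[OF continuous_on_hat[of UNIV]]) auto
  have out: "?g x = 0" if "x \<notin> {a..a+k}" for x
    using that k by (subst hat_outside) (auto simp: field_simps)
  have eq: "indicator U x *\<^sub>R (u x * ?g x) = indicator {a..a+k} x *\<^sub>R (u x * ?g x)" for x
    using U out[of x] by (cases "x \<in> {a..a+k}") (auto simp: indicator_def)
  have int: "set_integrable lebesgue {a..a+k} (\<lambda>x. f x * ?g x)" if "continuous_on {a..a+k} f" for f
    by (intro absolutely_integrable_continuous_real continuous_intros that gc)
  show "set_integrable lebesgue U (\<lambda>x. u x * ?g x)"
    using int[OF u] unfolding set_integrable_def eq .
  have "(?g has_integral smoothstep ((a + k - a) / k) - smoothstep ((a - a)/k)) {a..a+k}"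
    using k by (intro fundamental_theorem_of_calculus)
      (auto simp: has_real_derivative_iff_has_vector_derivative[symmetric]
            intro!: has_field_derivative_at_within smoothstep_scaled_derivative)
  then have g1: "(?g has_integral 1) {a..a+k}"
    using k by (simp add: smoothstep_left smoothstep_right)
  have "(LINT x:U|lebesgue. u x * ?g x) = (LINT x:{a..a+k}|lebesgue. u x * ?g x)"
    unfolding set_lebesgue_integral_def eq ..
  also have "\<dots> = integral {a..a+k} (\<lambda>x. u x * ?g x)"
    by (rule set_lebesgue_integral_eq_integral(2)[OF int[OF u]])
  finally have I: "(LINT x:U|lebesgue. u x * ?g x) = integral {a..a+k} (\<lambda>x. u x * ?g x)" .
  have h1: "((\<lambda>x. u x * ?g x) has_integral integral {a..a+k} (\<lambda>x. u x * ?g x)) {a..a+k}"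
    using set_lebesgue_integral_eq_integral(1)[OF int[OF u]] by (rule integrable_integral)
  have h2: "((\<lambda>x. u a * ?g x) has_integral u a) {a..a+k}"
    using has_integral_mult_right[OF g1, of "u a"] by simp
  have h3: "((\<lambda>x. e * ?g x) has_integral e) {a..a+k}"
    using has_integral_mult_right[OF g1, of e] by simp
  have gn: "?g x \<ge> 0" for x using k hat_nonneg by simp
  have "integral {a..a+k} (\<lambda>x. u x * ?g x) - u a \<le> e"
    by (rule has_integral_le[OF has_integral_diff[OF h1 h2] h3])
      (use order_trans[OF abs_ge_self e] gn in \<open>simp only: left_diff_distrib[symmetric], blast intro: mult_right_mono\<close>)
  moreover have "- e \<le> integral {a..a+k} (\<lambda>x. u x * ?g x) - u a"
  proof (rule has_integral_le[OF has_integral_neg[OF h3] has_integral_diff[OF h1 h2]])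
    fix x assume "x \<in> {a..a+k}"
    from e[OF this] have "- e \<le> u x - u a" by linarith
    from mult_right_mono[OF this gn[of x]] show "- (e * ?g x) \<le> u x * ?g x - u a * ?g x"
      by (simp only: left_diff_distrib minus_mult_left)
  qed
  ultimately show "\<bar>(LINT x:U|lebesgue. u x * ?g x) - u a\<bar> \<le> e" using I by linarith
qed

lemma L2_set_integrable:
  assumes "v \<in> L2 U" "U \<in> lmeasurable"
  shows "set_integrable lebesgue U v"
proof -
  have sq: "set_integrable lebesgue U (\<lambda>x. (v x)\<^sup>2)" and m: "set_borel_measurable lebesgue U v"
    using assms by (auto simp: L2_def)
  have "set_integrable lebesgue U (\<lambda>x. 1::real)"
    using assms(2) by (auto simp: set_integrable_def fmeasurable_def intro!: integrable_real_indicator)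
  from set_integral_add(1)[OF this sq]
  have i: "set_integrable lebesgue U (\<lambda>x. 1 + (v x)\<^sup>2)" .
  show ?thesis
    unfolding set_integrable_def
  proof (rule Bochner_Integration.integrable_bound[OF i[unfolded set_integrable_def]])
    show "(\<lambda>x. indicat_real U x *\<^sub>R v x) \<in> borel_measurable lebesgue"
      using m by (simp add: set_borel_measurable_def)
    have "\<bar>y\<bar> \<le> 1 + y\<^sup>2" for y :: real
      using zero_le_power2[of "\<bar>y\<bar> - 1"] by (simp add: power2_eq_square algebra_simps) 
    then have "norm (indicat_real U x *\<^sub>R v x) \<le> norm (indicat_real U x *\<^sub>R (1 + (v x)\<^sup>2))" for x
      by (auto simp: indicator_def abs_of_nonneg)
    then show "AE x in lebesgue. norm (indicat_real U x *\<^sub>R v x) \<le> norm (indicat_real U x *\<^sub>R (1 + (v x)\<^sup>2))"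
      by simp
  qed
qed

text \<open>Test the weak derivative against a smoothed indicator of the interval from \<open>a\<close> to \<open>b\<close> that rises and
  falls over a length \<open>k\<close>, and let \<open>k\<close> tend to 0. On one side the derivative of the test function
  concentrates at \<open>a\<close> and \<open>b\<close>, where \<open>u\<close> is continuous; on the other side dominated convergence
  applies.\<close>

lemma weak_deriv_FTC:
  assumes wd: "has_L2_weak_deriv {A<..<B} u v" and u: "continuous_on {A<..<B} u"
    and ab: "A < a" "a < b" "b < B"
  shows "u b - u a = (LINT x:{a..b}|lebesgue. v x)"
proof -
  let ?U = "{A<..<B}"
  define k where "k i = (B - b) / (2 * (real i + 1))" for i :: nat
  have kpos: "k i > 0" for i using ab by (simp add: k_def)
  have kle: "k i \<le> (B - b) / 2" for i
  proof -
    have "(B - b) / (2 * (real i + 1)) \<le> (B - b) / (2 * 1)"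
      using ab by (intro divide_left_mono) auto
    then show ?thesis by (simp add: k_def)
  qed
  have k0: "k \<longlonglongrightarrow> 0" unfolding k_def by real_asymp
  define \<phi> where "\<phi> i x = smoothstep ((x - a) / k i) - smoothstep ((x - b) / k i)" for i x
  define \<phi>' where "\<phi>' i x = hat ((x - a) / k i) / k i - hat ((x - b) / k i) / k i" for i x
  have D: "(\<phi> i has_real_derivative \<phi>' i x) (at x)" for i x
    unfolding \<phi>_def[abs_def] \<phi>'_def by (intro DERIV_diff smoothstep_scaled_derivative kpos)
  have dphi: "deriv (\<phi> i) = \<phi>' i" for i using D DERIV_imp_deriv by blast
  have cphi': "continuous_on UNIV (\<phi>' i)" for i
    unfolding \<phi>'_def[abs_def] using kpos[of i]
    by (intro continuous_intros continuous_on_compose2[OF continuous_on_hat[of UNIV]]) auto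
  have supp: "\<phi> i x = 0" if "x \<notin> {a..b + (B-b)/2}" for i x
  proof (cases "x < a")
    case True
    then show ?thesis unfolding \<phi>_def using kpos[of i] ab
      by (simp add: smoothstep_left divide_nonpos_pos)
  next
    case False
    then have "x > b + (B-b)/2" using that by simp
    then have "x - b \<ge> k i" "x - a \<ge> k i" using kle[of i] ab by linarith+
    then have "(x - a) / k i \<ge> 1" "(x - b) / k i \<ge> 1" using kpos[of i] by simp_all
    then show ?thesis unfolding \<phi>_def by (simp add: smoothstep_right)
  qed
  have test: "\<phi> i \<in> test_functions ?U" for i
  proof -
    have cl: "closure {x. \<phi> i x \<noteq> 0} \<subseteq> {a..b + (B-b)/2}"
    proof (rule closure_minimal)
      show "{x. \<phi> i x \<noteq> 0} \<subseteq> {a..b + (B-b)/2}" using supp[of _ i] by blast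
    qed simp
    have "compact (closure {x. \<phi> i x \<noteq> 0})"
      using compact_Int_closed[OF compact_Icc closed_closure, of a "b + (B-b)/2" "{x. \<phi> i x \<noteq> 0}"] cl
      by (simp add: Int_absorb1)
    moreover have "\<phi> i C1_differentiable_on UNIV"
      unfolding C1_differentiable_on_def
      using D cphi'[of i] by (intro exI[of _ "\<phi>' i"]) (simp add: has_real_derivative_iff_has_vector_derivative[symmetric])
    moreover have "closure {x. \<phi> i x \<noteq> 0} \<subseteq> ?U" using cl ab by (auto simp: field_simps)
    ultimately show ?thesis by (simp add: test_functions_def)
  qed
  have ident: "(LINT x:?U|lebesgue. u x * \<phi>' i x) = - (LINT x:?U|lebesgue. v x * \<phi> i x)" for i
    using wd test[of i] unfolding has_L2_weak_deriv_def by (metis dphi)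
  have vint: "set_integrable lebesgue ?U v"
    using wd by (intro L2_set_integrable) (auto simp: has_L2_weak_deriv_def)
  have R: "(\<lambda>i. LINT x:?U|lebesgue. v x * \<phi> i x) \<longlonglongrightarrow> (LINT x:{a..b}|lebesgue. v x)"
  proof -
    have "(\<lambda>i. LINT x|lebesgue. indicat_real ?U x *\<^sub>R (v x * \<phi> i x)) \<longlonglongrightarrow> 
        (LINT x|lebesgue. indicator {a..b} x *\<^sub>R v x)"
    proof (rule integral_dominated_convergence[where w="\<lambda>x. norm (indicat_real ?U x *\<^sub>R v x)"])
      have m: "(\<lambda>x. indicat_real ?U x *\<^sub>R v x) \<in> borel_measurable lebesgue"
        using vint by (auto simp: set_integrable_def)
      have "(\<lambda>x. indicator {a..b} x * (indicat_real ?U x *\<^sub>R v x)) \<in> borel_measurable lebesgue"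
        by (intro borel_measurable_times m borel_measurable_indicator) simp
      also have "(\<lambda>x. indicator {a..b} x * (indicat_real ?U x *\<^sub>R v x)) = (\<lambda>x. indicator {a..b} x *\<^sub>R v x)"
        using ab by (auto simp: indicator_def fun_eq_iff)
      finally show "(\<lambda>x. indicator {a..b} x *\<^sub>R v x) \<in> borel_measurable lebesgue" .
      have "\<phi> i \<in> borel_measurable lebesgue" for i
      proof -
        have "continuous_on UNIV (\<phi> i)"
          using DERIV_continuous_on[OF D] by blast
        then have "\<phi> i \<in> borel_measurable borel" by (rule borel_measurable_continuous_onI)
        then show ?thesis by (intro measurable_completion) simp
      qed
      then have "(\<lambda>x. (indicat_real ?U x *\<^sub>R v x) * \<phi> i x) \<in> borel_measurable lebesgue" for i
        by (intro borel_measurable_times m)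
      then show "(\<lambda>x. indicat_real ?U x *\<^sub>R (v x * \<phi> i x)) \<in> borel_measurable lebesgue" for i
        by (simp add: mult.assoc)
      show "integrable lebesgue (\<lambda>x. norm (indicat_real ?U x *\<^sub>R v x))"
        using vint by (auto simp: set_integrable_def)
      have "\<bar>\<phi> i x\<bar> \<le> 1" for i x
        unfolding \<phi>_def using smoothstep_bounds[of "(x - a) / k i"] smoothstep_bounds[of "(x - b) / k i"]
        by linarith
      then show "AE x in lebesgue. norm (indicat_real ?U x *\<^sub>R (v x * \<phi> i x)) \<le> norm (indicat_real ?U x *\<^sub>R v x)" for i
        by (auto simp: abs_mult indicator_def intro!: mult_left_le)
      \<comment> \<open>The smoothed indicator rises to the right of \<open>a\<close>, so it vanishes at \<open>a\<close> itself for every \<open>i\<close>.\<close>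
      have "(\<lambda>i. indicat_real ?U x *\<^sub>R (v x * \<phi> i x)) \<longlonglongrightarrow> indicator {a..b} x *\<^sub>R v x" if "x \<noteq> a" for x
      proof -
        have ev: "\<forall>\<^sub>F i in sequentially. k i < d" if "d > 0" for d
          using order_tendstoD(2)[OF k0 that] .
        have s: "\<forall>\<^sub>F i in sequentially. smoothstep ((x - c) / k i) = (if x > c then 1 else 0)" for c
        proof (cases "x > c")
          case True
          have "\<forall>\<^sub>F i in sequentially. k i < x - c" using True by (intro ev) simp
          then show ?thesis
          proof eventually_elim
            case (elim i)
            then have "(x - c) / k i \<ge> 1" using kpos[of i] by simp 
            then show ?case using True by (simp add: smoothstep_right)
          qed
        next
          case False
          have "smoothstep ((x - c) / k i) = 0" for i
            using False kpos[of i] by (intro smoothstep_left divide_nonpos_pos) auto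
          then show ?thesis using False by simp
        qed
        have "\<forall>\<^sub>F i in sequentially. \<phi> i x = indicator {a..b} x"
          using s[of a] s[of b]
          by eventually_elim (use that ab in \<open>auto simp: \<phi>_def indicator_def\<close>)
        then have "\<forall>\<^sub>F i in sequentially. indicat_real ?U x *\<^sub>R (v x * \<phi> i x) = indicator {a..b} x *\<^sub>R v x"
          by eventually_elim (use ab in \<open>auto simp: indicator_def\<close>)
        then show ?thesis by (rule tendsto_eventually)
      qed
      moreover have "AE x in lebesgue. x \<noteq> a"
        using AE_lborel_singleton[of a] by (rule AE_completion)
      ultimately show "AE x in lebesgue. (\<lambda>i. indicat_real ?U x *\<^sub>R (v x * \<phi> i x)) \<longlonglongrightarrow> indicator {a..b} x *\<^sub>R v x"
        by auto
    qed
    then show ?thesis by (simp add: set_lebesgue_integral_def)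
  qed
  have L: "(\<lambda>i. LINT x:?U|lebesgue. u x * \<phi>' i x) \<longlonglongrightarrow> u a - u b"
  proof -
    have near: "(\<lambda>i. LINT x:?U|lebesgue. u x * (hat ((x - c) / k i) / k i)) \<longlonglongrightarrow> u c \<and>
       (\<forall>i. set_integrable lebesgue ?U (\<lambda>x. u x * (hat ((x - c) / k i) / k i)))" if c: "A < c" "c \<le> b" for c
    proof (intro conjI allI)
      have sub: "{c..c + k i} \<subseteq> ?U" for i using c ab kle[of i] by auto
      show "(\<lambda>i. LINT x:?U|lebesgue. u x * (hat ((x - c) / k i) / k i)) \<longlonglongrightarrow> u c"
      proof (rule LIMSEQ_I)
        fix e :: real assume "e > 0"
        have "isCont u c" using u c ab by (simp add: continuous_on_eq_continuous_at)
        then obtain d where d: "d > 0" "\<And>x. \<bar>x - c\<bar> < d \<Longrightarrow> \<bar>u x - u c\<bar> < e / 2"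
          using \<open>e > 0\<close> unfolding continuous_at_eps_delta dist_real_def by (metis half_gt_zero)
        from order_tendstoD(2)[OF k0 d(1)] obtain n where n: "\<And>i. i \<ge> n \<Longrightarrow> k i < d"
          by (auto simp: eventually_sequentially)
        have "\<bar>(LINT x:?U|lebesgue. u x * (hat ((x - c) / k i) / k i)) - u c\<bar> \<le> e / 2" if "i \<ge> n" for i
        proof (rule hat_average(2))
          show "continuous_on {c..c + k i} u" using u sub continuous_on_subset by blast
          show "\<bar>u x - u c\<bar> \<le> e / 2" if "x \<in> {c..c + k i}" for x
            using d(2)[of x] n[OF \<open>i \<ge> n\<close>] that by force
        qed (use kpos sub in auto)
        then show "\<exists>no. \<forall>n\<ge>no. norm ((LINT x:?U|lebesgue. u x * (hat ((x - c) / k n) / k n)) - u c) < e"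
          using \<open>e > 0\<close> by (intro exI[of _ n]) fastforce
      qed
      fix i
      have cc: "continuous_on {c..c + k i} (\<lambda>x. u x)" using u sub continuous_on_subset by blast
      have "compact ((\<lambda>x. u x - u c) ` {c..c + k i})"
        by (intro compact_continuous_image continuous_intros cc) auto
      then obtain e where "\<And>x. x \<in> {c..c + k i} \<Longrightarrow> \<bar>u x - u c\<bar> \<le> e"
        by (metis (no_types, lifting) bounded_iff compact_imp_bounded image_eqI real_norm_def)
      from hat_average(1)[OF kpos cc this sub]
      show "set_integrable lebesgue ?U (\<lambda>x. u x * (hat ((x - c) / k i) / k i))" .
    qed
    have "(LINT x:?U|lebesgue. u x * \<phi>' i x) = (LINT x:?U|lebesgue. u x * (hat ((x - a) / k i) / k i))
       - (LINT x:?U|lebesgue. u x * (hat ((x - b) / k i) / k i))" for i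
      unfolding \<phi>'_def right_diff_distrib
      using near[of a] near[of b] ab by (intro set_integral_diff(2)) auto
    then show ?thesis using near[of a] near[of b] ab by (auto intro!: tendsto_diff)
  qed
  have "(\<lambda>i. LINT x:?U|lebesgue. u x * \<phi>' i x) \<longlonglongrightarrow> - (LINT x:{a..b}|lebesgue. v x)"
    unfolding ident using R by (rule tendsto_minus)
  from LIMSEQ_unique[OF L this] show ?thesis by simp
qed


text \<open>Two weak derivatives have the same integral over every short interval, so the Lebesgue
  differentiation theorem identifies them almost everywhere. This makes the energy computable from any
  weak derivative, although \<open>weak_deriv\<close> is a choice.\<close>

lemma weak_deriv_unique:
  assumes v: "has_L2_weak_deriv {A<..<B} u v" and v': "has_L2_weak_deriv {A<..<B} u v'"
    and u: "continuous_on {A<..<B} u"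
  shows "AE x in lebesgue. x \<in> {A<..<B} \<longrightarrow> v x = v' x"
proof -
  let ?U = "{A<..<B}"
  define f where "f x = indicat_real ?U x *\<^sub>R (v x - v' x)" for x
  have iv: "set_integrable lebesgue ?U v" "set_integrable lebesgue ?U v'"
    using v v' by (auto intro!: L2_set_integrable simp: has_L2_weak_deriv_def)
  have sub: "set_integrable lebesgue {a..b} v" "set_integrable lebesgue {a..b} v'"
    if "A < a" "b < B" for a b
    using that by (auto intro!: set_integrable_subset[OF iv(1)] set_integrable_subset[OF iv(2)])
  have "set_integrable lebesgue ?U (\<lambda>x. v x - v' x)" using iv by (rule set_integral_diff(1))
  then have "integrable lebesgue f" unfolding f_def set_integrable_def .
  then have "f integrable_on UNIV" by (rule integrable_on_lebesgue)
  then have "\<And>a b. f integrable_on cbox a b" by (rule integrable_on_subcbox) simp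
  from integrable_ccontinuous_explicit[OF this] obtain N where N: "negligible N" and
    lim: "\<And>x e. \<lbrakk>x \<notin> N; 0 < e\<rbrakk> \<Longrightarrow> \<exists>d>0. \<forall>h. 0 < h \<and> h < d \<longrightarrow>
            norm(integral (cbox x (x + h *\<^sub>R One)) f /\<^sub>R h ^ DIM(real) - f x) < e" by blast
  have "v x = v' x" if x: "x \<in> ?U" "x \<notin> N" for x
  proof -
    have "\<bar>f x\<bar> < e" if "e > 0" for e
    proof -
      from lim[OF x(2) that] obtain d where d: "d > 0" "\<And>h. 0 < h \<Longrightarrow> h < d \<Longrightarrow>
        norm(integral (cbox x (x + h *\<^sub>R One)) f /\<^sub>R h ^ DIM(real) - f x) < e" by blast
      define h where "h = min (d/2) ((B - x)/2)"
      have h: "h > 0" "h < d" "x + h < B" using d x by (auto simp: h_def min_def field_simps)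
      have "integral {x..x+h} f = integral {x..x+h} (\<lambda>y. v y - v' y)"
        using x h by (intro integral_cong) (auto simp: f_def)
      also have "\<dots> = (LINT y:{x..x+h}|lebesgue. v y - v' y)"
        using x h by (intro set_lebesgue_integral_eq_integral(2)[symmetric] set_integral_diff(1) sub) auto
      also have "\<dots> = (LINT y:{x..x+h}|lebesgue. v y) - (LINT y:{x..x+h}|lebesgue. v' y)"
        using x h by (intro set_integral_diff(2) sub) auto
      also have "\<dots> = 0"
        using weak_deriv_FTC[OF v u, of x "x+h"] weak_deriv_FTC[OF v' u, of x "x+h"] x h by auto
      finally show ?thesis using d(2)[OF h(1,2)] by simp
    qed
    from this[of "\<bar>f x\<bar>"] have "f x = 0" by auto
    then show ?thesis using x by (simp add: f_def)
  qed
  moreover have "AE x in lebesgue. x \<notin> N"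
    using N by (intro AE_not_in) (simp add: negligible_iff_null_sets)
  ultimately show ?thesis by auto
qed

text \<open>The variance of \<open>v\<close> over the interval is nonnegative.\<close>

lemma set_integral_Cauchy_Schwarz_interval:
  fixes v :: "real \<Rightarrow> real"
  assumes "a < b" "set_integrable lebesgue {a..b} v" "set_integrable lebesgue {a..b} (\<lambda>x. (v x)\<^sup>2)"
  shows "(LINT x:{a..b}|lebesgue. v x)\<^sup>2 \<le> (b - a) * (LINT x:{a..b}|lebesgue. (v x)\<^sup>2)"
proof -
  define I where "I = (LINT x:{a..b}|lebesgue. v x)"
  define c where "c = I / (b - a)"
  have const: "set_integrable lebesgue {a..b} (\<lambda>x. c\<^sup>2)"
    by (intro absolutely_integrable_continuous_real continuous_intros)
  have i2: "set_integrable lebesgue {a..b} (\<lambda>x. 2 * c * v x)"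
    using assms(2) by simp
  have "0 \<le> (LINT x:{a..b}|lebesgue. (v x - c)\<^sup>2)"
    by (simp add: set_lebesgue_integral_def)
  also have "(\<lambda>x. (v x - c)\<^sup>2) = (\<lambda>x. (v x)\<^sup>2 - 2 * c * v x + c\<^sup>2)"
    by (simp add: power2_diff fun_eq_iff mult_ac)
  also have "(LINT x:{a..b}|lebesgue. (v x)\<^sup>2 - 2 * c * v x + c\<^sup>2)
     = (LINT x:{a..b}|lebesgue. (v x)\<^sup>2) - 2 * c * I + c\<^sup>2 * (b - a)"
    using assms const i2
    by (subst set_integral_add(2), (simp_all)[2])
      (subst set_integral_diff(2), (simp_all add: I_def)[3], simp add: set_lebesgue_integral_def)
  also have "\<dots> = (LINT x:{a..b}|lebesgue. (v x)\<^sup>2) - I\<^sup>2 / (b - a)"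
  proof -
    have "c * (b - a) = I" using \<open>a < b\<close> by (simp add: c_def)
    then have "c\<^sup>2 * (b - a) = c * I" by (simp add: power2_eq_square)
    moreover have "c * I = I\<^sup>2 / (b - a)" by (simp add: c_def power2_eq_square)
    ultimately show ?thesis by simp
  qed
  finally show ?thesis using \<open>a < b\<close> by (simp add: I_def[symmetric] field_simps)
qed

text \<open>Integration by parts: the fundamental theorem of calculus tolerates finitely many exceptional
  points, and a test function vanishes at both endpoints.\<close>

lemma piecewise_C1_weak_deriv:
  assumes "A < B" and u: "continuous_on {A..B} u" and S: "finite S"
    and D: "\<And>x. x \<in> {A<..<B} - S \<Longrightarrow> (u has_real_derivative w x) (at x)"
    and w: "w \<in> borel_measurable borel" and C: "\<And>x. \<bar>w x\<bar> \<le> C"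
  shows "has_L2_weak_deriv {A<..<B} u w"
proof -
  let ?U = "{A<..<B}"
  have wl: "w \<in> borel_measurable lebesgue" using w by (intro measurable_completion) simp
  have one: "integrable lebesgue (\<lambda>x. indicat_real ?U x * c)" for c :: real
    by (intro integrable_mult_left integrable_real_indicator) (use \<open>A < B\<close> in simp_all)
  have bint: "set_integrable lebesgue ?U (\<lambda>x. w x * g x)"
    if g: "g \<in> borel_measurable lebesgue" "\<And>x. x \<in> ?U \<Longrightarrow> \<bar>g x\<bar> \<le> K" for g K
    unfolding set_integrable_def
  proof (rule Bochner_Integration.integrable_bound[OF one[of "C * K"]])
    show "(\<lambda>x. indicat_real ?U x *\<^sub>R (w x * g x)) \<in> borel_measurable lebesgue"
      using wl g by (auto intro!: borel_measurable_scaleR borel_measurable_indicator borel_measurable_times)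
    have "\<bar>w x\<bar> * \<bar>g x\<bar> \<le> C * K" if "x \<in> ?U" for x
      using C[of x] g(2)[OF that] by (intro mult_mono) (auto intro: order_trans[OF abs_ge_zero])
    then have "norm (indicat_real ?U x *\<^sub>R (w x * g x)) \<le> norm (indicat_real ?U x * (C * K))" for x
      by (cases "x \<in> ?U") (auto simp: abs_mult intro: order_trans[OF _ abs_ge_self[of "C * K", unfolded abs_mult]])
    then show "AE x in lebesgue. norm (indicat_real ?U x *\<^sub>R (w x * g x)) \<le> norm (indicat_real ?U x * (C * K))"
      by simp
  qed
  have "set_integrable lebesgue ?U (\<lambda>x. w x * w x)" by (rule bint[OF wl C])
  then have "w \<in> L2 ?U"
    using borel_measurable_times[OF borel_measurable_indicator wl, of ?U]
    by (simp add: L2_def power2_eq_square set_borel_measurable_def)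
  moreover have "(LINT x:?U|lebesgue. u x * deriv \<phi> x) = - (LINT x:?U|lebesgue. w x * \<phi> x)"
    if phi: "\<phi> \<in> test_functions ?U" for \<phi>
  proof -
    from phi obtain \<phi>' where p: "\<And>x. (\<phi> has_real_derivative \<phi>' x) (at x)" "continuous_on UNIV \<phi>'"
      by (auto simp: test_functions_def C1_differentiable_on_def has_real_derivative_iff_has_vector_derivative)
    have dphi: "deriv \<phi> = \<phi>'" using p DERIV_imp_deriv by blast
    have zero: "\<phi> A = 0" "\<phi> B = 0"
      using phi closure_subset[of "{x. \<phi> x \<noteq> 0}"] by (auto simp: test_functions_def)
    have cphi: "continuous_on T \<phi>" for T using DERIV_continuous_on[of T \<phi> \<phi>'] p(1)
      by (meson has_field_derivative_at_within)
    have cphi': "continuous_on T \<phi>'" for T using p(2) continuous_on_subset by blast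
    have "((\<lambda>x. w x * \<phi> x + u x * \<phi>' x) has_integral (u B * \<phi> B - u A * \<phi> A)) {A..B}"
    proof (rule fundamental_theorem_of_calculus_interior_strong[OF S])
      show "((\<lambda>x. u x * \<phi> x) has_vector_derivative w x * \<phi> x + u x * \<phi>' x) (at x)" if "x \<in> {A<..<B} - S" for x
        using DERIV_mult[OF D[OF that] p(1)[of x]]
        by (simp add: has_real_derivative_iff_has_vector_derivative add.commute mult.commute)
      show "continuous_on {A..B} (\<lambda>x. u x * \<phi> x)" by (intro continuous_intros u cphi)
    qed (use \<open>A < B\<close> in simp)
    then have hk: "((\<lambda>x. w x * \<phi> x + u x * \<phi>' x) has_integral 0) ?U"
      by (simp add: zero has_integral_Icc_iff_Ioo)
    have "bounded (\<phi> ` {A..B})" by (intro compact_imp_bounded compact_continuous_image cphi) simp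
    then obtain K where K: "\<And>x. x \<in> {A..B} \<Longrightarrow> \<bar>\<phi> x\<bar> \<le> K"  unfolding bounded_iff real_norm_def by blast
    have "\<phi> \<in> borel_measurable borel" by (intro borel_measurable_continuous_onI cphi)
    then have "\<phi> \<in> borel_measurable lebesgue" by (intro measurable_completion) simp
    then have i1: "set_integrable lebesgue ?U (\<lambda>x. w x * \<phi> x)" using K by (intro bint[where K=K]) auto
    have "set_integrable lebesgue {A..B} (\<lambda>x. u x * \<phi>' x)"
      by (intro absolutely_integrable_continuous_real continuous_intros u cphi')
    then have i2: "set_integrable lebesgue ?U (\<lambda>x. u x * \<phi>' x)"
      by (rule set_integrable_subset) auto
    have "(LINT x:?U|lebesgue. w x * \<phi> x) + (LINT x:?U|lebesgue. u x * \<phi>' x)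
       = (LINT x:?U|lebesgue. w x * \<phi> x + u x * \<phi>' x)"
      by (rule set_integral_add(2)[symmetric, OF i1 i2])
    also have "\<dots> = integral ?U (\<lambda>x. w x * \<phi> x + u x * \<phi>' x)"
      by (intro set_lebesgue_integral_eq_integral set_integral_add(1) i1 i2)
    also have "\<dots> = 0" using hk by (rule integral_unique)
    finally show ?thesis by (simp add: dphi)
  qed
  ultimately show ?thesis by (simp add: has_L2_weak_deriv_def)
qed

lemma has_L2_weak_deriv_uminus:
  assumes "has_L2_weak_deriv U u v"
  shows "has_L2_weak_deriv U (\<lambda>x. - u x) (\<lambda>x. - v x)"
  using assms by (auto simp: has_L2_weak_deriv_def L2_def set_borel_measurable_def set_lebesgue_integral_def)

lemma has_L2_weak_deriv_weak_deriv:
  assumes "u \<in> H1 I"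
  shows "has_L2_weak_deriv (interior I) u (weak_deriv I u)"
proof -
  have "\<exists>v. has_L2_weak_deriv (interior I) u v" using assms by (simp add: H1_def)
  then show ?thesis unfolding weak_deriv_def by (rule someI_ex)
qed

lemma H1_uminus:
  assumes "u \<in> H1 I"
  shows "(\<lambda>x. - u x) \<in> H1 I"
  using assms has_L2_weak_deriv_uminus[OF has_L2_weak_deriv_weak_deriv[OF assms]]
  by (auto simp: H1_def L2_def set_borel_measurable_def intro: continuous_on_minus)

lemma weak_deriv_AE_eq:
  assumes u: "u \<in> H1 {A..B}" and v: "has_L2_weak_deriv {A<..<B} u v"
  shows "AE x in lebesgue. x \<in> {A<..<B} \<longrightarrow> weak_deriv {A..B} u x = v x"
proof (rule weak_deriv_unique[OF _ v])
  show "has_L2_weak_deriv {A<..<B} u (weak_deriv {A..B} u)"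
    using has_L2_weak_deriv_weak_deriv[OF u] by simp
  show "continuous_on {A<..<B} u"
  proof -
    have "continuous_on {A..B} u" using u by (simp add: H1_def)
    then show ?thesis by (rule continuous_on_subset) auto
  qed
qed

lemma weakly_differentiable_H1:
  assumes "A < B" and u: "continuous_on {A..B} u" and "has_L2_weak_deriv {A<..<B} u w"
  shows "u \<in> H1 {A..B}"
proof -
  have "set_integrable lebesgue {A..B} u" "set_integrable lebesgue {A..B} (\<lambda>x. (u x)\<^sup>2)"
    by (intro absolutely_integrable_continuous_real continuous_intros u)+
  then have "set_integrable lebesgue {A<..<B} u" "set_integrable lebesgue {A<..<B} (\<lambda>x. (u x)\<^sup>2)"
    by (auto elim!: set_integrable_subset)
  then have "u \<in> L2 {A<..<B}" by (auto simp: L2_def set_integrable_def set_borel_measurable_def)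
  then show ?thesis using assms by (auto simp: H1_def)
qed

lemma bounded_interval_shape:
  fixes I :: "real set"
  assumes "is_interval I" "bounded I" "interior I \<noteq> {}"
  obtains A B where "A < B" "interior I = {A<..<B}" "closure I = {A..B}" "frontier I = {A, B}"
    "{A<..<B} \<subseteq> I" "I \<subseteq> {A..B}" "midpoint_of I = (A + B) / 2"
proof -
  define A B where "A = Inf I" and "B = Sup I"
  have ne: "I \<noteq> {}" using assms(3) by auto
  have bdd: "bdd_below I" "bdd_above I" using assms(2) bounded_imp_bdd_above bounded_imp_bdd_below by auto
  have sub: "I \<subseteq> {A..B}" using bdd by (auto simp: A_def B_def cInf_lower cSup_upper)
  have sup: "{A<..<B} \<subseteq> I"
  proof
    fix x assume x: "x \<in> {A<..<B}"
    obtain y where y: "y \<in> I" "y < x" using x cInf_less_iff[OF ne bdd(1)] unfolding A_def by auto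
    obtain z where z: "z \<in> I" "x < z" using x less_cSup_iff[OF ne bdd(2)] unfolding B_def by auto
    show "x \<in> I" using mem_is_interval_1_I[OF assms(1) y(1) z(1)] y z by auto
  qed
  have int: "interior I = {A<..<B}"
  proof
    show "interior I \<subseteq> {A<..<B}" using interior_mono[OF sub] by simp
    show "{A<..<B} \<subseteq> interior I" using sup by (simp add: interior_maximal)
  qed
  then have AB: "A < B" using assms(3) by auto
  have cl: "closure I = {A..B}"
  proof
    show "closure I \<subseteq> {A..B}" using sub by (simp add: closure_minimal)
    show "{A..B} \<subseteq> closure I" using closure_mono[OF sup] AB by simp
  qed
  have "frontier I = {A, B}" using AB by (auto simp: frontier_def int cl)
  then show ?thesis using that[OF AB int cl _ sup sub] by (simp add: midpoint_of_def A_def B_def)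
qed

section \<open>The energy in a fixed environment\<close>

text \<open>The cell \<open>z\<close> of the checkerboard of mesh \<open>\<delta>\<close>.\<close>

definition scaled_cell :: "real \<Rightarrow> int \<Rightarrow> real set" where
  "scaled_cell \<delta> z = {\<delta> * (of_int z - 1/2) <..< \<delta> * (of_int z + 1/2)}"

lemma mem_scaled_cell:
  "\<delta> > 0 \<Longrightarrow> x / \<delta> \<in> {of_int z - 1/2 <..< of_int z + 1/2} \<longleftrightarrow> x \<in> scaled_cell \<delta> z"
  by (auto simp: scaled_cell_def field_simps)

lemma scaled_cell_disjoint:
  assumes "\<delta> > 0" "x \<in> scaled_cell \<delta> z" "x \<in> scaled_cell \<delta> z'"
  shows "z = z'"
proof -
  have "of_int z - 1/2 < x / \<delta>" "x / \<delta> < of_int z + 1/2" "of_int z' - 1/2 < x / \<delta>" "x / \<delta> < of_int z' + 1/2"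
    using assms by (auto simp: scaled_cell_def field_simps)
  then have "of_int z < (of_int z' + 1 :: real)" "of_int z' < (of_int z + 1 :: real)" by linarith+
  then show ?thesis by linarith
qed

lemma checkerboard_eq_sum:
  assumes "\<delta> > 0" "finite Z" "\<And>z. x \<in> scaled_cell \<delta> z \<Longrightarrow> z \<in> Z"
  shows "checkerboard \<theta> (x / \<delta>) = (\<Sum>z\<in>Z. \<theta> z * indicator (scaled_cell \<delta> z) x)"
proof -
  have ind: "indicat_real {real_of_int z - 1/2 <..< of_int z + 1/2} (x / \<delta>) = indicator (scaled_cell \<delta> z) x" for z
    using mem_scaled_cell[OF assms(1), of x z] by (auto simp: indicator_def)
  have "checkerboard \<theta> (x / \<delta>) = (\<Sum>\<^sub>\<infinity>z\<in>UNIV. \<theta> z * indicator (scaled_cell \<delta> z) x)"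
    by (simp add: checkerboard_def ind)
  also have "\<dots> = (\<Sum>\<^sub>\<infinity>z\<in>Z. \<theta> z * indicator (scaled_cell \<delta> z) x)"
    using assms(3) by (intro infsum_cong_neutral) (auto simp: indicator_def)
  finally show ?thesis using assms(2) by simp
qed

lemma checkerboard_in_cell:
  assumes "\<delta> > 0" "x \<in> scaled_cell \<delta> z"
  shows "checkerboard \<theta> (x / \<delta>) = \<theta> z"
  using assms checkerboard_eq_sum[of \<delta> "{z}" x \<theta>] scaled_cell_disjoint[of \<delta> x] by auto

lemma checkerboard_between_cells:
  assumes "\<delta> > 0" "\<And>z. x \<notin> scaled_cell \<delta> z"
  shows "checkerboard \<theta> (x / \<delta>) = 0"
  using assms checkerboard_eq_sum[of \<delta> "{}" x \<theta>] by auto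

lemma checkerboard_nonneg:
  assumes "\<delta> > 0" "\<And>z. \<theta> z \<ge> 0"
  shows "checkerboard \<theta> (x / \<delta>) \<ge> 0"
  using checkerboard_in_cell[OF assms(1), of x _ \<theta>] checkerboard_between_cells[OF assms(1), of x \<theta>] assms(2)
  by (cases "\<exists>z. x \<in> scaled_cell \<delta> z") auto

lemma checkerboard_le:
  assumes "\<delta> > 0" "\<And>z. 0 \<le> \<theta> z" "\<And>z. \<theta> z \<le> hi"
  shows "checkerboard \<theta> (x / \<delta>) \<le> hi"
  using checkerboard_in_cell[OF assms(1), of x _ \<theta>] checkerboard_between_cells[OF assms(1), of x \<theta>]
    assms(3) order_trans[OF assms(2,3)]
  by (cases "\<exists>z. x \<in> scaled_cell \<delta> z") auto

text \<open>Finitely many indices that cover the cells meeting the interval from \<open>A\<close> to \<open>B\<close>.\<close>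

definition cells :: "real \<Rightarrow> real \<Rightarrow> real \<Rightarrow> int set" where
  "cells \<delta> A B = {\<lfloor>A / \<delta>\<rfloor>..\<lceil>B / \<delta>\<rceil>}"

lemma cells_cover:
  assumes "\<delta> > 0" "x \<in> {A..B}" "x \<in> scaled_cell \<delta> z"
  shows "z \<in> cells \<delta> A B"
proof -
  have "A / \<delta> \<le> x / \<delta>" "x / \<delta> \<le> B / \<delta>" "of_int z - 1/2 < x / \<delta>" "x / \<delta> < of_int z + 1/2"
    using assms by (auto simp: scaled_cell_def field_simps)
  then show ?thesis unfolding cells_def atLeastAtMost_iff by linarith
qed

text \<open>Only finitely many cells meet the interval, so the energy is an affine function of finitely many
  of the values \<open>\<theta> z\<close>. The values may have any sign: measurability of the surface tension concerns
  all outcomes, also the null set on which the variables leave their bounds.\<close>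

lemma energy_density_integral:
  assumes "\<delta> > 0" and W: "continuous_on UNIV W" and u: "continuous_on {A..B} u"
    and v: "set_integrable lebesgue {A..B} (\<lambda>x. (v x)\<^sup>2)"
  shows "set_integrable lebesgue {A..B} (\<lambda>x. \<epsilon> / 2 * (v x)\<^sup>2 + 1 / \<epsilon> * checkerboard \<theta> (x / \<delta>) * W (u x))"
    and "(LINT x:{A..B}|lebesgue. \<epsilon> / 2 * (v x)\<^sup>2 + 1 / \<epsilon> * checkerboard \<theta> (x / \<delta>) * W (u x))
      = \<epsilon> / 2 * (LINT x:{A..B}|lebesgue. (v x)\<^sup>2)
        + (\<Sum>z\<in>cells \<delta> A B. \<theta> z * (1 / \<epsilon> * (LINT x:({A..B} \<inter> scaled_cell \<delta> z)|lebesgue. W (u x))))"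
proof -
  let ?C = "cells \<delta> A B"
  have Wu: "continuous_on {A..B} (\<lambda>x. W (u x))"
    by (rule continuous_on_compose2[OF W u]) auto
  have iW: "set_integrable lebesgue ({A..B} \<inter> scaled_cell \<delta> z) (\<lambda>x. W (u x))" for z
    by (rule set_integrable_subset[OF absolutely_integrable_continuous_real[OF Wu]])
      (auto simp: scaled_cell_def)
  let ?f = "\<lambda>x. \<epsilon> / 2 * (v x)\<^sup>2 + 1 / \<epsilon> * checkerboard \<theta> (x / \<delta>) * W (u x)"
  have eq: "indicat_real {A..B} x *\<^sub>R ?f x = \<epsilon> / 2 * (indicat_real {A..B} x *\<^sub>R (v x)\<^sup>2)
      + (\<Sum>z\<in>?C. \<theta> z * (1 / \<epsilon> * (indicat_real ({A..B} \<inter> scaled_cell \<delta> z) x *\<^sub>R W (u x))))" for x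
  proof (cases "x \<in> {A..B}")
    case True
    have cb: "checkerboard \<theta> (x / \<delta>) = (\<Sum>z\<in>?C. \<theta> z * indicator (scaled_cell \<delta> z) x)"
      using cells_cover[OF \<open>\<delta> > 0\<close> True] by (intro checkerboard_eq_sum \<open>\<delta> > 0\<close>) (auto simp: cells_def)
    show ?thesis using True unfolding cb
      by (simp add: sum_distrib_left sum_distrib_right sum_divide_distrib indicator_inter_arith mult_ac)
  qed (simp add: indicator_inter_arith)
  have i1: "integrable lebesgue (\<lambda>x. \<epsilon> / 2 * (indicat_real {A..B} x *\<^sub>R (v x)\<^sup>2))"
    using v unfolding set_integrable_def by (rule integrable_mult_right)
  have i2: "integrable lebesgue (\<lambda>x. \<theta> z * (1 / \<epsilon> * (indicat_real ({A..B} \<inter> scaled_cell \<delta> z) x *\<^sub>R W (u x))))" for z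
    using iW[of z] unfolding set_integrable_def by (intro integrable_mult_right)
  have i3: "integrable lebesgue (\<lambda>x. \<Sum>z\<in>?C. \<theta> z * (1 / \<epsilon> * (indicat_real ({A..B} \<inter> scaled_cell \<delta> z) x *\<^sub>R W (u x))))"
    by (rule Bochner_Integration.integrable_sum) (rule i2)
  show "set_integrable lebesgue {A..B} ?f"
    unfolding set_integrable_def eq by (rule Bochner_Integration.integrable_add[OF i1 i3])
  have "(LINT x:{A..B}|lebesgue. ?f x) = (LINT x|lebesgue. \<epsilon> / 2 * (indicat_real {A..B} x *\<^sub>R (v x)\<^sup>2))
     + (LINT x|lebesgue. (\<Sum>z\<in>?C. \<theta> z * (1 / \<epsilon> * (indicat_real ({A..B} \<inter> scaled_cell \<delta> z) x *\<^sub>R W (u x)))))"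
    unfolding set_lebesgue_integral_def eq by (rule Bochner_Integration.integral_add[OF i1 i3])
  also have "(LINT x|lebesgue. (\<Sum>z\<in>?C. \<theta> z * (1 / \<epsilon> * (indicat_real ({A..B} \<inter> scaled_cell \<delta> z) x *\<^sub>R W (u x)))))
     = (\<Sum>z\<in>?C. (LINT x|lebesgue. \<theta> z * (1 / \<epsilon> * (indicat_real ({A..B} \<inter> scaled_cell \<delta> z) x *\<^sub>R W (u x)))))"
    by (rule Bochner_Integration.integral_sum[OF i2])
  finally show "(LINT x:{A..B}|lebesgue. ?f x) = \<epsilon> / 2 * (LINT x:{A..B}|lebesgue. (v x)\<^sup>2)
        + (\<Sum>z\<in>?C. \<theta> z * (1 / \<epsilon> * (LINT x:({A..B} \<inter> scaled_cell \<delta> z)|lebesgue. W (u x))))"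
    unfolding set_lebesgue_integral_def by simp
qed

lemma set_integral_endpoints:
  fixes f :: "real \<Rightarrow> real"
  assumes "{A<..<B} \<subseteq> I" "I \<subseteq> {A..B}"
  shows "(LINT x:I|lebesgue. f x) = (LINT x:{A<..<B}|lebesgue. f x)"
    and "set_integrable lebesgue I f \<longleftrightarrow> set_integrable lebesgue {A<..<B} f"
proof -
  have eq: "indicat_real I x *\<^sub>R f x = indicat_real {A<..<B} x *\<^sub>R f x" if "x \<notin> {A, B}" for x
  proof -
    have "x \<in> I \<longleftrightarrow> x \<in> {A<..<B}" using assms that by force
    then show ?thesis by (simp add: indicator_def)
  qed
  show "(LINT x:I|lebesgue. f x) = (LINT x:{A<..<B}|lebesgue. f x)"
    unfolding set_lebesgue_integral_def
    by (rule integral_discrete_difference[where X="{A,B}"]) (use eq in auto)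
  show "set_integrable lebesgue I f \<longleftrightarrow> set_integrable lebesgue {A<..<B} f"
    unfolding set_integrable_def
    by (rule integrable_discrete_difference[where X="{A,B}"]) (use eq in auto)
qed

lemma H1_weak_deriv_square_integrable:
  assumes "u \<in> H1 {A..B}"
  shows "set_integrable lebesgue {A..B} (\<lambda>x. (weak_deriv {A..B} u x)\<^sup>2)"
  using has_L2_weak_deriv_weak_deriv[OF assms] set_integral_endpoints(2)[of A B "{A..B}"]
  by (auto simp: has_L2_weak_deriv_def L2_def greaterThanLessThan_subseteq_atLeastAtMost_iff)

lemma H1_continuous: "u \<in> H1 {A..B} \<Longrightarrow> continuous_on {A..B} (u :: real \<Rightarrow> real)"
  by (simp add: H1_def)

text \<open>Endpoints carry no mass, and function space, boundary and midpoint depend on the interval only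
  through its interior and closure; so it may be taken closed.\<close>

lemma surface_tension_interval:
  assumes "interior I = {A<..<B}" "closure I = {A..B}" "frontier I = {A, B}" "{A<..<B} \<subseteq> I" "I \<subseteq> {A..B}"
    "midpoint_of I = (A + B) / 2" "A < B"
  shows "surface_tension W q \<theta> \<epsilon> \<delta> n I = surface_tension W q \<theta> \<epsilon> \<delta> n {A..B}"
    "admissible q \<epsilon> n {A..B} = {u \<in> H1 {A..B}. u A = q ((A - B) / 2 * n / \<epsilon>) \<and> u B = q ((B - A) / 2 * n / \<epsilon>)}"
proof -
  have H: "H1 I = H1 {A..B}" by (simp add: H1_def assms)
  have fr: "frontier {A..B} = {A, B}" using assms(7) by (auto simp: frontier_def)
  have mid: "midpoint_of {A..B} = (A + B) / 2" using assms(7) by (simp add: midpoint_of_def)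
  have "energy W \<theta> \<epsilon> \<delta> I u = energy W \<theta> \<epsilon> \<delta> {A..B} u" for u
  proof -
    have "weak_deriv I u = weak_deriv {A..B} u" by (simp add: weak_deriv_def assms)
    then show ?thesis unfolding energy_def
      using set_integral_endpoints(1)[OF assms(4,5)] set_integral_endpoints(1)[of A B "{A..B}"]
      by (simp add: greaterThanLessThan_subseteq_atLeastAtMost_iff)
  qed
  then show "surface_tension W q \<theta> \<epsilon> \<delta> n I = surface_tension W q \<theta> \<epsilon> \<delta> n {A..B}"
    by (simp add: surface_tension_def admissible_def H assms fr mid)
  have two: "(\<forall>y\<in>{A, B}. P y) = (P A \<and> P B)" for P by simp
  have m: "A - (A + B) / 2 = (A - B) / 2" "B - (A + B) / 2 = (B - A) / 2" by (simp_all add: field_simps)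
  show "admissible q \<epsilon> n {A..B} = {u \<in> H1 {A..B}. u A = q ((A - B) / 2 * n / \<epsilon>) \<and> u B = q ((B - A) / 2 * n / \<epsilon>)}"
    unfolding admissible_def fr mid two m ..
qed

lemma energy_expand:
  assumes "\<delta> > 0" "continuous_on UNIV W" "u \<in> H1 {A..B}"
  shows "energy W \<theta> \<epsilon> \<delta> {A..B} u = \<epsilon> / 2 * (LINT x:{A..B}|lebesgue. (weak_deriv {A..B} u x)\<^sup>2)
        + (\<Sum>z\<in>cells \<delta> A B. \<theta> z * (1 / \<epsilon> * (LINT x:({A..B} \<inter> scaled_cell \<delta> z)|lebesgue. W (u x))))"
  unfolding energy_def
  by (rule energy_density_integral(2)[OF assms(1,2) H1_continuous H1_weak_deriv_square_integrable]) (rule assms(3))+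

text \<open>An uncountable infimum of continuous functions is upper semicontinuous, so its strict sublevel sets
  are open. Where the family is unbounded below, the real-valued infimum is a fixed default value, and
  these points form a countable intersection of open sets.\<close>

lemma borel_measurable_INF_continuous:
  fixes F :: "'i \<Rightarrow> 'b::topological_space \<Rightarrow> real"
  assumes cont: "\<And>u. u \<in> D \<Longrightarrow> continuous_on UNIV (F u)"
  shows "(\<lambda>\<theta>. INF u\<in>D. F u \<theta>) \<in> borel_measurable borel"
proof (cases "D = {}")
  case True
  then show ?thesis by simp
next
  case False
  define U where "U c = (\<Union>u\<in>D. {\<theta>. F u \<theta> < c})" for c
  have U: "U c \<in> sets borel" for c
    unfolding U_def using cont by (intro borel_open open_UN) (auto intro!: open_Collect_less continuous_intros)
  define G where "G = (\<Inter>n::nat. U (- real n))"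
  have G: "G \<in> sets borel" unfolding G_def using U by (intro sets.countable_INT) auto
  have unb: "\<theta> \<in> G \<longleftrightarrow> \<not> bdd_below ((\<lambda>u. F u \<theta>) ` D)" for \<theta>
  proof -
    have "\<theta> \<in> G \<longleftrightarrow> (\<forall>c. \<exists>u\<in>D. F u \<theta> < c)"
    proof
      assume g: "\<theta> \<in> G"
      show "\<forall>c. \<exists>u\<in>D. F u \<theta> < c"
      proof
        fix c
        obtain n :: nat where "- c \<le> real n" using real_arch_simple by blast
        moreover from g obtain u where "u \<in> D" "F u \<theta> < - real n" unfolding G_def U_def by blast
        ultimately show "\<exists>u\<in>D. F u \<theta> < c" by (intro bexI[of _ u]) auto
      qed
    qed (auto simp: G_def U_def)
    then show ?thesis by (auto simp: bdd_below_def not_le)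
  qed
  \<comment> \<open>The infimum of every set that is unbounded below is this same value.\<close>
  define k where "k = (Inf (UNIV :: real set))"
  have k: "(INF u\<in>D. F u \<theta>) = k" if "\<theta> \<in> G" for \<theta>
  proof -
    have "\<not> (\<exists>z. \<forall>x\<in>uminus ` (\<lambda>u. F u \<theta>) ` D. x \<le> z)" "\<not> (\<exists>z. \<forall>x\<in>uminus ` (UNIV::real set). x \<le> z)"
      using that unfolding unb by (auto simp: bdd_below_def) (metis minus_le_iff, meson gt_ex not_le)
    then have "(\<lambda>z. \<forall>x\<in>uminus ` (\<lambda>u. F u \<theta>) ` D. x \<le> z) = (\<lambda>z. \<forall>x\<in>uminus ` (UNIV::real set). x \<le> z)"
      by (auto simp: fun_eq_iff)
    then show ?thesis unfolding k_def Inf_real_def Sup_real_def by simp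
  qed
  show ?thesis
  proof (rule borel_measurableI_less)
    fix c :: real
    have "{\<theta> \<in> space borel. (INF u\<in>D. F u \<theta>) < c} = (U c - G) \<union> (if k < c then G else {})"
    proof -
      have "(INF u\<in>D. F u \<theta>) < c \<longleftrightarrow> \<theta> \<in> U c" if "\<theta> \<notin> G" for \<theta>
        using that False unfolding unb by (subst cINF_less_iff) (auto simp: U_def)
      then show ?thesis using k by auto
    qed
    also have "\<dots> \<in> sets borel" using U G by auto
    finally show "{\<theta> \<in> space borel. (INF u\<in>D. F u \<theta>) < c} \<in> sets borel" .
  qed
qed

text \<open>The energy of each competitor is continuous in the environment for the product topology, by
  \<open>energy_expand\<close>.\<close>

lemma borel_measurable_surface_tension:
  fixes \<Theta> :: "int \<Rightarrow> 'a \<Rightarrow> real"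
  assumes "\<delta> > 0" "continuous_on UNIV W" "\<And>z. \<Theta> z \<in> borel_measurable M"
  shows "(\<lambda>\<omega>. surface_tension W q (\<lambda>z. \<Theta> z \<omega>) \<epsilon> \<delta> n {A..B}) \<in> borel_measurable M"
proof -
  have "(\<lambda>\<theta>. surface_tension W q \<theta> \<epsilon> \<delta> n {A..B}) \<in> borel_measurable borel"
    unfolding surface_tension_def
  proof (rule borel_measurable_INF_continuous)
    fix u assume "u \<in> admissible q \<epsilon> n {A..B}"
    then have u: "u \<in> H1 {A..B}" by (simp add: admissible_def)
    show "continuous_on UNIV (\<lambda>\<theta>. energy W \<theta> \<epsilon> \<delta> {A..B} u)"
      unfolding energy_expand[OF assms(1,2) u]
      by (intro continuous_intros continuous_on_product_coordinates)
  qed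
  moreover have "(\<lambda>\<omega> z. \<Theta> z \<omega>) \<in> borel_measurable M"
    by (rule measurable_coordinatewise_then_product) (rule assms(3))
  ultimately show ?thesis by (rule measurable_compose[rotated])
qed


lemma set_integral_ge_disjoint_sum:
  fixes f :: "real \<Rightarrow> real"
  assumes int: "set_integrable lebesgue U f" and nn: "\<And>x. f x \<ge> 0"
    and J: "finite J" "\<And>j. j \<in> J \<Longrightarrow> S j \<in> sets lebesgue" "\<And>j. j \<in> J \<Longrightarrow> S j \<subseteq> U"
    and disj: "\<And>i j x. i \<in> J \<Longrightarrow> j \<in> J \<Longrightarrow> x \<in> S i \<Longrightarrow> x \<in> S j \<Longrightarrow> i = j"
  shows "(\<Sum>j\<in>J. LINT x:S j|lebesgue. f x) \<le> (LINT x:U|lebesgue. f x)"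
proof -
  have ij: "integrable lebesgue (\<lambda>x. indicat_real (S j) x *\<^sub>R f x)" if "j \<in> J" for j
    using set_integrable_subset[OF int J(2,3)[OF that]] by (simp add: set_integrable_def)
  have "(\<Sum>j\<in>J. LINT x:S j|lebesgue. f x) = (LINT x|lebesgue. (\<Sum>j\<in>J. indicat_real (S j) x *\<^sub>R f x))"
    unfolding set_lebesgue_integral_def by (rule Bochner_Integration.integral_sum[OF ij, symmetric])
  also have "\<dots> \<le> (LINT x|lebesgue. indicat_real U x *\<^sub>R f x)"
  proof (rule integral_mono)
    show "integrable lebesgue (\<lambda>x. \<Sum>j\<in>J. indicat_real (S j) x *\<^sub>R f x)"
      by (rule Bochner_Integration.integrable_sum[OF ij])
    show "integrable lebesgue (\<lambda>x. indicat_real U x *\<^sub>R f x)" using int by (simp add: set_integrable_def)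
    fix x
    show "(\<Sum>j\<in>J. indicat_real (S j) x *\<^sub>R f x) \<le> indicat_real U x *\<^sub>R f x"
    proof (cases "\<exists>j\<in>J. x \<in> S j")
      case True
      then obtain j where j: "j \<in> J" "x \<in> S j" by blast
      have "(\<Sum>i\<in>J. indicat_real (S i) x *\<^sub>R f x) = (\<Sum>i\<in>J. if i = j then f x else 0)"
      proof (rule sum.cong)
        fix i assume i: "i \<in> J"
        have "x \<in> S i \<longleftrightarrow> i = j" using disj[OF i j(1)] j(2) by blast
        then show "indicat_real (S i) x *\<^sub>R f x = (if i = j then f x else 0)" by (simp add: indicator_def)
      qed simp
      also have "\<dots> = f x" using j J(1) by simp
      also have "\<dots> = indicat_real U x *\<^sub>R f x" using j J(3)[OF j(1)] by (auto simp: indicator_def)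
      finally show ?thesis by simp
    next
      case False
      then have "(\<Sum>i\<in>J. indicat_real (S i) x *\<^sub>R f x) = 0" by (intro sum.neutral) (auto simp: indicator_def)
      then show ?thesis using nn[of x] by simp
    qed
  qed
  finally show ?thesis by (simp add: set_lebesgue_integral_def)
qed

abbreviation energy_density ::
  "(real \<Rightarrow> real) \<Rightarrow> (int \<Rightarrow> real) \<Rightarrow> real \<Rightarrow> real \<Rightarrow> (real \<Rightarrow> real) \<Rightarrow> (real \<Rightarrow> real) \<Rightarrow> real \<Rightarrow> real" where
  "energy_density W \<theta> \<epsilon> \<delta> u v x \<equiv> \<epsilon> / 2 * (v x)\<^sup>2 + 1 / \<epsilon> * checkerboard \<theta> (x / \<delta>) * W (u x)"

lemma set_integral_Ioo_Icc:
  fixes f :: "real \<Rightarrow> real"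
  shows "(LINT x:{a..b}|lebesgue. f x) = (LINT x:{a<..<b}|lebesgue. f x)"
    "set_integrable lebesgue {a..b} f \<longleftrightarrow> set_integrable lebesgue {a<..<b} f"
  by (rule set_integral_endpoints; auto)+

lemma set_integral_const_cell:
  assumes "\<delta> > 0"
  shows "(LINT x:scaled_cell \<delta> z|lebesgue. c) = \<delta> * (c::real)"
proof -
  have "(LINT x:scaled_cell \<delta> z|lebesgue. c) = measure lebesgue (scaled_cell \<delta> z) * c"
    by (simp add: scaled_cell_def set_lebesgue_integral_def)
  also have "measure lebesgue (scaled_cell \<delta> z) = \<delta>"
    using assms by (simp add: scaled_cell_def algebra_simps)
  finally show ?thesis .
qed

text \<open>On a stretch where \<open>W (u x)\<close> is at least \<open>w\<close>, the gradient part is at least that of the affine function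
  with the same end values (Cauchy-Schwarz), and the potential part is at least \<open>w\<close> times the integral of
  the coefficient over the whole cells inside.\<close>

lemma energy_slab_lower:
  assumes u: "u \<in> H1 {A..B}" and ab: "A < a" "a < b" "b < B" and pos: "\<epsilon> > 0" "\<delta> > 0"
    and W: "continuous_on UNIV W" "\<And>s. W s \<ge> 0" and \<theta>: "\<And>z. \<theta> z \<ge> 0"
    and w: "w \<ge> 0" "\<And>x. x \<in> {a<..<b} \<Longrightarrow> w \<le> W (u x)"
    and K: "finite K" "\<And>z. z \<in> K \<Longrightarrow> scaled_cell \<delta> z \<subseteq> {a<..<b}"
  shows "\<epsilon> * (u b - u a)\<^sup>2 / (2 * (b - a)) + \<delta> / \<epsilon> * w * (\<Sum>z\<in>K. \<theta> z)
    \<le> (LINT x:{a<..<b}|lebesgue. energy_density W \<theta> \<epsilon> \<delta> u (weak_deriv {A..B} u) x)"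
proof -
  define v where "v = weak_deriv {A..B} u"
  have cu: "continuous_on {A..B} u" using u by (rule H1_continuous)
  have v2: "set_integrable lebesgue {A..B} (\<lambda>x. (v x)\<^sup>2)"
    unfolding v_def by (rule H1_weak_deriv_square_integrable[OF u])
  have wd: "has_L2_weak_deriv {A<..<B} u v" using has_L2_weak_deriv_weak_deriv[OF u] by (simp add: v_def)
  have "set_integrable lebesgue {A<..<B} v"
    using wd by (intro L2_set_integrable) (auto simp: has_L2_weak_deriv_def)
  then have v1: "set_integrable lebesgue {a..b} v" by (rule set_integrable_subset) (use ab in auto)
  have v2ab: "set_integrable lebesgue {a..b} (\<lambda>x. (v x)\<^sup>2)"
    by (rule set_integrable_subset[OF v2]) (use ab in auto)
  have "u b - u a = (LINT x:{a..b}|lebesgue. v x)"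
    by (rule weak_deriv_FTC[OF wd continuous_on_subset[OF cu] ab]) auto
  then have "(u b - u a)\<^sup>2 \<le> (b - a) * (LINT x:{a..b}|lebesgue. (v x)\<^sup>2)"
    using set_integral_Cauchy_Schwarz_interval[OF ab(2) v1 v2ab] by simp
  then have "(u b - u a)\<^sup>2 / (b - a) \<le> (LINT x:{a<..<b}|lebesgue. (v x)\<^sup>2)"
    using ab by (simp add: field_simps set_integral_Ioo_Icc)
  then have "\<epsilon> / 2 * ((u b - u a)\<^sup>2 / (b - a)) \<le> \<epsilon> / 2 * (LINT x:{a<..<b}|lebesgue. (v x)\<^sup>2)"
    using pos by (intro mult_left_mono) auto
  moreover have "\<epsilon> / 2 * ((u b - u a)\<^sup>2 / (b - a)) = \<epsilon> * (u b - u a)\<^sup>2 / (2 * (b - a))" by simp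
  ultimately have kin: "\<epsilon> * (u b - u a)\<^sup>2 / (2 * (b - a)) \<le> \<epsilon> / 2 * (LINT x:{a<..<b}|lebesgue. (v x)\<^sup>2)" by simp
  let ?p = "\<lambda>x. 1 / \<epsilon> * checkerboard \<theta> (x / \<delta>) * W (u x)"
  have iv: "set_integrable lebesgue {a<..<b} (\<lambda>x. \<epsilon> / 2 * (v x)\<^sup>2)"
    using v2ab by (simp add: set_integral_Ioo_Icc)
  have "set_integrable lebesgue {a..b} (energy_density W \<theta> \<epsilon> \<delta> u v)"
    by (rule energy_density_integral(1)[OF pos(2) W(1) continuous_on_subset[OF cu] v2ab]) (use ab in auto)
  then have "set_integrable lebesgue {a<..<b} (\<lambda>x. energy_density W \<theta> \<epsilon> \<delta> u v x - \<epsilon> / 2 * (v x)\<^sup>2)"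
    unfolding set_integral_Ioo_Icc(2) using iv by (rule set_integral_diff(1))
  then have ip: "set_integrable lebesgue {a<..<b} ?p" by simp
  have split: "(LINT x:{a<..<b}|lebesgue. energy_density W \<theta> \<epsilon> \<delta> u v x)
     = \<epsilon> / 2 * (LINT x:{a<..<b}|lebesgue. (v x)\<^sup>2) + (LINT x:{a<..<b}|lebesgue. ?p x)"
    using set_integral_add(2)[OF iv ip] by simp
  have cb: "checkerboard \<theta> (x / \<delta>) \<ge> 0" for x
    by (rule checkerboard_nonneg[OF pos(2) \<theta>])
  have "\<delta> / \<epsilon> * w * (\<Sum>z\<in>K. \<theta> z) = (\<Sum>z\<in>K. \<delta> / \<epsilon> * w * \<theta> z)" by (rule sum_distrib_left)
  also have "\<dots> \<le> (\<Sum>z\<in>K. LINT x:scaled_cell \<delta> z|lebesgue. ?p x)"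
  proof (rule sum_mono)
    fix z assume z: "z \<in> K"
    have "(LINT x:scaled_cell \<delta> z|lebesgue. 1 / \<epsilon> * \<theta> z * w) = \<delta> * (1 / \<epsilon> * \<theta> z * w)"
      by (rule set_integral_const_cell[OF pos(2)])
    then have "\<delta> / \<epsilon> * w * \<theta> z = (LINT x:scaled_cell \<delta> z|lebesgue. 1 / \<epsilon> * \<theta> z * w)"
      by (simp only: mult_ac divide_inverse)
    also have "\<dots> \<le> (LINT x:scaled_cell \<delta> z|lebesgue. ?p x)"
    proof (rule set_integral_mono)
      show "set_integrable lebesgue (scaled_cell \<delta> z) (\<lambda>x. 1 / \<epsilon> * \<theta> z * w)"
        unfolding scaled_cell_def set_integral_Ioo_Icc(2)[symmetric]
        by (intro absolutely_integrable_continuous_real continuous_intros)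
      show "set_integrable lebesgue (scaled_cell \<delta> z) ?p"
        by (rule set_integrable_subset[OF ip _ K(2)[OF z]]) (simp add: scaled_cell_def)
      fix x assume x: "x \<in> scaled_cell \<delta> z"
      have "w \<le> W (u x)" using x K(2)[OF z] w(2) by blast
      then show "1 / \<epsilon> * \<theta> z * w \<le> ?p x"
        using pos \<theta>[of z] by (simp add: checkerboard_in_cell[OF pos(2) x] mult_left_mono divide_right_mono)
    qed
    finally show "\<delta> / \<epsilon> * w * \<theta> z \<le> (LINT x:scaled_cell \<delta> z|lebesgue. ?p x)" .
  qed
  also have "\<dots> \<le> (LINT x:{a<..<b}|lebesgue. ?p x)"
  proof (rule set_integral_ge_disjoint_sum[OF ip _ K(1)])
    show "0 \<le> ?p x" for x using pos cb[of x] W(2)[of "u x"] by simp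
    show "scaled_cell \<delta> z \<in> sets lebesgue" for z by (simp add: scaled_cell_def)
    show "scaled_cell \<delta> z \<subseteq> {a<..<b}" if "z \<in> K" for z by (rule K(2)[OF that])
  qed (rule scaled_cell_disjoint[OF pos(2)])
  finally show ?thesis using kin unfolding split v_def[symmetric] by linarith
qed

text \<open>Away from the wells the potential energy is proportional to length, so bounded energy bounds the
  length of a transition by a multiple of \<open>\<epsilon>\<close>. Almost every point lies in a cell, where the
  coefficient is at least \<open>lo\<close>.\<close>

lemma potential_length_bound:
  assumes u: "u \<in> H1 {A..B}" and ab: "A < a" "a < b" "b < B" and pos: "\<epsilon> > 0" "\<delta> > 0"
    and W: "continuous_on UNIV W" "\<And>s. W s \<ge> 0" and \<theta>: "\<And>z. \<theta> z \<ge> lo" "lo \<ge> 0"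
    and w: "w \<ge> 0" "\<And>x. x \<in> {a<..<b} \<Longrightarrow> w \<le> W (u x)"
  shows "lo * w / \<epsilon> * (b - a) \<le> energy W \<theta> \<epsilon> \<delta> {A..B} u"
proof -
  define v where "v = weak_deriv {A..B} u"
  let ?e = "energy_density W \<theta> \<epsilon> \<delta> u v"
  have ie: "set_integrable lebesgue {A..B} ?e"
    unfolding v_def
    by (rule energy_density_integral(1)[OF pos(2) W(1) H1_continuous H1_weak_deriv_square_integrable]) (rule u)+
  have iab: "set_integrable lebesgue {a<..<b} ?e" by (rule set_integrable_subset[OF ie]) (use ab in auto)
  have cb: "checkerboard \<theta> (x / \<delta>) \<ge> 0" for x
    by (rule checkerboard_nonneg[OF pos(2) order_trans[OF \<theta>(2) \<theta>(1)]])
  have nn: "?e x \<ge> 0" for x using pos cb W by simp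
  define N where "N = range (\<lambda>z::int. \<delta> * (of_int z + 1/2))"
  have "AE x in lebesgue. x \<notin> N"
    unfolding N_def by (intro AE_not_in null_sets_completionI countable_imp_null_set_lborel) simp
  moreover have incell: "\<exists>z. x \<in> scaled_cell \<delta> z" if "x \<notin> N" for x
  proof -
    define z where "z = \<lceil>x / \<delta> - 1/2\<rceil>"
    have 1: "x / \<delta> - 1/2 \<le> of_int z" "of_int z < x / \<delta> - 1/2 + 1" unfolding z_def by linarith+
    have "x \<noteq> \<delta> * (of_int z + 1/2)" using that by (auto simp: N_def)
    then have "x / \<delta> \<noteq> of_int z + 1/2" using pos by (auto simp: field_simps)
    then have "x / \<delta> < of_int z + 1/2" "of_int z - 1/2 < x / \<delta>" using 1 by linarith+
    then show ?thesis using pos by (auto simp: scaled_cell_def field_simps intro!: exI[of _ z])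
  qed
  ultimately have ae: "AE x in lebesgue. checkerboard \<theta> (x / \<delta>) \<ge> lo"
    by (auto elim!: eventually_mono) (metis incell checkerboard_in_cell pos(2) \<theta>(1))
  have "lo * w / \<epsilon> * (b - a) = (LINT x:{a<..<b}|lebesgue. lo * w / \<epsilon>)"
    using ab by (simp add: set_lebesgue_integral_def)
  also have "\<dots> \<le> (LINT x:{a<..<b}|lebesgue. ?e x)"
    unfolding set_lebesgue_integral_def
  proof (rule integral_mono_AE)
    show "integrable lebesgue (\<lambda>x. indicat_real {a<..<b} x *\<^sub>R (lo * w / \<epsilon>))"
      using ab by (intro integrable_scaleR_left integrable_real_indicator) auto
    show "integrable lebesgue (\<lambda>x. indicat_real {a<..<b} x *\<^sub>R ?e x)" using iab by (simp add: set_integrable_def)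
    show "AE x in lebesgue. indicat_real {a<..<b} x *\<^sub>R (lo * w / \<epsilon>) \<le> indicat_real {a<..<b} x *\<^sub>R ?e x"
      using ae
    proof (rule eventually_mono)
      fix x assume x: "lo \<le> checkerboard \<theta> (x / \<delta>)"
      show "indicat_real {a<..<b} x *\<^sub>R (lo * w / \<epsilon>) \<le> indicat_real {a<..<b} x *\<^sub>R ?e x"
      proof (cases "x \<in> {a<..<b}")
        case True
        have "lo * w \<le> checkerboard \<theta> (x / \<delta>) * W (u x)"
          using x w True \<theta>(2) cb by (intro mult_mono) auto
        then have "lo * w / \<epsilon> \<le> checkerboard \<theta> (x / \<delta>) * W (u x) / \<epsilon>" using pos by (simp add: divide_right_mono)
        moreover have "0 \<le> \<epsilon> / 2 * (v x)\<^sup>2" using pos by simp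
        ultimately show ?thesis using True by simp
      qed simp
    qed
  qed
  also have "\<dots> \<le> (LINT x:{A..B}|lebesgue. ?e x)"
  proof -
    have "{a<..<b} \<subseteq> {A..B}" using ab by auto
    then show ?thesis using set_integral_ge_disjoint_sum[OF ie nn, of "{0::nat}" "\<lambda>_. {a<..<b}"] by simp
  qed
  finally show ?thesis by (simp add: energy_def v_def)
qed

section \<open>Piecewise smooth competitors\<close>

text \<open>A piecewise smooth function from the value \<open>p\<close> at \<open>a\<close> to \<open>q\<close> at \<open>b\<close> of energy at most \<open>e\<close>. In this form
  competitors can be concatenated, with energies adding up, before any weak derivative is taken.\<close>

definition path_within ::
  "(real \<Rightarrow> real) \<Rightarrow> (int \<Rightarrow> real) \<Rightarrow> real \<Rightarrow> real \<Rightarrow> real \<Rightarrow> real \<Rightarrow> real \<Rightarrow> real \<Rightarrow> real \<Rightarrow> bool" where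
  "path_within W \<theta> \<epsilon> \<delta> a b p q e \<longleftrightarrow> (\<exists>u w S C. continuous_on {a..b} u \<and> finite S \<and>
     (\<forall>x\<in>{a<..<b} - S. (u has_real_derivative w x) (at x)) \<and> w \<in> borel_measurable borel \<and>
     (\<forall>x. \<bar>w x\<bar> \<le> (C::real)) \<and> u a = p \<and> u b = q \<and>
     (LINT x:{a..b}|lebesgue. energy_density W \<theta> \<epsilon> \<delta> u w x) \<le> e)"

lemma bounded_square_set_integrable:
  fixes w :: "real \<Rightarrow> real"
  assumes "w \<in> borel_measurable borel" "\<And>x. \<bar>w x\<bar> \<le> C"
  shows "set_integrable lebesgue {a..b} (\<lambda>x. (w x)\<^sup>2)"
  unfolding set_integrable_def
proof (rule Bochner_Integration.integrable_bound)
  have "set_integrable lebesgue {a..b} (\<lambda>x. C\<^sup>2)"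
    by (intro absolutely_integrable_continuous_real continuous_intros)
  then show "integrable lebesgue (\<lambda>x. indicat_real {a..b} x *\<^sub>R C\<^sup>2)" by (simp add: set_integrable_def)
  have "(\<lambda>x. indicat_real {a..b} x *\<^sub>R (w x)\<^sup>2) \<in> borel_measurable borel"
    using assms(1) by measurable
  then show "(\<lambda>x. indicat_real {a..b} x *\<^sub>R (w x)\<^sup>2) \<in> borel_measurable lebesgue"
    by (intro measurable_completion) simp
  have "(w x)\<^sup>2 \<le> C\<^sup>2" for x using assms(2)[of x] by (metis abs_ge_zero order_trans abs_le_square_iff abs_of_nonneg)
  then show "AE x in lebesgue. norm (indicat_real {a..b} x *\<^sub>R (w x)\<^sup>2) \<le> norm (indicat_real {a..b} x *\<^sub>R C\<^sup>2)"
    by (auto simp: indicator_def)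
qed

lemma path_within_join:
  assumes p1: "path_within W \<theta> \<epsilon> \<delta> a b p q e1" and p2: "path_within W \<theta> \<epsilon> \<delta> b c q r e2"
    and "a < b" "b < c" "\<delta> > 0" and W: "continuous_on UNIV W"
  shows "path_within W \<theta> \<epsilon> \<delta> a c p r (e1 + e2)"
proof -
  from p1 obtain u1 w1 S1 C1 where 1: "continuous_on {a..b} u1" "finite S1"
     "\<And>x. x\<in>{a<..<b} - S1 \<Longrightarrow> (u1 has_real_derivative w1 x) (at x)" "w1 \<in> borel_measurable borel"
     "\<And>x. \<bar>w1 x\<bar> \<le> C1" "u1 a = p" "u1 b = q"
     "(LINT x:{a..b}|lebesgue. energy_density W \<theta> \<epsilon> \<delta> u1 w1 x) \<le> e1" unfolding path_within_def by blast
  from p2 obtain u2 w2 S2 C2 where 2: "continuous_on {b..c} u2" "finite S2"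
     "\<And>x. x\<in>{b<..<c} - S2 \<Longrightarrow> (u2 has_real_derivative w2 x) (at x)" "w2 \<in> borel_measurable borel"
     "\<And>x. \<bar>w2 x\<bar> \<le> C2" "u2 b = q" "u2 c = r"
     "(LINT x:{b..c}|lebesgue. energy_density W \<theta> \<epsilon> \<delta> u2 w2 x) \<le> e2" unfolding path_within_def by blast
  define u where "u x = (if x \<le> b then u1 x else u2 x)" for x
  define w where "w x = (if x \<le> b then w1 x else w2 x)" for x
  have cu: "continuous_on {a..c} u"
  proof -
    have "continuous_on ({a..b} \<union> {b..c}) (\<lambda>x. if x \<le> b then u1 x else u2 x)"
      by (rule continuous_on_cases) (use 1 2 in auto)
    moreover have "{a..b} \<union> {b..c} = {a..c}" using assms by auto
    ultimately show ?thesis unfolding u_def[abs_def] by simp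
  qed
  have D: "(u has_real_derivative w x) (at x)" if x: "x \<in> {a<..<c} - (S1 \<union> S2 \<union> {b})" for x
  proof (cases "x < b")
    case True
    then have "(u1 has_real_derivative w1 x) (at x)" using x by (intro 1(3)) auto
    then have "(u has_real_derivative w1 x) (at x)"
      by (rule has_field_derivative_transform_within_open[where S="{..<b}"]) (use True in \<open>auto simp: u_def\<close>)
    then show ?thesis using True by (simp add: w_def)
  next
    case False
    then have xb: "x > b" using x by auto
    then have "(u2 has_real_derivative w2 x) (at x)" using x by (intro 2(3)) auto
    then have "(u has_real_derivative w2 x) (at x)"
      by (rule has_field_derivative_transform_within_open[where S="{b<..}"]) (use xb in \<open>auto simp: u_def\<close>)
    then show ?thesis using xb by (simp add: w_def)
  qed
  have wm: "w \<in> borel_measurable borel" unfolding w_def[abs_def] using 1(4) 2(4) by measurable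
  have wb: "\<bar>w x\<bar> \<le> max C1 C2" for x using 1(5)[of x] 2(5)[of x] by (auto simp: w_def)
  let ?e = "energy_density W \<theta> \<epsilon> \<delta> u w"
  have int: "set_integrable lebesgue {a'..b'} ?e" if "a \<le> a'" "b' \<le> c" for a' b'
    by (rule energy_density_integral(1)[OF \<open>\<delta> > 0\<close> W continuous_on_subset[OF cu] bounded_square_set_integrable[OF wm wb]])
      (use that in auto)
  have e2: "(LINT x:{b<..<c}|lebesgue. ?e x) = (LINT x:{b..c}|lebesgue. energy_density W \<theta> \<epsilon> \<delta> u2 w2 x)"
    unfolding set_integral_Ioo_Icc by (rule set_lebesgue_integral_cong) (auto simp: u_def w_def)
  have e1: "(LINT x:{a..b}|lebesgue. ?e x) = (LINT x:{a..b}|lebesgue. energy_density W \<theta> \<epsilon> \<delta> u1 w1 x)"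
    by (rule set_lebesgue_integral_cong) (auto simp: u_def w_def)
  have "(LINT x:{a..b} \<union> {b<..<c}|lebesgue. ?e x) = (LINT x:{a..b}|lebesgue. ?e x) + (LINT x:{b<..<c}|lebesgue. ?e x)"
    using int[of a b] int[of b c] assms by (intro set_integral_Un) (auto simp: set_integral_Ioo_Icc)
  moreover have "(LINT x:{a..b} \<union> {b<..<c}|lebesgue. ?e x) = (LINT x:{a..c}|lebesgue. ?e x)"
    using assms by (subst (1 2) set_integral_endpoints(1)[of a c]) auto
  ultimately have "(LINT x:{a..c}|lebesgue. ?e x) \<le> e1 + e2" using e1 e2 1(8) 2(8) by simp
  then show ?thesis
    unfolding path_within_def
    using cu D wm wb 1(2,6) 2(2,7) assms(3,4)
    by (intro exI[of _ u] exI[of _ w] exI[of _ "S1 \<union> S2 \<union> {b}"] exI[of _ "max C1 C2"]) (auto simp: u_def)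
qed

lemma checkerboard_set_integrable:
  assumes "\<delta> > 0"
  shows "set_integrable lebesgue {a..b} (\<lambda>x. checkerboard \<theta> (x / \<delta>))"
proof -
  have "set_integrable lebesgue {a..b} (energy_density (\<lambda>_. 1) \<theta> 1 \<delta> (\<lambda>_. 0) (\<lambda>_. 0))"
    by (rule energy_density_integral(1)[OF assms]) (auto intro!: continuous_intros)
  then show ?thesis by simp
qed

lemma path_within_linear:
  assumes ab: "a < b" and pos: "\<epsilon> > 0" "\<delta> > 0" and W: "continuous_on UNIV W"
    and \<theta>: "\<And>z. \<theta> z \<ge> 0" and V: "\<And>s. s \<in> closed_segment p q \<Longrightarrow> W s \<le> V"
    and T: "(LINT x:{a..b}|lebesgue. checkerboard \<theta> (x / \<delta>)) \<le> T" and "V \<ge> 0"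
  shows "path_within W \<theta> \<epsilon> \<delta> a b p q (\<epsilon> * (q - p)\<^sup>2 / (2 * (b - a)) + V * T / \<epsilon>)"
proof -
  define d where "d = (q - p) / (b - a)"
  define u where "u x = p + d * (x - a)" for x
  have dba: "d * (b - a) = q - p" using ab by (simp add: d_def)
  have cu: "continuous_on S u" for S unfolding u_def[abs_def] by (intro continuous_intros)
  have D: "(u has_real_derivative d) (at x)" for x
    unfolding u_def[abs_def] by (auto intro!: derivative_eq_intros)
  have seg: "u x \<in> closed_segment p q" if x: "x \<in> {a..b}" for x
  proof -
    define t where "t = (x - a) / (b - a)"
    have "u x = p + t * (q - p)" by (simp add: u_def d_def t_def)
    then have "u x = (1 - t) * p + t * q" by (simp add: algebra_simps)
    moreover have "0 \<le> t" "t \<le> 1" using ab x by (auto simp: t_def)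
    ultimately show ?thesis unfolding closed_segment_def by auto
  qed
  have cb: "checkerboard \<theta> (x / \<delta>) \<ge> 0" for x
    by (rule checkerboard_nonneg[OF pos(2) \<theta>])
  have c1: "set_integrable lebesgue {a..b} (\<lambda>x. \<epsilon> / 2 * d\<^sup>2)"
    by (intro absolutely_integrable_continuous_real continuous_intros)
  have c2: "set_integrable lebesgue {a..b} (\<lambda>x. V / \<epsilon> * checkerboard \<theta> (x / \<delta>))"
    using checkerboard_set_integrable[OF pos(2)] by (intro set_integrable_mult_right) auto
  have "(LINT x:{a..b}|lebesgue. energy_density W \<theta> \<epsilon> \<delta> u (\<lambda>_. d) x)
     \<le> (LINT x:{a..b}|lebesgue. \<epsilon> / 2 * d\<^sup>2 + V / \<epsilon> * checkerboard \<theta> (x / \<delta>))"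
  proof (rule set_integral_mono)
    show "set_integrable lebesgue {a..b} (energy_density W \<theta> \<epsilon> \<delta> u (\<lambda>_. d))"
      by (rule energy_density_integral(1)[OF pos(2) W cu]) (intro absolutely_integrable_continuous_real continuous_intros)
    show "set_integrable lebesgue {a..b} (\<lambda>x. \<epsilon> / 2 * d\<^sup>2 + V / \<epsilon> * checkerboard \<theta> (x / \<delta>))"
      by (rule set_integral_add(1)[OF c1 c2])
    fix x assume x: "x \<in> {a..b}"
    have "checkerboard \<theta> (x / \<delta>) * W (u x) \<le> checkerboard \<theta> (x / \<delta>) * V"
      by (intro mult_left_mono V seg x cb)
    from divide_right_mono[OF this, of \<epsilon>]
    show "energy_density W \<theta> \<epsilon> \<delta> u (\<lambda>_. d) x \<le> \<epsilon> / 2 * d\<^sup>2 + V / \<epsilon> * checkerboard \<theta> (x / \<delta>)"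
      using pos by (simp add: mult.commute)
  qed
  also have "\<dots> = \<epsilon> / 2 * d\<^sup>2 * (b - a) + V / \<epsilon> * (LINT x:{a..b}|lebesgue. checkerboard \<theta> (x / \<delta>))"
    unfolding set_integral_add(2)[OF c1 c2] set_integral_mult_right
    using ab by (simp add: set_lebesgue_integral_def)
  also have "\<epsilon> / 2 * d\<^sup>2 * (b - a) = \<epsilon> * (q - p)\<^sup>2 / (2 * (b - a))"
    using ab by (simp add: d_def power_divide power2_eq_square)
  also have "V / \<epsilon> * (LINT x:{a..b}|lebesgue. checkerboard \<theta> (x / \<delta>)) \<le> V / \<epsilon> * T"
    using T pos \<open>V \<ge> 0\<close> by (intro mult_left_mono) auto
  finally have "(LINT x:{a..b}|lebesgue. energy_density W \<theta> \<epsilon> \<delta> u (\<lambda>_. d) x) \<le> \<epsilon> * (q - p)\<^sup>2 / (2 * (b - a)) + V * T / \<epsilon>"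
    by simp
  then show ?thesis
    unfolding path_within_def using cu D dba
    by (intro exI[of _ u] exI[of _ "\<lambda>_. d"] exI[of _ "{}"] exI[of _ "\<bar>d\<bar>"]) (auto simp: u_def)
qed

lemma checkerboard_integral_cells:
  assumes pos: "\<delta> > 0"
  shows "(LINT x:{\<delta> * (of_int z - 1/2)..\<delta> * (of_int (z + int r) - 1/2)}|lebesgue. checkerboard \<theta> (x / \<delta>))
     = \<delta> * (\<Sum>i\<in>{z..<z + int r}. \<theta> i)"
proof (induction r)
  case 0
  have "(LINT x:{\<delta> * (of_int z - 1/2)..\<delta> * (of_int z - 1/2)}|lebesgue. checkerboard \<theta> (x / \<delta>)) = 0"
    unfolding set_integral_Ioo_Icc by (simp add: set_lebesgue_integral_def)
  then show ?case by simp
next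
  case (Suc r)
  let ?a = "\<delta> * (of_int z - 1/2)" and ?b = "\<delta> * (of_int (z + int r) - 1/2)" and ?c = "\<delta> * (of_int (z + int (Suc r)) - 1/2)"
  let ?f = "\<lambda>x. checkerboard \<theta> (x / \<delta>)"
  have le: "?a \<le> ?b" "?b < ?c" using pos by (auto intro!: mult_left_mono)
  have cell: "{?b<..<?c} = scaled_cell \<delta> (z + int r)" by (auto simp: scaled_cell_def algebra_simps)
  have "(LINT x:{?a..?c}|lebesgue. ?f x) = (LINT x:{?a..?b} \<union> {?b<..<?c}|lebesgue. ?f x)"
    using le by (subst (1 2) set_integral_endpoints(1)[of ?a ?c]) auto
  also have "\<dots> = (LINT x:{?a..?b}|lebesgue. ?f x) + (LINT x:{?b<..<?c}|lebesgue. ?f x)"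
    using checkerboard_set_integrable[OF pos, of ?a ?b \<theta>] checkerboard_set_integrable[OF pos, of ?b ?c \<theta>]
    by (intro set_integral_Un) (auto simp: set_integral_Ioo_Icc)
  also have "(LINT x:{?b<..<?c}|lebesgue. ?f x) = (LINT x:{?b<..<?c}|lebesgue. \<theta> (z + int r))"
    unfolding cell
  proof (rule set_lebesgue_integral_cong)
    show "scaled_cell \<delta> (z + int r) \<in> sets lebesgue" by (simp add: scaled_cell_def)
  qed (simp add: checkerboard_in_cell[OF pos])
  also have "\<dots> = \<delta> * \<theta> (z + int r)"
    unfolding cell by (rule set_integral_const_cell[OF pos])
  also have "{z..<z + int (Suc r)} = insert (z + int r) {z..<z + int r}" by auto
  ultimately show ?case using Suc.IH by (simp add: algebra_simps)
qed

lemma checkerboard_integral_le: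
  assumes pos: "\<delta> > 0" and ab: "a \<le> b" and \<theta>: "\<And>z. 0 \<le> \<theta> z" "\<And>z. \<theta> z \<le> hi"
  shows "(LINT x:{a..b}|lebesgue. checkerboard \<theta> (x / \<delta>)) \<le> hi * (b - a)"
proof -
  have c: "set_integrable lebesgue {a..b} (\<lambda>x. hi)"
    by (intro absolutely_integrable_continuous_real continuous_intros)
  have "(LINT x:{a..b}|lebesgue. checkerboard \<theta> (x / \<delta>)) \<le> (LINT x:{a..b}|lebesgue. hi)"
    using checkerboard_le[OF pos \<theta>]
    by (intro set_integral_mono checkerboard_set_integrable pos c)
  then show ?thesis using ab by (simp add: set_lebesgue_integral_def mult.commute)
qed

text \<open>The energy may be computed with any weak derivative in place of the chosen one.\<close>

lemma energy_eq_weak_deriv: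
  assumes H: "u \<in> H1 {A..B}" and wd: "has_L2_weak_deriv {A<..<B} u w"
    and W: "continuous_on UNIV W" and pos: "\<delta> > 0"
  shows "energy W \<theta> \<epsilon> \<delta> {A..B} u = (LINT x:{A..B}|lebesgue. energy_density W \<theta> \<epsilon> \<delta> u w x)"
proof -
  let ?v = "weak_deriv {A..B} u"
  have u: "continuous_on {A..B} u" using H by (rule H1_continuous)
  have w2: "set_integrable lebesgue {A..B} (\<lambda>x. (w x)\<^sup>2)"
    using wd by (simp add: set_integral_Ioo_Icc has_L2_weak_deriv_def L2_def)
  have iv: "set_integrable lebesgue {A..B} (energy_density W \<theta> \<epsilon> \<delta> u ?v)"
    by (rule energy_density_integral(1)[OF pos W u H1_weak_deriv_square_integrable[OF H]])
  have iw: "set_integrable lebesgue {A..B} (energy_density W \<theta> \<epsilon> \<delta> u w)"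
    by (rule energy_density_integral(1)[OF pos W u w2])
  have "energy W \<theta> \<epsilon> \<delta> {A..B} u = (LINT x:{A<..<B}|lebesgue. energy_density W \<theta> \<epsilon> \<delta> u ?v x)"
    by (simp add: energy_def set_integral_Ioo_Icc)
  also have "\<dots> = (LINT x:{A<..<B}|lebesgue. energy_density W \<theta> \<epsilon> \<delta> u w x)"
    unfolding set_lebesgue_integral_def
  proof (rule integral_cong_AE)
    show "(\<lambda>x. indicat_real {A<..<B} x *\<^sub>R energy_density W \<theta> \<epsilon> \<delta> u ?v x) \<in> borel_measurable lebesgue"
      by (rule borel_measurable_integrable[OF iv[unfolded set_integral_Ioo_Icc, unfolded set_integrable_def]])
    show "(\<lambda>x. indicat_real {A<..<B} x *\<^sub>R energy_density W \<theta> \<epsilon> \<delta> u w x) \<in> borel_measurable lebesgue"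
      by (rule borel_measurable_integrable[OF iw[unfolded set_integral_Ioo_Icc, unfolded set_integrable_def]])
    show "AE x in lebesgue. indicat_real {A<..<B} x *\<^sub>R energy_density W \<theta> \<epsilon> \<delta> u ?v x
        = indicat_real {A<..<B} x *\<^sub>R energy_density W \<theta> \<epsilon> \<delta> u w x"
      using weak_deriv_AE_eq[OF H wd] by eventually_elim (auto simp: indicator_def)
  qed
  finally show ?thesis by (simp add: set_integral_Ioo_Icc)
qed

lemma path_within_energy:
  assumes p: "path_within W \<theta> \<epsilon> \<delta> A B p q e" and AB: "A < B" and W: "continuous_on UNIV W" and pos: "\<delta> > 0"
  shows "\<exists>u\<in>H1 {A..B}. u A = p \<and> u B = q \<and> energy W \<theta> \<epsilon> \<delta> {A..B} u \<le> e"
proof -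
  from p obtain u w S C where 1: "continuous_on {A..B} u" "finite S"
     "\<And>x. x\<in>{A<..<B} - S \<Longrightarrow> (u has_real_derivative w x) (at x)" "w \<in> borel_measurable borel"
     "\<And>x. \<bar>w x\<bar> \<le> C" "u A = p" "u B = q"
     "(LINT x:{A..B}|lebesgue. energy_density W \<theta> \<epsilon> \<delta> u w x) \<le> e" unfolding path_within_def by blast
  have wd: "has_L2_weak_deriv {A<..<B} u w"
    by (rule piecewise_C1_weak_deriv[OF AB 1(1,2,3,4,5)])
  have H: "u \<in> H1 {A..B}" by (rule weakly_differentiable_H1[OF AB 1(1) wd])
  show ?thesis using energy_eq_weak_deriv[OF H wd W pos, of \<theta> \<epsilon>] H 1(6,7,8) by auto
qed

section \<open>The effective variational problem\<close>

text \<open>The end points of the \<open>n\<close> slots into which the range from \<open>-1\<close> to \<open>1\<close> is cut.\<close>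

definition level :: "nat \<Rightarrow> nat \<Rightarrow> real" where
  "level n j = -1 + 2 * real j / real n"

definition slot_max :: "(real \<Rightarrow> real) \<Rightarrow> nat \<Rightarrow> nat \<Rightarrow> real" where
  "slot_max W n j = Sup (W ` {level n j..level n (Suc j)})"

text \<open>Crossing slot \<open>j\<close>, of height \<open>2 / n\<close>, with constant slope over the width \<open>h j\<close> has gradient energy
  \<open>(2 / n)\<^sup>2 / (2 * h j)\<close>; all lengths are in units of \<open>\<epsilon>\<close>.\<close>

definition profile_energy :: "(real \<Rightarrow> real) \<Rightarrow> nat \<Rightarrow> (nat \<Rightarrow> real) \<Rightarrow> (nat \<Rightarrow> real) \<Rightarrow> real" where
  "profile_energy W n h m = (\<Sum>j<n. 2 / ((real n)\<^sup>2 * h j) + h j * m j * slot_max W n j)"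

text \<open>The cost \<open>h j * J (m j)\<close> is the exponent, per unit of \<open>N\<close>, of the probability that a block of length
  \<open>h j\<close> has average at most \<open>m j\<close>. Requiring \<open>m j\<close> to exceed \<open>lo\<close> strictly keeps the rate finite, so that it
  can be real-valued.\<close>

definition is_profile :: "real \<Rightarrow> (real \<Rightarrow> real) \<Rightarrow> ennreal \<Rightarrow> nat \<Rightarrow> (nat \<Rightarrow> real) \<Rightarrow> (nat \<Rightarrow> real) \<Rightarrow> bool" where
  "is_profile lo J \<kappa> n h m \<longleftrightarrow> n > 0 \<and> (\<forall>j<n. 0 < h j \<and> lo < m j) \<and> ennreal (\<Sum>j<n. h j * J (m j)) \<le> \<kappa>"

definition check_sigma :: "(real \<Rightarrow> real) \<Rightarrow> real \<Rightarrow> (real \<Rightarrow> real) \<Rightarrow> ennreal \<Rightarrow> real" where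
  "check_sigma W lo J \<kappa> = Inf {profile_energy W n h m | n h m. is_profile lo J \<kappa> n h m}"

lemma level_less: "n > 0 \<Longrightarrow> level n j < level n (Suc j)"
  by (simp add: level_def divide_strict_right_mono)

lemma level_mono: "i \<le> j \<Longrightarrow> level n i \<le> level n j"
  by (simp add: level_def divide_right_mono)

lemma level_diff: "n > 0 \<Longrightarrow> level n (Suc j) - level n j = 2 / real n"
  by (simp add: level_def field_simps)

lemma level_0: "level n 0 = -1" and level_n: "n > 0 \<Longrightarrow> level n n = 1"
  by (simp_all add: level_def)

lemma level_range: "n > 0 \<Longrightarrow> j \<le> n \<Longrightarrow> level n j \<in> {-1..1}"
  using level_mono[of 0 j n] level_mono[of j n n] by (simp add: level_0 level_n)

text \<open>Arithmetic-geometric mean inequality between gradient and potential energy; equality holds at the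
  width in \<open>width_tradeoff_eq\<close>.\<close>

lemma width_tradeoff_ge:
  fixes h m S c :: real
  assumes "h > 0" "m \<ge> 0" "S \<ge> 0" "c > 0"
  shows "2 / (c\<^sup>2 * h) + h * m * S \<ge> 2 / c * sqrt (2 * (m * S))"
proof -
  let ?x = "sqrt (2 / (c\<^sup>2 * h))" and ?y = "sqrt (h * m * S)"
  have "0 \<le> (?x - ?y)\<^sup>2" by simp
  also have "\<dots> = ?x\<^sup>2 + ?y\<^sup>2 - 2 * (?x * ?y)" by (simp add: power2_diff)
  also have "?x\<^sup>2 = 2 / (c\<^sup>2 * h)" using assms by simp
  also have "?y\<^sup>2 = h * m * S" using assms by simp
  also have "?x * ?y = sqrt (2 / (c\<^sup>2 * h) * (h * m * S))" by (rule real_sqrt_mult[symmetric])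
  also have "2 / (c\<^sup>2 * h) * (h * m * S) = (1 / c)\<^sup>2 * (2 * (m * S))" using assms by (simp add: power2_eq_square)
  also have "sqrt ((1 / c)\<^sup>2 * (2 * (m * S))) = 1 / c * sqrt (2 * (m * S))" using assms by (simp add: real_sqrt_mult)
  finally show ?thesis by simp
qed

lemma width_tradeoff_eq:
  fixes m S c :: real
  assumes "m > 0" "S > 0" "c > 0"
  defines "h \<equiv> 2 / c / sqrt (2 * (m * S))"
  shows "h > 0" "2 / (c\<^sup>2 * h) + h * m * S = 2 / c * sqrt (2 * (m * S))"
proof -
  define r where "r = sqrt (2 * (m * S))"
  have r: "r > 0" "r * r = 2 * (m * S)" using assms by (auto simp: r_def)
  show "h > 0" using r assms by (simp add: h_def r_def)
  have "h * m * S = 1 / c * ((2 * (m * S)) / r)" by (simp add: h_def r_def)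
  also have "\<dots> = 1 / c * r" using r by (simp add: r(2)[symmetric])
  finally have 1: "h * m * S = r / c" by simp
  have "2 / (c\<^sup>2 * h) = r / c" using r assms by (simp add: h_def r_def[symmetric] power2_eq_square)
  then show "2 / (c\<^sup>2 * h) + h * m * S = 2 / c * sqrt (2 * (m * S))" using 1 by (simp add: r_def)
qed

lemma eventually_at_right_obtain:
  assumes "eventually P (at_right (a::real))"
  obtains t where "t > a" "P t"
proof -
  from assms obtain b where b: "b > a" "\<And>y. a < y \<Longrightarrow> y < b \<Longrightarrow> P y" by (auto simp: eventually_at_right_field)
  obtain t where "a < t" "t < b" using dense[OF b(1)] by blast
  then show ?thesis using that b(2) by blast
qed

locale double_well =
  fixes W :: "real \<Rightarrow> real"
  assumes W_cont: "continuous_on UNIV W" and W_nonneg: "\<And>s. W s \<ge> 0"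
    and W_zeros: "\<And>s. W s = 0 \<longleftrightarrow> s = -1 \<or> s = 1"
begin

lemma W_cont_on: "continuous_on S W"
  using W_cont continuous_on_subset by blast

lemma W_pos: "s \<noteq> -1 \<Longrightarrow> s \<noteq> 1 \<Longrightarrow> W s > 0"
  using W_nonneg[of s] W_zeros[of s] by force

lemma slot_max_upper:
  assumes "x \<in> {level n j..level n (Suc j)}"
  shows "W x \<le> slot_max W n j"
proof -
  have "compact (W ` {level n j..level n (Suc j)})" by (intro compact_continuous_image W_cont_on) simp
  then have "bdd_above (W ` {level n j..level n (Suc j)})" by (simp add: bounded_imp_bdd_above compact_imp_bounded)
  then show ?thesis unfolding slot_max_def using assms by (intro cSUP_upper)
qed

lemma slot_max_attained:
  "n > 0 \<Longrightarrow> \<exists>x\<in>{level n j..level n (Suc j)}. slot_max W n j = W x"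
proof -
  assume n: "n > 0"
  have "compact {level n j..level n (Suc j)}" "{level n j..level n (Suc j)} \<noteq> {}"
    using level_less[OF n, of j] by auto
  from continuous_attains_sup[OF this W_cont_on]
  obtain x where x: "x \<in> {level n j..level n (Suc j)}" "\<forall>y\<in>{level n j..level n (Suc j)}. W y \<le> W x" by blast
  have "slot_max W n j \<le> W x" unfolding slot_max_def using x by (intro cSUP_least) auto
  then show ?thesis using slot_max_upper[OF x(1)] x(1) by (intro bexI[of _ x]) auto
qed

text \<open>A slot is infinite and the wells are two points.\<close>

lemma slot_max_pos:
  assumes "n > 0"
  shows "slot_max W n j > 0"
proof -
  obtain x where x: "level n j < x" "x < level n (Suc j)" "x \<noteq> 1" "x \<noteq> -1"
  proof -
    have "infinite {level n j<..<level n (Suc j)}" using level_less[OF assms] by simp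
    then have "infinite ({level n j<..<level n (Suc j)} - {1,-1})" by simp
    then obtain x where "x \<in> {level n j<..<level n (Suc j)} - {1,-1}" using infinite_imp_nonempty by blast
    then show ?thesis using that by auto
  qed
  then show ?thesis using slot_max_upper[of x n j] W_pos[of x] by simp
qed

definition W_max :: real where "W_max = Sup (W ` {-1..1})"

lemma W_le_max: "x \<in> {-1..1} \<Longrightarrow> W x \<le> W_max"
proof -
  have "compact (W ` {-1..1})" by (intro compact_continuous_image W_cont_on) simp
  then have "bdd_above (W ` {-1..1})" by (simp add: bounded_imp_bdd_above compact_imp_bounded)
  then show "x \<in> {-1..1} \<Longrightarrow> W x \<le> W_max" unfolding W_max_def by (intro cSUP_upper)
qed

lemma W_max_pos: "W_max > 0"
  using W_le_max[of 0] W_pos[of 0] by simp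

lemma slot_max_le: "n > 0 \<Longrightarrow> j < n \<Longrightarrow> slot_max W n j \<le> W_max"
  using slot_max_attained[of n j] level_range[of n j] level_range[of n "Suc j"] W_le_max by fastforce

abbreviation "root_W x \<equiv> sqrt (2 * W x)"

lemma root_W_cont: "continuous_on S root_W"
  by (intro continuous_intros W_cont_on)

lemma root_W_integrable: "root_W integrable_on {a..b}"
  by (intro integrable_continuous_real root_W_cont)

lemma sigma_W_integral: "sigma_W W = integral {-1..1} root_W"
  unfolding sigma_W_def
  by (intro set_lebesgue_integral_eq_integral absolutely_integrable_continuous_real root_W_cont)

lemma integral_levels: "(\<Sum>j<k. integral {level n j..level n (Suc j)} root_W) = integral {-1..level n k} root_W"
proof (induction k)
  case 0
  then show ?case by (simp add: level_0)
next
  case (Suc k)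
  have "integral {-1..level n k} root_W + integral {level n k..level n (Suc k)} root_W = integral {-1..level n (Suc k)} root_W"
    using level_mono[of 0 k n] level_mono[of k "Suc k" n]
    by (intro Henstock_Kurzweil_Integration.integral_combine root_W_integrable) (auto simp: level_0)
  then show ?case using Suc by simp
qed

lemma sigma_W_slots:
  "n > 0 \<Longrightarrow> sigma_W W = (\<Sum>j<n. integral {level n j..level n (Suc j)} root_W)"
  by (simp add: integral_levels level_n sigma_W_integral)

text \<open>Upper Riemann sum of \<open>sqrt (2 * W u)\<close>.\<close>

definition upper_sum :: "nat \<Rightarrow> real" where
  "upper_sum n = (\<Sum>j<n. 2 / real n * sqrt (2 * slot_max W n j))"

lemma upper_sum_ge:
  assumes "n > 0"
  shows "sigma_W W \<le> upper_sum n"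
  unfolding sigma_W_slots[OF assms] upper_sum_def
proof (rule sum_mono)
  fix j
  have "integral {level n j..level n (Suc j)} root_W \<le> integral {level n j..level n (Suc j)} (\<lambda>_. sqrt (2 * slot_max W n j))"
    by (intro integral_le root_W_integrable) (auto intro: slot_max_upper)
  also have "\<dots> = 2 / real n * sqrt (2 * slot_max W n j)"
    using level_less[OF assms, of j] level_diff[OF assms, of j] by simp
  finally show "integral {level n j..level n (Suc j)} root_W \<le> 2 / real n * sqrt (2 * slot_max W n j)" .
qed

lemma upper_sum_close:
  assumes "e > 0"
  shows "\<exists>N. \<forall>n\<ge>N. n > 0 \<longrightarrow> upper_sum n \<le> sigma_W W + e"
proof -
  have "uniformly_continuous_on {-1..1} root_W" by (intro compact_uniformly_continuous root_W_cont) simp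
  moreover have "e / 2 > 0" using assms by simp
  ultimately obtain d where d: "d > 0" "\<And>x x'. x \<in> {-1..1} \<Longrightarrow> x' \<in> {-1..1} \<Longrightarrow> dist x' x < d \<Longrightarrow> dist (root_W x') (root_W x) < e / 2"
    unfolding uniformly_continuous_on_def by blast
  obtain N :: nat where N: "real N > 2 / d" using reals_Archimedean2 by blast
  show ?thesis
  proof (intro exI[of _ N] allI impI)
    fix n assume n: "n \<ge> N" "n > 0"
    have small: "2 / real n < d"
    proof -
      have "2 / d < real n" using N n by linarith
      then show ?thesis using d n by (simp add: field_simps)
    qed
    have "upper_sum n \<le> (\<Sum>j<n. integral {level n j..level n (Suc j)} root_W + 2 / real n * (e / 2))"
      unfolding upper_sum_def
    proof (rule sum_mono)
      fix j assume j: "j \<in> {..<n}"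
      obtain x where x: "x \<in> {level n j..level n (Suc j)}" "slot_max W n j = W x"
        using slot_max_attained[OF n(2)] by blast
      have sub: "{level n j..level n (Suc j)} \<subseteq> {-1..1}"
        using level_range[OF n(2), of j] level_range[OF n(2), of "Suc j"] j by auto
      have "root_W x - e / 2 \<le> root_W y" if y: "y \<in> {level n j..level n (Suc j)}" for y
      proof -
        have "\<bar>y - x\<bar> \<le> 2 / real n" using x y level_diff[OF n(2), of j] by auto
        then have "dist (root_W y) (root_W x) < e / 2" using d(2)[of x y] x y sub small by (auto simp: dist_real_def)
        then show ?thesis unfolding dist_real_def by linarith
      qed
      then have "integral {level n j..level n (Suc j)} (\<lambda>_. root_W x - e / 2) \<le> integral {level n j..level n (Suc j)} root_W"
        by (intro integral_le root_W_integrable) auto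
      moreover have "integral {level n j..level n (Suc j)} (\<lambda>_. root_W x - e / 2) = 2 / real n * (root_W x - e / 2)"
        using level_less[OF n(2), of j] level_diff[OF n(2), of j] by simp
      ultimately show "2 / real n * sqrt (2 * slot_max W n j) \<le> integral {level n j..level n (Suc j)} root_W + 2 / real n * (e / 2)"
        unfolding x(2) by (simp add: right_diff_distrib)
    qed
    also have "\<dots> = sigma_W W + e"
      using n by (simp add: sum.distrib sigma_W_slots)
    finally show "upper_sum n \<le> sigma_W W + e" .
  qed
qed

lemma sigma_W_pos: "sigma_W W > 0"
proof -
  have "compact {-1/2..1/2::real}" "{-1/2..1/2::real} \<noteq> {}" by auto
  from continuous_attains_inf[OF this W_cont_on] obtain x where
    x: "x \<in> {-1/2..1/2}" "\<forall>y\<in>{-1/2..1/2}. W x \<le> W y" by blast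
  have "0 < root_W x" using W_pos[of x] x by auto
  also have "root_W x = integral {-1/2..1/2::real} (\<lambda>_. root_W x)" by simp
  also have "\<dots> \<le> integral {-1/2..1/2::real} root_W" using x by (intro integral_le root_W_integrable) auto
  also have "\<dots> \<le> integral {-1..1} root_W"
    by (intro integral_subset_le root_W_integrable) (auto simp: W_nonneg)
  finally show ?thesis by (simp add: sigma_W_integral)
qed

text \<open>Optimise the width of every slot separately; what remains is an upper Riemann sum of
  \<open>sigma_W\<close>.\<close>

lemma profile_energy_ge:
  assumes "n > 0" "\<And>j. j < n \<Longrightarrow> 0 < h j" "\<And>j. j < n \<Longrightarrow> a \<le> m j" "0 \<le> a"
  shows "sqrt a * sigma_W W \<le> profile_energy W n h m"
proof -
  have "sqrt a * sigma_W W \<le> sqrt a * upper_sum n" using upper_sum_ge[OF assms(1)] assms by (intro mult_left_mono) auto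
  also have "\<dots> = (\<Sum>j<n. 2 / real n * sqrt (2 * (a * slot_max W n j)))"
    unfolding upper_sum_def sum_distrib_left by (simp add: real_sqrt_mult mult_ac)
  also have "\<dots> \<le> profile_energy W n h m"
    unfolding profile_energy_def
  proof (rule sum_mono)
    fix j assume j: "j \<in> {..<n}"
    have S: "0 \<le> slot_max W n j" using slot_max_pos[OF assms(1)] by (simp add: less_imp_le)
    have "2 / real n * sqrt (2 * (a * slot_max W n j)) \<le> 2 / real n * sqrt (2 * (m j * slot_max W n j))"
      using assms(3) j S by (intro mult_left_mono real_sqrt_le_mono mult_right_mono) auto
    also have "\<dots> \<le> 2 / ((real n)\<^sup>2 * h j) + h j * m j * slot_max W n j"
      using assms(2,3)[of j] j S assms(1,4) by (intro width_tradeoff_ge) auto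
    finally show "2 / real n * sqrt (2 * (a * slot_max W n j)) \<le> 2 / ((real n)\<^sup>2 * h j) + h j * m j * slot_max W n j" .
  qed
  finally show ?thesis .
qed

definition best_width :: "nat \<Rightarrow> (nat \<Rightarrow> real) \<Rightarrow> nat \<Rightarrow> real" where
  "best_width n m j = 2 / real n / sqrt (2 * (m j * slot_max W n j))"

lemma best_width_pos: "n > 0 \<Longrightarrow> m j > 0 \<Longrightarrow> best_width n m j > 0"
  unfolding best_width_def by (rule width_tradeoff_eq(1)) (auto simp: slot_max_pos)

lemma profile_energy_best_width:
  assumes "n > 0" "\<And>j. j < n \<Longrightarrow> 0 < m j"
  shows "profile_energy W n (best_width n m) m = (\<Sum>j<n. 2 / real n * sqrt (2 * (m j * slot_max W n j)))"
  unfolding profile_energy_def best_width_def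
  using assms slot_max_pos by (intro sum.cong refl width_tradeoff_eq(2)) auto

lemma constant_profile_energy:
  assumes "n > 0" "a > 0"
  shows "profile_energy W n (best_width n (\<lambda>_. a)) (\<lambda>_. a) = sqrt a * upper_sum n"
  using assms by (simp add: profile_energy_best_width upper_sum_def sum_distrib_left real_sqrt_mult mult_ac)

end

text \<open>The properties of the rate function on which the variational problem depends; \<open>mu\<close> is the mean of
  the environment.\<close>

locale rate_bounds = double_well W for W :: "real \<Rightarrow> real" +
  fixes J :: "real \<Rightarrow> real" and lo mu c :: real
  assumes lo_pos: "0 < lo" and lo_mu: "lo < mu" and c_pos: "c > 0"
    and J_nonneg: "\<And>m. lo < m \<Longrightarrow> J m \<ge> 0"
    and J_above: "\<And>m. mu < m \<Longrightarrow> J m = 0"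
    and J_below: "\<And>m. lo < m \<Longrightarrow> m \<le> mu \<Longrightarrow> J m \<ge> c * (mu - m)\<^sup>2"
begin

abbreviation "\<sigma> \<equiv> check_sigma W lo J"

lemma profile_energy_nonneg:
  assumes "is_profile lo J \<kappa> n h m"
  shows "profile_energy W n h m \<ge> sqrt lo * sigma_W W"
  using assms by (intro profile_energy_ge) (auto simp: is_profile_def less_imp_le lo_pos)

lemma \<sigma>_bdd: "bdd_below {profile_energy W n h m | n h m. is_profile lo J \<kappa> n h m}"
  using profile_energy_nonneg by (intro bdd_belowI[of _ "sqrt lo * sigma_W W"]) auto

lemma \<sigma>_le: "is_profile lo J \<kappa> n h m \<Longrightarrow> \<sigma> \<kappa> \<le> profile_energy W n h m"
  unfolding check_sigma_def using \<sigma>_bdd by (intro cInf_lower) auto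

text \<open>A constant coefficient slightly above the mean costs nothing, so it is available for every \<open>\<kappa>\<close>.\<close>

lemma profile_above_mean:
  assumes "n > 0" "t > 0"
  shows "is_profile lo J \<kappa> n (best_width n (\<lambda>_. mu + t)) (\<lambda>_. mu + t)"
    and "profile_energy W n (best_width n (\<lambda>_. mu + t)) (\<lambda>_. mu + t) = sqrt (mu + t) * upper_sum n"
proof -
  show "is_profile lo J \<kappa> n (best_width n (\<lambda>_. mu + t)) (\<lambda>_. mu + t)"
    using assms lo_pos lo_mu by (auto simp: is_profile_def J_above intro!: best_width_pos)
  show "profile_energy W n (best_width n (\<lambda>_. mu + t)) (\<lambda>_. mu + t) = sqrt (mu + t) * upper_sum n"
    using assms lo_pos lo_mu by (intro constant_profile_energy) auto
qed

lemma \<sigma>_nonempty: "{profile_energy W n h m | n h m. is_profile lo J \<kappa> n h m} \<noteq> {}"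
  using profile_above_mean(1)[of 1 1 \<kappa>] by auto

lemma \<sigma>_less:
  assumes "\<sigma> \<kappa> < a"
  obtains n h m where "is_profile lo J \<kappa> n h m" "profile_energy W n h m < a"
  using assms \<sigma>_nonempty[of \<kappa>] \<sigma>_bdd[of \<kappa>] unfolding check_sigma_def
  by (subst (asm) cInf_less_iff) auto

lemma \<sigma>_greatest:
  assumes "\<And>n h m. is_profile lo J \<kappa> n h m \<Longrightarrow> a \<le> profile_energy W n h m"
  shows "a \<le> \<sigma> \<kappa>"
  unfolding check_sigma_def using \<sigma>_nonempty[of \<kappa>] assms by (intro cInf_greatest) auto

lemma \<sigma>_antimono: "\<kappa> \<le> \<kappa>' \<Longrightarrow> \<sigma> \<kappa>' \<le> \<sigma> \<kappa>"
  by (rule \<sigma>_greatest, rule \<sigma>_le) (auto simp: is_profile_def)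

lemma \<sigma>_ge: "sqrt lo * sigma_W W \<le> \<sigma> \<kappa>"
  by (intro \<sigma>_greatest profile_energy_nonneg)

lemma \<sigma>_le_bar: "\<sigma> \<kappa> \<le> sqrt mu * sigma_W W"
proof -
  have "\<sigma> \<kappa> \<le> sqrt (mu + t) * (sigma_W W + t)" if t: "t > 0" for t
  proof -
    from upper_sum_close[OF t] obtain N where "\<forall>n\<ge>N. n > 0 \<longrightarrow> upper_sum n \<le> sigma_W W + t" by blast
    then have N: "upper_sum (Suc N) \<le> sigma_W W + t" by simp
    have "\<sigma> \<kappa> \<le> sqrt (mu + t) * upper_sum (Suc N)"
      using \<sigma>_le[OF profile_above_mean(1)[of "Suc N" t]] profile_above_mean(2)[of "Suc N" t] t by simp
    also have "\<dots> \<le> sqrt (mu + t) * (sigma_W W + t)"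
      using N t lo_pos lo_mu by (intro mult_left_mono) auto
    finally show ?thesis .
  qed
  then have "\<forall>\<^sub>F t in at_right 0. \<sigma> \<kappa> \<le> sqrt (mu + t) * (sigma_W W + t)"
    by (auto simp: eventually_at_filter)
  moreover have "((\<lambda>t. sqrt (mu + t) * (sigma_W W + t)) \<longlongrightarrow> sqrt mu * sigma_W W) (at_right 0)"
    by (auto intro!: tendsto_eq_intros)
  ultimately show ?thesis by (intro tendsto_lowerbound) auto
qed

text \<open>With no budget every coefficient has rate 0, hence is at least the mean.\<close>

lemma \<sigma>_0: "\<sigma> 0 = sqrt mu * sigma_W W"
proof (rule antisym[OF \<sigma>_le_bar \<sigma>_greatest])
  fix n h m assume p: "is_profile lo J 0 n h m"
  have nn: "h j * J (m j) \<ge> 0" if "j < n" for j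
    using p that J_nonneg by (auto simp: is_profile_def less_imp_le)
  have "(\<Sum>j<n. h j * J (m j)) \<le> 0" using p by (simp add: is_profile_def ennreal_eq_0_iff)
  then have z: "(\<Sum>j<n. h j * J (m j)) = 0" using nn by (intro antisym sum_nonneg) auto
  have "mu \<le> m j" if j: "j < n" for j
  proof (rule ccontr)
    assume "\<not> mu \<le> m j"
    then have "0 < c * (mu - m j)\<^sup>2" using c_pos by simp
    also have "\<dots> \<le> J (m j)" using \<open>\<not> mu \<le> m j\<close> p j by (intro J_below) (auto simp: is_profile_def)
    finally have "h j * J (m j) > 0" using p j by (simp add: is_profile_def)
    moreover have "h j * J (m j) = 0"
      using z nn j by (subst (asm) sum_nonneg_eq_0_iff) auto
    ultimately show False by simp
  qed
  then show "sqrt mu * sigma_W W \<le> profile_energy W n h m"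
    using p lo_pos lo_mu by (intro profile_energy_ge) (auto simp: is_profile_def)
qed

text \<open>With unlimited budget the coefficient can be constant and arbitrarily close to \<open>lo\<close>.\<close>

lemma \<sigma>_top: "\<sigma> top = sqrt lo * sigma_W W"
proof (rule antisym[OF _ \<sigma>_ge])
  have "\<sigma> top \<le> sqrt (lo + t) * (sigma_W W + t)" if t: "t > 0" for t
  proof -
    from upper_sum_close[OF t] obtain N where "\<forall>n\<ge>N. n > 0 \<longrightarrow> upper_sum n \<le> sigma_W W + t" by blast
    then have N: "upper_sum (Suc N) \<le> sigma_W W + t" by simp
    have "is_profile lo J top (Suc N) (best_width (Suc N) (\<lambda>_. lo + t)) (\<lambda>_. lo + t)"
      using t lo_pos by (auto simp: is_profile_def intro!: best_width_pos)
    from \<sigma>_le[OF this] have "\<sigma> top \<le> sqrt (lo + t) * upper_sum (Suc N)"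
      using t lo_pos by (simp add: constant_profile_energy del: of_nat_Suc)
    also have "\<dots> \<le> sqrt (lo + t) * (sigma_W W + t)"
      using N t lo_pos by (intro mult_left_mono) auto
    finally show ?thesis .
  qed
  then have "\<forall>\<^sub>F t in at_right 0. \<sigma> top \<le> sqrt (lo + t) * (sigma_W W + t)"
    by (auto simp: eventually_at_filter)
  moreover have "((\<lambda>t. sqrt (lo + t) * (sigma_W W + t)) \<longlongrightarrow> sqrt lo * sigma_W W) (at_right 0)"
    by (auto intro!: tendsto_eq_intros)
  ultimately show "\<sigma> top \<le> sqrt lo * sigma_W W" by (intro tendsto_lowerbound) auto
qed

text \<open>Shrinking all widths by the factor \<open>l\<close> divides the cost by \<open>l\<close>, multiplies the gradient energy by \<open>l\<close>
  and divides the potential energy by \<open>l\<close>.\<close>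

lemma \<sigma>_scaling:
  assumes "l \<ge> 1" "k \<ge> 0"
  shows "\<sigma> (ennreal k) \<le> l * \<sigma> (ennreal (l * k))"
proof -
  have "\<sigma> (ennreal k) / l \<le> \<sigma> (ennreal (l * k))"
  proof (rule \<sigma>_greatest)
    fix n h m assume p: "is_profile lo J (ennreal (l * k)) n h m"
    have "(\<Sum>j<n. h j * J (m j)) \<le> l * k" using p assms by (simp add: is_profile_def)
    then have "(\<Sum>j<n. h j / l * J (m j)) \<le> k"
      using assms by (simp add: sum_divide_distrib[symmetric] field_simps)
    then have "is_profile lo J (ennreal k) n (\<lambda>j. h j / l) m"
      using p assms by (auto simp: is_profile_def intro: ennreal_leI)
    from \<sigma>_le[OF this] have "\<sigma> (ennreal k) \<le> profile_energy W n (\<lambda>j. h j / l) m" .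
    also have "\<dots> \<le> (\<Sum>j<n. l * (2 / ((real n)\<^sup>2 * h j) + h j * m j * slot_max W n j))"
      unfolding profile_energy_def
    proof (rule sum_mono)
      fix j assume "j \<in> {..<n}"
      then have "0 < h j" "0 < m j" "0 < slot_max W n j" using p lo_pos slot_max_pos by (auto simp: is_profile_def)
      then have nn: "0 \<le> h j * m j * slot_max W n j" by simp
      have "h j / l * m j * slot_max W n j = h j * m j * slot_max W n j / l" by simp
      also have "\<dots> \<le> h j * m j * slot_max W n j"
        using nn assms by (simp add: divide_le_eq mult_left_mono[of 1 l "h j * m j * slot_max W n j", simplified])
      also have "\<dots> \<le> l * (h j * m j * slot_max W n j)"
        using nn assms mult_right_mono[of 1 l "h j * m j * slot_max W n j"] by simp
      finally show "2 / ((real n)\<^sup>2 * (h j / l)) + h j / l * m j * slot_max W n j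
          \<le> l * (2 / ((real n)\<^sup>2 * h j) + h j * m j * slot_max W n j)"
        unfolding distrib_left by (intro add_mono) (use assms in \<open>simp_all add: mult.commute\<close>)
    qed
    also have "\<dots> = l * profile_energy W n h m" by (simp add: profile_energy_def sum_distrib_left)
    finally show "\<sigma> (ennreal k) / l \<le> profile_energy W n h m" using assms by (simp add: field_simps)
  qed
  then show ?thesis using assms by (simp add: field_simps)
qed

text \<open>Replacing every coefficient by the mean raises the energy only in proportion to the cost, because
  by the quadratic lower bound a coefficient \<open>x\<close> below the mean satisfies \<open>x \<le> s + x\<^sup>2 / s\<close>, where the last
  term is controlled by the rate.\<close>

lemma \<sigma>_near_0:
  assumes "s > 0" "k \<ge> 0"
  shows "sqrt mu * sigma_W W \<le> (1 + s / lo) * \<sigma> (ennreal k) + W_max * k / (c * s)"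
proof -
  have "(sqrt mu * sigma_W W - W_max * k / (c * s)) / (1 + s / lo) \<le> \<sigma> (ennreal k)"
  proof (rule \<sigma>_greatest)
    fix n h m assume p: "is_profile lo J (ennreal k) n h m"
    then have h: "0 < h j" and m: "lo < m j" if "j < n" for j using that by (auto simp: is_profile_def)
    have n: "n > 0" using p by (simp add: is_profile_def)
    have cost: "(\<Sum>j<n. h j * J (m j)) \<le> k" using p assms by (simp add: is_profile_def)
    have "sqrt mu * sigma_W W \<le> profile_energy W n h (\<lambda>_. mu)"
      using n h lo_pos lo_mu by (intro profile_energy_ge) auto
    also have "\<dots> \<le> (\<Sum>j<n. (1 + s / lo) * (2 / ((real n)\<^sup>2 * h j) + h j * m j * slot_max W n j) + W_max / (c * s) * (h j * J (m j)))"
      unfolding profile_energy_def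
    proof (rule sum_mono)
      fix j assume "j \<in> {..<n}"
      then have j: "j < n" by simp
      have S: "0 < slot_max W n j" "slot_max W n j \<le> W_max" using slot_max_pos[OF n] slot_max_le[OF n j] by auto
      have mu: "mu \<le> m j + s + J (m j) / (c * s)"
      proof (cases "mu \<le> m j")
        case True
        then show ?thesis using assms c_pos J_nonneg[OF m[OF j]] by (auto intro!: add_increasing2)
      next
        case False
        define x where "x = mu - m j"
        have x: "x > 0" using False by (simp add: x_def)
        have "x \<le> s + x\<^sup>2 / s"
        proof (cases "x \<le> s")
          case False
          then have "x * s \<le> x\<^sup>2" using x by (simp add: power2_eq_square)
          then have "x \<le> x\<^sup>2 / s" using assms by (simp add: field_simps)
          then show ?thesis using assms by linarith
        qed (use assms in \<open>simp add: add_increasing2\<close>)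
        also have "x\<^sup>2 / s = c * x\<^sup>2 / (c * s)" using c_pos by simp
        also have "\<dots> \<le> J (m j) / (c * s)"
          using J_below[OF m[OF j]] False c_pos assms by (intro divide_right_mono) (auto simp: x_def)
        finally show ?thesis by (simp add: x_def)
      qed
      have hs: "0 \<le> h j * slot_max W n j" using h[OF j] S by simp
      have "h j * mu * slot_max W n j = (h j * slot_max W n j) * mu" by simp
      also have "\<dots> \<le> (h j * slot_max W n j) * (m j + s + J (m j) / (c * s))"
        by (rule mult_left_mono[OF mu hs])
      also have "\<dots> = h j * m j * slot_max W n j + (h j * slot_max W n j) * s + slot_max W n j * (h j * J (m j) / (c * s))"
        by (simp add: algebra_simps)
      also have "(h j * slot_max W n j) * s \<le> s / lo * (h j * m j * slot_max W n j)"
      proof -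
        have "h j * slot_max W n j * s * lo \<le> h j * slot_max W n j * s * m j"
          using hs assms m[OF j] by (intro mult_left_mono) auto
        then show ?thesis using lo_pos by (simp add: field_simps)
      qed
      also have "slot_max W n j * (h j * J (m j) / (c * s)) \<le> W_max * (h j * J (m j) / (c * s))"
        using S h[OF j] J_nonneg[OF m[OF j]] c_pos assms by (intro mult_right_mono) auto
      finally have pot: "h j * mu * slot_max W n j
         \<le> (1 + s / lo) * (h j * m j * slot_max W n j) + W_max / (c * s) * (h j * J (m j))"
        by (simp add: algebra_simps)
      have "0 \<le> s / lo * (2 / ((real n)\<^sup>2 * h j))"
        using h[OF j] assms lo_pos by simp
      then have "2 / ((real n)\<^sup>2 * h j) \<le> (1 + s / lo) * (2 / ((real n)\<^sup>2 * h j))"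
        by (simp only: distrib_right mult_1 le_add_same_cancel1)
      then show "2 / ((real n)\<^sup>2 * h j) + h j * mu * slot_max W n j
        \<le> (1 + s / lo) * (2 / ((real n)\<^sup>2 * h j) + h j * m j * slot_max W n j) + W_max / (c * s) * (h j * J (m j))"
        using pot by (simp only: distrib_left)
    qed
    also have "\<dots> = (1 + s / lo) * profile_energy W n h m + W_max / (c * s) * (\<Sum>j<n. h j * J (m j))"
      unfolding sum.distrib[of "\<lambda>j. (1 + s / lo) * _ j"] profile_energy_def sum_distrib_left ..
    also have "\<dots> \<le> (1 + s / lo) * profile_energy W n h m + W_max / (c * s) * k"
      using cost W_max_pos c_pos assms by (intro add_left_mono mult_left_mono) auto
    finally have "sqrt mu * sigma_W W - W_max * k / (c * s) \<le> profile_energy W n h m * (1 + s / lo)"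
      by (simp add: mult.commute)
    moreover have "1 + s / lo > 0" using assms lo_pos by (simp add: add_pos_pos)
    ultimately show "(sqrt mu * sigma_W W - W_max * k / (c * s)) / (1 + s / lo) \<le> profile_energy W n h m"
      by (simp add: pos_divide_le_eq)
  qed
  moreover have "1 + s / lo > 0" using assms lo_pos by (simp add: add_pos_pos)
  ultimately show ?thesis by (simp add: pos_divide_le_eq mult.commute)
qed

text \<open>Take the mean everywhere except on a central piece of the range, where a coefficient half way
  between \<open>lo\<close> and the mean is used. The piece is of relative size \<open>1 / b\<close>, so short that its cost is at most
  \<open>k\<close>; there the potential is bounded below, so the energy drops by an amount \<open>G\<close> that is independent of
  the number of slots, and it beats all approximation errors.\<close>

lemma \<sigma>_strict:
  assumes "k > 0"
  shows "\<sigma> (ennreal k) < sqrt mu * sigma_W W"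
proof -
  define m0 where "m0 = (lo + mu) / 2"
  have m0: "lo < m0" "m0 < mu" using lo_mu by (auto simp: m0_def)
  have "compact {-1/2..1/2::real}" "{-1/2..1/2::real} \<noteq> {}" by auto
  from continuous_attains_inf[OF this W_cont_on] obtain x0 where
    x0: "x0 \<in> {-1/2..1/2}" "\<And>y. y\<in>{-1/2..1/2} \<Longrightarrow> W x0 \<le> W y" by blast
  define w0 where "w0 = W x0"
  have w0: "w0 > 0" using W_pos[of x0] x0 by (auto simp: w0_def)
  define D where "D = sqrt (2 * (m0 * w0))"
  have D: "D > 0" using m0 w0 lo_pos by (simp add: D_def)
  obtain b :: nat where b: "real b > 2 * J m0 / (D * k)" "b \<ge> 2"
  proof -
    obtain b' :: nat where "real b' > 2 * J m0 / (D * k)" using reals_Archimedean2 by blast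
    then show ?thesis using that[of "max b' 2"] by (simp add: max_def)
  qed
  define G where "G = 2 / real b * ((sqrt mu - sqrt m0) * sqrt (2 * w0))"
  have G: "G > 0" using b m0 w0 lo_pos by (simp add: G_def)
  have "((\<lambda>t. sqrt (mu + t) * (sigma_W W + t)) \<longlongrightarrow> sqrt mu * sigma_W W) (at_right 0)"
    by (auto intro!: tendsto_eq_intros)
  then have "\<forall>\<^sub>F t in at_right 0. sqrt (mu + t) * (sigma_W W + t) < sqrt mu * sigma_W W + G"
    by (rule order_tendstoD) (use G in simp)
  then obtain t where t: "t > 0" "sqrt (mu + t) * (sigma_W W + t) < sqrt mu * sigma_W W + G"
    by (rule eventually_at_right_obtain)
  from upper_sum_close[OF t(1)] obtain N where N: "\<forall>n\<ge>N. n > 0 \<longrightarrow> upper_sum n \<le> sigma_W W + t" by blast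
  define p where "p = Suc N"
  \<comment> \<open>With this number of slots the central piece from \<open>- 1 / b\<close> to \<open>1 / b\<close> is exactly the union of the slots in \<open>Z\<close>.\<close>
  define n where "n = 2 * b * p"
  have n: "n > 0" "n \<ge> N"
  proof -
    show "n > 0" using b by (simp add: n_def p_def)
    have "1 * p \<le> 2 * b * p" using b by (intro mult_right_mono) auto
    then show "n \<ge> N" by (simp add: n_def p_def)
  qed
  define Z where "Z = {b * p - p..<b * p + p}"
  have pb: "p \<le> b * p" using b by simp
  have Zn: "Z \<subseteq> {..<n}"   proof -
    have "n = b * p + b * p" by (simp add: n_def)
    then show ?thesis using pb unfolding Z_def subset_iff atLeastLessThan_iff lessThan_iff by linarith
  qed
  have cZ: "real (card Z) = 2 * real p" using pb by (simp add: Z_def)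
  have Zc: "real (card Z) * (2 / real n) = 2 / real b"
  proof -
    have "real b > 0" "real p > 0" using b by (simp_all add: p_def)
    then show ?thesis unfolding cZ n_def by (simp add: field_simps)
  qed
  define m where "m j = (if j \<in> Z then m0 else mu + t)" for j
  have mlo: "lo < m j" for j using m0 lo_mu t by (auto simp: m_def)
  have mpos: "0 < m j" for j using mlo[of j] lo_pos by linarith
  have bp: "real b > 0" "real p > 0" using b by (simp_all add: p_def)
  have SZ: "w0 \<le> slot_max W n j" if j: "j \<in> Z" for j
  proof -
    have "b * p \<le> j + p" "j + 1 \<le> b * p + p" using j by (auto simp: Z_def)
    then have "real (b * p) \<le> real (j + p)" "real (j + 1) \<le> real (b * p + p)" by (simp_all only: of_nat_le_iff)
    then have "real b * real p - real p \<le> real j" "real j \<le> real b * real p + real p" by simp_all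
    then have "(real b * real p - real p) / (real b * real p) \<le> real j / (real b * real p)"
       "real j / (real b * real p) \<le> (real b * real p + real p) / (real b * real p)"
      by (intro divide_right_mono; simp)+
    moreover have "(real b * real p - real p) / (real b * real p) = 1 - 1 / real b"
      "(real b * real p + real p) / (real b * real p) = 1 + 1 / real b"
      using bp by (simp_all add: diff_divide_distrib add_divide_distrib)
    moreover have "level n j = -1 + real j / (real b * real p)" using bp by (simp add: level_def n_def)
    moreover have "1 / real b \<le> 1 / 2" using b by (intro divide_left_mono) auto
    ultimately have "level n j \<in> {-1/2..1/2}" unfolding atLeastAtMost_iff by linarith
    then have "w0 \<le> W (level n j)" using x0(2) by (simp add: w0_def)
    also have "\<dots> \<le> slot_max W n j" using level_less[OF n(1), of j] by (intro slot_max_upper) auto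
    finally show ?thesis .
  qed
  have h: "0 < best_width n m j" for j using n mpos by (intro best_width_pos)
  have "(\<Sum>j<n. best_width n m j * J (m j)) = (\<Sum>j\<in>Z. best_width n m j * J m0)"
    using Zn t by (intro sum.mono_neutral_cong_right) (auto simp: m_def J_above)
  also have "\<dots> \<le> (\<Sum>j\<in>Z. 2 / real n / D * J m0)"
  proof (intro sum_mono mult_right_mono J_nonneg m0)
    fix j assume j: "j \<in> Z"
    have "D \<le> sqrt (2 * (m j * slot_max W n j))"
      unfolding D_def using j SZ[OF j] m0 lo_pos by (auto simp: m_def intro!: mult_left_mono)
    then show "best_width n m j \<le> 2 / real n / D"
      unfolding best_width_def using D n by (intro divide_left_mono mult_pos_pos)
        (use slot_max_pos[OF n(1)] mpos in auto)
  qed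
  also have "\<dots> = (real (card Z) * (2 / real n)) * (J m0 / D)" by simp
  also have "\<dots> = 2 * J m0 / (D * real b)" unfolding Zc by simp
  also have "\<dots> \<le> k"
  proof -
    have "2 * J m0 < real b * (D * k)" using b D assms by (simp add: pos_divide_less_eq)
    then show ?thesis using D b by (simp add: pos_divide_le_eq mult_ac)
  qed
  finally have "is_profile lo J (ennreal k) n (best_width n m) m"
    using n h mlo by (auto simp: is_profile_def intro: ennreal_leI)
  from \<sigma>_le[OF this] have "\<sigma> (ennreal k) \<le> (\<Sum>j<n. 2 / real n * sqrt (2 * (m j * slot_max W n j)))"
    using profile_energy_best_width[OF n(1), of m] mpos by simp
  also have "\<dots> \<le> (\<Sum>j<n. sqrt (mu + t) * (2 / real n * sqrt (2 * slot_max W n j))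
      - (if j \<in> Z then 2 / real n * ((sqrt mu - sqrt m0) * sqrt (2 * w0)) else 0))"
  proof (rule sum_mono)
    fix j assume "j \<in> {..<n}"
    show "2 / real n * sqrt (2 * (m j * slot_max W n j)) \<le> sqrt (mu + t) * (2 / real n * sqrt (2 * slot_max W n j))
      - (if j \<in> Z then 2 / real n * ((sqrt mu - sqrt m0) * sqrt (2 * w0)) else 0)"
    proof (cases "j \<in> Z")
      case True
      have "(sqrt mu - sqrt m0) * sqrt (2 * w0) \<le> (sqrt (mu + t) - sqrt m0) * sqrt (2 * slot_max W n j)"
        using SZ[OF True] m0 t w0 by (intro mult_mono) auto
      then have "sqrt m0 * sqrt (2 * slot_max W n j) \<le> sqrt (mu + t) * sqrt (2 * slot_max W n j) - (sqrt mu - sqrt m0) * sqrt (2 * w0)"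
        by (simp add: left_diff_distrib)
      from mult_left_mono[OF this, of "2 / real n"] show ?thesis
        using True by (simp only: if_True m_def right_diff_distrib real_sqrt_mult[of m0, symmetric]) (simp add: real_sqrt_mult mult_ac)
    next
      case False
      then show ?thesis by (simp add: m_def real_sqrt_mult mult_ac)
    qed
  qed
  also have "\<dots> = sqrt (mu + t) * upper_sum n - real (card Z) * (2 / real n * ((sqrt mu - sqrt m0) * sqrt (2 * w0)))"
    unfolding sum_subtractf upper_sum_def sum_distrib_left[symmetric]
    using Zn by (simp add: sum.If_cases Int_absorb1)
  also have "real (card Z) * (2 / real n * ((sqrt mu - sqrt m0) * sqrt (2 * w0))) = G"
    unfolding G_def Zc[symmetric] by (simp only: mult.assoc)
  also have "sqrt (mu + t) * upper_sum n - G \<le> sqrt (mu + t) * (sigma_W W + t) - G"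
    using N n t lo_pos lo_mu by (auto intro!: mult_left_mono)
  also have "\<dots> < sqrt mu * sigma_W W" using t by simp
  finally show ?thesis .
qed

lemma \<sigma>_pos: "\<sigma> \<kappa> > 0"
  using \<sigma>_ge[of \<kappa>] sigma_W_pos lo_pos by (meson less_le_trans mult_pos_pos real_sqrt_gt_zero)

text \<open>At 0 this is \<open>\<sigma>_near_0\<close> with \<open>k = s\<^sup>2\<close>; at positive values it is scaling.\<close>

lemma \<sigma>_right_continuous:
  assumes "a < \<sigma> (ennreal k)" "k \<ge> 0"
  shows "\<exists>k'>k. a < \<sigma> (ennreal k')"
proof (cases "k = 0")
  case True
  then have a: "a < sqrt mu * sigma_W W" using assms \<sigma>_0 by simp
  have "((\<lambda>s. (sqrt mu * sigma_W W - W_max * s / c) / (1 + s / lo)) \<longlongrightarrow> sqrt mu * sigma_W W) (at_right 0)"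
    using lo_pos c_pos by (auto intro!: tendsto_eq_intros)
  from order_tendstoD(1)[OF this a] obtain s where s: "s > 0"
    "a < (sqrt mu * sigma_W W - W_max * s / c) / (1 + s / lo)"
    by (rule eventually_at_right_obtain)
  have pos: "1 + s / lo > 0" using s lo_pos by (simp add: add_pos_pos)
  have "sqrt mu * sigma_W W \<le> (1 + s / lo) * \<sigma> (ennreal (s * s)) + W_max * (s * s) / (c * s)"
    using \<sigma>_near_0[of s "s * s"] s by simp
  moreover have "W_max * (s * s) / (c * s) = W_max * s / c" using s by simp
  moreover have "(1 + s / lo) * a < sqrt mu * sigma_W W - W_max * s / c"
    using s(2) pos by (simp add: pos_less_divide_eq mult.commute)
  ultimately have "(1 + s / lo) * a < (1 + s / lo) * \<sigma> (ennreal (s * s))" by linarith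
  then have "a < \<sigma> (ennreal (s * s))" using pos by (simp only: mult_less_cancel_left_pos)
  then show ?thesis using s True by (intro exI[of _ "s * s"]) auto
next
  case False
  then have k: "k > 0" using assms by simp
  have "((\<lambda>l. \<sigma> (ennreal k) / l) \<longlongrightarrow> \<sigma> (ennreal k)) (at_right 1)"
    by (auto intro!: tendsto_eq_intros)
  from order_tendstoD(1)[OF this assms(1)] obtain l where l: "l > 1" "a < \<sigma> (ennreal k) / l"
    by (rule eventually_at_right_obtain)
  have "\<sigma> (ennreal k) / l \<le> \<sigma> (ennreal (l * k))" using \<sigma>_scaling[of l k] l k by (simp add: field_simps)
  then show ?thesis using l k by (intro exI[of _ "l * k"]) auto
qed

text \<open>At infinity it holds because each single profile has finite cost; elsewhere it is scaling.\<close>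

lemma \<sigma>_left_continuous:
  assumes "\<sigma> \<kappa> < a" "\<kappa> > 0"
  shows "\<exists>k\<ge>0. ennreal k < \<kappa> \<and> \<sigma> (ennreal k) < a"
proof (cases \<kappa>)
  case top
  from \<sigma>_less[OF assms(1)] obtain n h m where p: "is_profile lo J \<kappa> n h m" "profile_energy W n h m < a" .
  define k where "k = max 0 (\<Sum>j<n. h j * J (m j))"
  have "is_profile lo J (ennreal k) n h m" using p by (auto simp: is_profile_def k_def intro: ennreal_leI)
  from \<sigma>_le[OF this] p have "\<sigma> (ennreal k) < a" by simp
  then show ?thesis using top by (intro exI[of _ k]) (auto simp: k_def)
next
  case (real k)
  then have k: "k > 0" using assms by auto
  have "((\<lambda>l. l * \<sigma> (ennreal k)) \<longlongrightarrow> 1 * \<sigma> (ennreal k)) (at_right 1)"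
    by (intro tendsto_intros)
  then have "\<forall>\<^sub>F l in at_right 1. l * \<sigma> (ennreal k) < a"
    by (rule order_tendstoD) (use assms real in simp)
  then obtain l where l: "l > 1" "l * \<sigma> (ennreal k) < a"
    by (rule eventually_at_right_obtain)
  have "\<sigma> (ennreal (k / l)) \<le> l * \<sigma> (ennreal k)" using \<sigma>_scaling[of l "k / l"] l k by simp
  moreover have "k / l < k" using l k by (simp add: divide_less_eq)
  ultimately show ?thesis using l k real by (intro exI[of _ "k / l"]) (auto simp: ennreal_less_iff)
qed

text \<open>For a nonincreasing function the two one-sided statements are enough.\<close>

lemma \<sigma>_continuous: "continuous_on UNIV \<sigma>"
proof -
  have "(\<sigma> \<longlongrightarrow> \<sigma> \<kappa>) (nhds \<kappa>)" for \<kappa>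
  proof (rule order_tendstoI)
    fix a assume a: "a < \<sigma> \<kappa>"
    show "\<forall>\<^sub>F x in nhds \<kappa>. a < \<sigma> x"
    proof (cases \<kappa>)
      case top
      then have "a < \<sigma> x" for x using a \<sigma>_antimono[of x \<kappa>] by simp
      then show ?thesis by simp
    next
      case (real k)
      then obtain k' where k': "k' > k" "a < \<sigma> (ennreal k')" using \<sigma>_right_continuous[of a k] a by auto
      then have "\<forall>\<^sub>F x in nhds \<kappa>. x < ennreal k'"
        using real by (intro eventually_nhds_in_open[of "{..<ennreal k'}", simplified]) (auto simp: ennreal_less_iff)
      then show ?thesis
        by (rule eventually_mono) (use k' \<sigma>_antimono in \<open>meson less_imp_le less_le_trans\<close>)
    qed
  next
    fix a assume a: "\<sigma> \<kappa> < a"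
    show "\<forall>\<^sub>F x in nhds \<kappa>. \<sigma> x < a"
    proof (cases "\<kappa> = 0")
      case True
      then have "\<sigma> x < a" for x using a \<sigma>_antimono[of \<kappa> x] by simp
      then show ?thesis by simp
    next
      case False
      then obtain k where k: "ennreal k < \<kappa>" "\<sigma> (ennreal k) < a"
        using \<sigma>_left_continuous[OF a] by (auto simp: zero_less_iff_neq_zero)
      then have "\<forall>\<^sub>F x in nhds \<kappa>. ennreal k < x"
        by (intro eventually_nhds_in_open[of "{ennreal k<..}", simplified]) auto
      then show ?thesis
        by (rule eventually_mono) (use k \<sigma>_antimono in \<open>meson less_imp_le le_less_trans\<close>)
    qed
  qed
  then show ?thesis
    unfolding continuous_on_def by (blast intro: tendsto_mono[OF at_within_le_nhds])
qed

end

section \<open>Large deviations of block averages\<close>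

locale iid_bounded = prob_space M for M :: "'a measure" +
  fixes \<Theta> :: "int \<Rightarrow> 'a \<Rightarrow> real" and lo hi :: real
  assumes indep: "indep_vars (\<lambda>_. borel) \<Theta> UNIV"
    and ident: "\<And>z. distr M borel (\<Theta> z) = distr M borel (\<Theta> 0)"
    and bounds: "\<And>z. AE \<omega> in M. lo \<le> \<Theta> z \<omega> \<and> \<Theta> z \<omega> \<le> hi"
    and lo_pos: "0 < lo" and lo_hi: "lo < hi"
    and lower_tail: "\<And>m. lo < m \<Longrightarrow> prob {\<omega> \<in> space M. \<Theta> 0 \<omega> \<le> m} > 0"
begin

lemma measurable_\<Theta> [measurable]: "\<Theta> z \<in> borel_measurable M"
  using indep by (simp add: indep_vars_def)

text \<open>Functions of the variables in disjoint blocks are independent.\<close>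

lemma prob_blocks:
  assumes L: "finite L" and K: "disjoint_family_on K L"
    and E: "\<And>j. j \<in> L \<Longrightarrow> E j \<in> sets (PiM (K j) (\<lambda>_. borel))"
  shows "prob {\<omega> \<in> space M. \<forall>j\<in>L. restrict (\<lambda>z. \<Theta> z \<omega>) (K j) \<in> E j}
    = (\<Prod>j\<in>L. prob {\<omega> \<in> space M. restrict (\<lambda>z. \<Theta> z \<omega>) (K j) \<in> E j})"
proof (cases "L = {}")
  case True
  then show ?thesis by (simp add: prob_space)
next
  case False
  have "indep_vars (\<lambda>j. PiM (K j) (\<lambda>_. borel)) (\<lambda>j \<omega>. restrict (\<lambda>z. \<Theta> z \<omega>) (K j)) L"
    by (rule indep_vars_restrict[OF indep _ K]) simp
  from indep_varsD_finite[OF this False L E]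
  have "prob (\<Inter>j\<in>L. (\<lambda>\<omega>. restrict (\<lambda>z. \<Theta> z \<omega>) (K j)) -` E j \<inter> space M)
    = (\<Prod>j\<in>L. prob ((\<lambda>\<omega>. restrict (\<lambda>z. \<Theta> z \<omega>) (K j)) -` E j \<inter> space M))" .
  moreover have "(\<Inter>j\<in>L. (\<lambda>\<omega>. restrict (\<lambda>z. \<Theta> z \<omega>) (K j)) -` E j \<inter> space M)
     = {\<omega> \<in> space M. \<forall>j\<in>L. restrict (\<lambda>z. \<Theta> z \<omega>) (K j) \<in> E j}"
    using False by auto
  moreover have "(\<lambda>\<omega>. restrict (\<lambda>z. \<Theta> z \<omega>) (K j)) -` E j \<inter> space M
     = {\<omega> \<in> space M. restrict (\<lambda>z. \<Theta> z \<omega>) (K j) \<in> E j}" for j by auto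
  ultimately show ?thesis by simp
qed

lemma prob_sums:
  assumes L: "finite L" and K: "disjoint_family_on K L"
  shows "prob {\<omega> \<in> space M. \<forall>j\<in>L. (\<Sum>z\<in>K j. \<Theta> z \<omega>) \<le> c j}
    = (\<Prod>j\<in>L. prob {\<omega> \<in> space M. (\<Sum>z\<in>K j. \<Theta> z \<omega>) \<le> c j})"
proof -
  define E where "E j = {f \<in> space (PiM (K j) (\<lambda>_. borel)). (\<Sum>z\<in>K j. f z) \<le> c j}" for j
  have E: "E j \<in> sets (PiM (K j) (\<lambda>_. borel))" for j
    unfolding E_def by measurable
  have eq: "restrict (\<lambda>z. \<Theta> z \<omega>) (K j) \<in> E j \<longleftrightarrow> (\<Sum>z\<in>K j. \<Theta> z \<omega>) \<le> c j" for j \<omega>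
    by (auto simp: E_def space_PiM cong: sum.cong)
  show ?thesis using prob_blocks[OF L K E] unfolding eq .
qed

text \<open>The index \<open>w\<close> ranges over windows and \<open>j\<close> over the blocks of a window; independence is used twice,
  between windows and between the blocks of one window.\<close>

lemma prob_no_window:
  assumes A: "finite A" and L: "finite L"
    and K: "disjoint_family_on (\<lambda>(w, j). K w j) (A \<times> L)"
  shows "prob {\<omega> \<in> space M. \<forall>w\<in>A. \<not> (\<forall>j\<in>L. (\<Sum>z\<in>K w j. \<Theta> z \<omega>) \<le> c j)}
    = (\<Prod>w\<in>A. 1 - (\<Prod>j\<in>L. prob {\<omega> \<in> space M. (\<Sum>z\<in>K w j. \<Theta> z \<omega>) \<le> c j}))"
proof -
  let ?U = "\<lambda>w. \<Union>j\<in>L. K w j"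
  define E where "E w = {f \<in> space (PiM (?U w) (\<lambda>_. borel)). \<not> (\<forall>j\<in>L. (\<Sum>z\<in>K w j. f z) \<le> c j)}" for w
  have E: "E w \<in> sets (PiM (?U w) (\<lambda>_. borel))" for w
  proof -
    have m: "(\<lambda>f. \<Sum>z\<in>K w j. f z) \<in> borel_measurable (PiM (?U w) (\<lambda>_. borel :: real measure))"
      if "j \<in> L" for j
      using that by (intro borel_measurable_sum measurable_component_singleton) auto
    have "{f \<in> space (PiM (?U w) (\<lambda>_. borel)). \<forall>j\<in>L. (\<Sum>z\<in>K w j. f z) \<le> c j} \<in> sets (PiM (?U w) (\<lambda>_. borel))"
      using L m by (intro sets.sets_Collect_finite_All) (auto intro!: borel_measurable_le)
    then show ?thesis unfolding E_def by (rule sets.sets_Collect_neg)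
  qed
  have eq: "restrict (\<lambda>z. \<Theta> z \<omega>) (?U w) \<in> E w \<longleftrightarrow> \<not> (\<forall>j\<in>L. (\<Sum>z\<in>K w j. \<Theta> z \<omega>) \<le> c j)" for w \<omega>
  proof -
    have "(\<Sum>z\<in>K w j. restrict (\<lambda>z. \<Theta> z \<omega>) (?U w) z) = (\<Sum>z\<in>K w j. \<Theta> z \<omega>)" if "j \<in> L" for j
      using that by (intro sum.cong) auto
    then show ?thesis by (auto simp: E_def space_PiM)
  qed
  have "disjoint_family_on ?U A"
    unfolding disjoint_family_on_def
  proof (intro ballI impI)
    fix w w' assume w: "w \<in> A" "w' \<in> A" "w \<noteq> w'"
    have "K w j \<inter> K w' j' = {}" if "j \<in> L" "j' \<in> L" for j j'
      using K w that unfolding disjoint_family_on_def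
      by (auto dest!: bspec[of _ _ "(w, j)"] bspec[of _ _ "(w', j')"])
    then show "?U w \<inter> ?U w' = {}" by blast
  qed
  from prob_blocks[OF A this E]
  have "prob {\<omega> \<in> space M. \<forall>w\<in>A. \<not> (\<forall>j\<in>L. (\<Sum>z\<in>K w j. \<Theta> z \<omega>) \<le> c j)}
    = (\<Prod>w\<in>A. prob {\<omega> \<in> space M. \<not> (\<forall>j\<in>L. (\<Sum>z\<in>K w j. \<Theta> z \<omega>) \<le> c j)})"
    unfolding eq .
  also have "\<dots> = (\<Prod>w\<in>A. 1 - (\<Prod>j\<in>L. prob {\<omega> \<in> space M. (\<Sum>z\<in>K w j. \<Theta> z \<omega>) \<le> c j}))"
  proof (rule prod.cong)
    fix w assume w: "w \<in> A"
    have "disjoint_family_on (K w) L"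
      using K w unfolding disjoint_family_on_def
      by (auto dest!: bspec[of _ _ "(w, _)"])
    from prob_sums[OF L this, of c]
    show "prob {\<omega> \<in> space M. \<not> (\<forall>j\<in>L. (\<Sum>z\<in>K w j. \<Theta> z \<omega>) \<le> c j)} =
      1 - (\<Prod>j\<in>L. prob {\<omega> \<in> space M. (\<Sum>z\<in>K w j. \<Theta> z \<omega>) \<le> c j})"
      using L by (subst prob_neg) (auto intro!: sets.sets_Collect_finite_All)
  qed simp
  finally show ?thesis .
qed

text \<open>By induction, the law of the sum is the convolution power of the common law, so only the number of
  summands matters.\<close>

lemma distr_sum_eq:
  assumes "finite K" "finite K'" "card K = card K'"
  shows "distr M borel (\<lambda>\<omega>. \<Sum>z\<in>K. \<Theta> z \<omega>) = distr M borel (\<lambda>\<omega>. \<Sum>z\<in>K'. \<Theta> z \<omega>)"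
  using assms
proof (induction K arbitrary: K' rule: finite_induct)
  case empty
  then show ?case by simp
next
  case (insert x F)
  then obtain y F' where K': "K' = insert y F'" "y \<notin> F'" "finite F'" "card F' = card F"
    by (metis card_Suc_eq card.insert finite_insert)
  have conv: "distr M borel (\<lambda>\<omega>. \<Sum>z\<in>insert x F. \<Theta> z \<omega>)
     = convolution (distr M borel (\<Theta> x)) (distr M borel (\<lambda>\<omega>. \<Sum>z\<in>F. \<Theta> z \<omega>))"
    if "x \<notin> F" "finite F" for x F
    using that
    by (subst sum_indep_random_variable[symmetric])
       (auto intro!: indep_vars_sum indep_vars_subset[OF indep])
  have "distr M borel (\<lambda>\<omega>. \<Sum>z\<in>F. \<Theta> z \<omega>) = distr M borel (\<lambda>\<omega>. \<Sum>z\<in>F'. \<Theta> z \<omega>)"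
    by (rule insert.IH) (use K' in auto)
  then show ?case
    unfolding K'(1) conv[OF insert.hyps(2,1)] conv[OF K'(2,3)] ident[of x] ident[of y] by (rule arg_cong)
qed

definition tail_prob :: "nat \<Rightarrow> real \<Rightarrow> real" where
  "tail_prob r m = prob {\<omega> \<in> space M. (\<Sum>z\<in>{0..<int r}. \<Theta> z \<omega>) \<le> real r * m}"

lemma prob_sum_le:
  assumes "finite K"
  shows "prob {\<omega> \<in> space M. (\<Sum>z\<in>K. \<Theta> z \<omega>) \<le> real (card K) * m} = tail_prob (card K) m"
proof -
  have "prob {\<omega> \<in> space M. (\<Sum>z\<in>K. \<Theta> z \<omega>) \<le> c} = measure (distr M borel (\<lambda>\<omega>. \<Sum>z\<in>K. \<Theta> z \<omega>)) {..c}" for K c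
    by (subst measure_distr) (auto simp: vimage_def Int_def conj_commute)
  moreover have "card K = card {0..<int (card K)}" by simp
  ultimately show ?thesis
    unfolding tail_prob_def using distr_sum_eq[OF assms, of "{0..<int (card K)}"] by simp
qed

lemma tail_prob_le_1: "tail_prob r m \<le> 1" and tail_prob_nonneg: "tail_prob r m \<ge> 0"
  by (auto simp: tail_prob_def)

text \<open>Two adjacent blocks with averages at most \<open>m\<close> form one block with average at most \<open>m\<close>.\<close>

lemma tail_prob_supermult: "tail_prob r m * tail_prob s m \<le> tail_prob (r + s) m"
proof -
  define K where "K b = (if b then {0..<int r} else {int r..<int (r + s)})" for b
  have "disjoint_family_on K UNIV" by (auto simp: disjoint_family_on_def K_def)
  from prob_sums[OF _ this, of "\<lambda>b. real (card (K b)) * m"]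
  have "prob {\<omega> \<in> space M. \<forall>j\<in>UNIV. (\<Sum>z\<in>K j. \<Theta> z \<omega>) \<le> real (card (K j)) * m} = tail_prob r m * tail_prob s m"
    by (simp add: prob_sum_le UNIV_bool K_def)
  moreover have "prob {\<omega> \<in> space M. \<forall>j\<in>UNIV. (\<Sum>z\<in>K j. \<Theta> z \<omega>) \<le> real (card (K j)) * m} \<le> tail_prob (r + s) m"
    unfolding tail_prob_def
  proof (rule finite_measure_mono)
    have split: "{0..<int (r + s)} = {0..<int r} \<union> {int r..<int (r + s)}" by auto
    have "(\<Sum>z\<in>{0..<int (r + s)}. f z) = (\<Sum>z\<in>{0..<int r}. f z) + (\<Sum>z\<in>{int r..<int (r + s)}. f z)" for f :: "int \<Rightarrow> real"
      unfolding split by (rule sum.union_disjoint) auto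
    then show "{\<omega> \<in> space M. \<forall>j\<in>UNIV. (\<Sum>z\<in>K j. \<Theta> z \<omega>) \<le> real (card (K j)) * m}
      \<subseteq> {\<omega> \<in> space M. (\<Sum>z\<in>{0..<int (r + s)}. \<Theta> z \<omega>) \<le> real (r + s) * m}"
      by (auto simp: UNIV_bool K_def distrib_right)
  qed measurable
  ultimately show ?thesis by simp
qed

lemma tail_prob_1: "tail_prob 1 m = prob {\<omega> \<in> space M. \<Theta> 0 \<omega> \<le> m}"
  using prob_sum_le[of "{0}" m] by simp

lemma tail_prob_0: "tail_prob 0 m = 1"
  by (simp add: tail_prob_def prob_space)

lemma tail_prob_power: "tail_prob s m ^ n \<le> tail_prob (n * s) m"
proof (induction n)
  case 0
  then show ?case by (simp add: tail_prob_0)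
next
  case (Suc n)
  have "tail_prob s m ^ Suc n \<le> tail_prob s m * tail_prob (n * s) m"
    using Suc tail_prob_nonneg by (simp add: mult_left_mono)
  also have "\<dots> \<le> tail_prob (Suc n * s) m" using tail_prob_supermult[of s m "n * s"] by simp
  finally show ?case .
qed

lemma tail_prob_pos:
  assumes "lo < m"
  shows "tail_prob r m > 0"
proof -
  have "0 < tail_prob 1 m ^ r" using lower_tail[OF assms] tail_prob_1[of m] by simp
  also have "\<dots> \<le> tail_prob r m" using tail_prob_power[of 1 m r] by simp
  finally show ?thesis .
qed

text \<open>By \<open>tail_prob_supermult\<close> and Fekete's argument this infimum is also the limit as \<open>r\<close> tends to infinity.
  It is the lower Cramer rate function.\<close>

definition rate :: "real \<Rightarrow> real" where
  "rate m = (INF r\<in>{1..}. - ln (tail_prob r m) / real r)"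

lemma rate_bdd: "lo < m \<Longrightarrow> bdd_below ((\<lambda>r. - ln (tail_prob r m) / real r) ` {1..})"
proof (rule bdd_belowI2[of _ 0])
  fix r :: nat assume "r \<in> {1..}" "lo < m"
  then show "0 \<le> - ln (tail_prob r m) / real r"
    using tail_prob_pos[of m r] tail_prob_le_1[of r m] by (simp add: divide_nonpos_nonneg)
qed

lemma rate_nonneg: "lo < m \<Longrightarrow> rate m \<ge> 0"
  unfolding rate_def
proof (rule cINF_greatest)
  fix r :: nat assume "r \<in> {1..}" "lo < m"
  then show "0 \<le> - ln (tail_prob r m) / real r"
    using tail_prob_pos[of m r] tail_prob_le_1[of r m] by (simp add: divide_nonpos_nonneg)
qed simp

lemma tail_prob_upper:
  assumes "lo < m"
  shows "tail_prob r m \<le> exp (- real r * rate m)"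
proof (cases "r = 0")
  case False
  then have "rate m \<le> - ln (tail_prob r m) / real r"
    unfolding rate_def using rate_bdd[OF assms] by (intro cINF_lower) auto
  then have "ln (tail_prob r m) \<le> - real r * rate m" using False by (simp add: field_simps)
  then have "exp (ln (tail_prob r m)) \<le> exp (- real r * rate m)" by simp
  then show ?thesis using tail_prob_pos[OF assms] by simp
qed (simp add: tail_prob_0)

text \<open>Fekete's argument: choose a block length \<open>s\<close> that nearly attains the infimum, and divide a long block
  into blocks of length \<open>s\<close> and fewer than \<open>s\<close> single cells.\<close>

lemma tail_prob_lower:
  assumes m: "lo < m" and e: "e > 0"
  shows "\<exists>R. \<forall>r\<ge>R. tail_prob r m \<ge> exp (- real r * (rate m + e))"
proof -
  have "rate m < rate m + e / 2" using e by simp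
  then obtain s where s: "s \<ge> 1" "- ln (tail_prob s m) / real s < rate m + e / 2"
    unfolding rate_def using rate_bdd[OF m] by (subst (asm) cINF_less_iff) auto
  define C where "C = - ln (tail_prob 1 m)"
  have C0: "C \<ge> 0" using tail_prob_le_1[of 1 m] tail_prob_pos[OF m, of 1] by (simp add: C_def)
  obtain R :: nat where R: "real R \<ge> 2 * (real s * C) / e" using real_arch_simple by blast
  show ?thesis
  proof (intro exI allI impI)
    fix r assume r: "r \<ge> R"
    let ?q = "r div s" and ?t = "r mod s"
    have "tail_prob s m ^ ?q * tail_prob 1 m ^ ?t \<le> tail_prob (?q * s) m * tail_prob ?t m"
      using tail_prob_power[of s m ?q] tail_prob_power[of 1 m ?t] tail_prob_nonneg
      by (intro mult_mono) auto
    also have "\<dots> \<le> tail_prob (?q * s + ?t) m" by (rule tail_prob_supermult)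
    finally have le: "tail_prob s m ^ ?q * tail_prob 1 m ^ ?t \<le> tail_prob r m" by simp
    have p: "tail_prob s m > 0" "tail_prob 1 m > 0" using tail_prob_pos m by auto
    have "ln (tail_prob s m ^ ?q * tail_prob 1 m ^ ?t) = real ?q * ln (tail_prob s m) - real ?t * C"
      using p by (simp add: ln_mult ln_realpow C_def)
    then have eq: "tail_prob s m ^ ?q * tail_prob 1 m ^ ?t = exp (real ?q * ln (tail_prob s m) - real ?t * C)"
      using p by (metis exp_ln mult_pos_pos zero_less_power)
    have qs: "real (?q * s) \<le> real r" by (simp only: of_nat_le_iff div_times_less_eq_dividend)
    have "real ?q * - ln (tail_prob s m) \<le> real ?q * (real s * (rate m + e/2))"
      using s by (intro mult_left_mono) (auto simp: field_simps)
    also have "\<dots> = real (?q * s) * (rate m + e/2)" by simp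
    also have "\<dots> \<le> real r * (rate m + e/2)"
      using rate_nonneg[OF m] e qs by (intro mult_right_mono) auto
    finally have 1: "real ?q * ln (tail_prob s m) \<ge> - (real r * (rate m + e/2))" by simp
    have "real ?t * C \<le> real s * C"
      using s C0 by (intro mult_right_mono) (auto intro: less_imp_le)
    also have "\<dots> \<le> real r * (e / 2)"
    proof -
      have "2 * (real s * C) / e \<le> real r" using R r by linarith
      then show ?thesis using e by (simp add: field_simps)
    qed
    finally have "- real r * (rate m + e) \<le> real ?q * ln (tail_prob s m) - real ?t * C"
      using 1 by (simp add: algebra_simps)
    then show "exp (- real r * (rate m + e)) \<le> tail_prob r m"
      using le eq by (metis exp_le_cancel_iff order_trans)
  qed
qed

abbreviation "mean \<equiv> expectation (\<Theta> 0)"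

lemma Hoeffding_\<Theta>: "Hoeffding_ineq_iid M {0..<int r} \<Theta> (\<Theta> 0) lo hi"
proof (intro Hoeffding_ineq_iid.intro iid_interval_bounded_random_variables.intro
    iid_interval_bounded_random_variables_axioms.intro)
  show "prob_space M" by (rule prob_space_axioms)
  show "indep_vars (\<lambda>_. borel) \<Theta> {0..<int r}" by (rule indep_vars_subset[OF indep]) simp
  show "distr M borel (\<Theta> i) = distr M borel (\<Theta> 0)" for i by (rule ident)
  show "AE x in M. \<Theta> 0 x \<in> {lo..hi}" using bounds[of 0] by simp
qed simp_all

lemma Hoeffding_tail:
  assumes "s \<ge> 0" "r > 0"
  shows "tail_prob r (mean - s) \<le> exp (- real r * (2 * s\<^sup>2 / (hi - lo)\<^sup>2))"
    and "s > 0 \<Longrightarrow> 1 - tail_prob r (mean + s) \<le> exp (- real r * (2 * s\<^sup>2 / (hi - lo)\<^sup>2))"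
proof -
  have ne: "{0..<int r} \<noteq> {}" using assms by simp
  note H = Hoeffding_ineq_iid.Hoeffding_ineq_le[OF Hoeffding_\<Theta> _ lo_hi ne, of "real r * s"]
    Hoeffding_ineq_iid.Hoeffding_ineq_ge[OF Hoeffding_\<Theta> _ lo_hi ne, of "real r * s"]
  have ex: "-2 * (real r * s)\<^sup>2 / (real r * (hi - lo)\<^sup>2) = - real r * (2 * s\<^sup>2 / (hi - lo)\<^sup>2)"
    using assms by (simp add: power_mult_distrib power2_eq_square[of "real r"])
  show "tail_prob r (mean - s) \<le> exp (- real r * (2 * s\<^sup>2 / (hi - lo)\<^sup>2))"
    using H(1) assms ex unfolding tail_prob_def by (simp add: right_diff_distrib)
  assume "s > 0"
  have "1 - tail_prob r (mean + s) = prob {\<omega> \<in> space M. \<not> ((\<Sum>z\<in>{0..<int r}. \<Theta> z \<omega>) \<le> real r * (mean + s))}"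
    unfolding tail_prob_def by (rule prob_neg[symmetric]) measurable
  also have "\<dots> \<le> prob {\<omega> \<in> space M. (\<Sum>z\<in>{0..<int r}. \<Theta> z \<omega>) \<ge> real r * mean + real r * s}"
    by (rule finite_measure_mono) (auto simp: distrib_left)
  also have "\<dots> \<le> exp (- real r * (2 * s\<^sup>2 / (hi - lo)\<^sup>2))"
    using H(2) assms ex by simp
  finally show "1 - tail_prob r (mean + s) \<le> exp (- real r * (2 * s\<^sup>2 / (hi - lo)\<^sup>2))" .
qed

lemma rate_quadratic:
  assumes "lo < m" "m \<le> mean"
  shows "rate m \<ge> 2 / (hi - lo)\<^sup>2 * (mean - m)\<^sup>2"
  unfolding rate_def
proof (rule cINF_greatest)
  fix r :: nat assume r: "r \<in> {1..}"
  have "tail_prob r m \<le> exp (- real r * (2 * (mean - m)\<^sup>2 / (hi - lo)\<^sup>2))"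
    using Hoeffding_tail(1)[of "mean - m" r] assms r by simp
  then have "ln (tail_prob r m) \<le> - real r * (2 * (mean - m)\<^sup>2 / (hi - lo)\<^sup>2)"
    using tail_prob_pos[OF assms(1), of r] by (metis ln_exp ln_le_cancel_iff exp_gt_zero)
  then show "2 / (hi - lo)\<^sup>2 * (mean - m)\<^sup>2 \<le> - ln (tail_prob r m) / real r"
    using r by (simp add: field_simps)
qed simp

lemma tail_prob_tendsto_1:
  assumes "mean < m"
  shows "(\<lambda>r. tail_prob r m) \<longlonglongrightarrow> 1"
proof -
  define c where "c = 2 * (m - mean)\<^sup>2 / (hi - lo)\<^sup>2"
  have c: "c > 0" using assms lo_hi by (simp add: c_def)
  have "(\<lambda>r. 1 - exp (- real r * c)) \<longlonglongrightarrow> 1" using c by real_asymp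
  moreover have "\<forall>\<^sub>F r in sequentially. 1 - exp (- real r * c) \<le> tail_prob r m"
    using eventually_gt_at_top[of 0]
  proof eventually_elim
    case (elim r)
    then show ?case using Hoeffding_tail(2)[of "m - mean" r] assms by (simp add: c_def)
  qed
  ultimately show ?thesis
    by (rule tendsto_sandwich[rotated 2, OF _ tendsto_const]) (auto simp: tail_prob_le_1)
qed

lemma rate_zero:
  assumes "lo < m" "mean < m"
  shows "rate m = 0"
proof (rule antisym)
  have "(\<lambda>r. - ln (tail_prob r m)) \<longlonglongrightarrow> - ln 1"
    by (intro tendsto_intros tail_prob_tendsto_1 assms) simp
  then have lim: "(\<lambda>r. - ln (tail_prob r m)) \<longlonglongrightarrow> 0" by simp
  have lim2: "(\<lambda>r. - ln (tail_prob r m) / real r) \<longlonglongrightarrow> 0"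
    by (rule tendsto_divide_0[OF lim]) (rule filterlim_at_top_imp_at_infinity[OF filterlim_real_sequentially])
  have "\<forall>\<^sub>F r in sequentially. rate m \<le> - ln (tail_prob r m) / real r"
    using eventually_ge_at_top[of 1]
  proof eventually_elim
    case (elim r)
    then show ?case unfolding rate_def using rate_bdd[OF assms(1)] by (intro cINF_lower) auto
  qed
  then show "rate m \<le> 0" by (rule tendsto_lowerbound[OF lim2]) simp
qed (rule rate_nonneg[OF assms(1)])

lemma AE_bounds: "AE \<omega> in M. \<forall>z. lo \<le> \<Theta> z \<omega> \<and> \<Theta> z \<omega> \<le> hi"
  using bounds by (simp add: AE_all_countable)

lemma integrable_\<Theta>: "integrable M (\<Theta> z)"
  by (rule integrable_const_bound[where B="hi"]) (use bounds[of z] lo_pos in \<open>auto elim: eventually_mono\<close>)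

lemma mean_bounds: "lo \<le> mean" "mean \<le> hi"
proof -
  have "expectation (\<lambda>_. lo) \<le> mean"
    by (rule integral_mono_AE) (use bounds[of 0] integrable_\<Theta> in auto)
  then show "lo \<le> mean" by (simp add: prob_space)
  have "mean \<le> expectation (\<lambda>_. hi)"
    by (rule integral_mono_AE) (use bounds[of 0] integrable_\<Theta> in auto)
  then show "mean \<le> hi" by (simp add: prob_space)
qed

end

section \<open>Low energy forces low block averages\<close>

text \<open>Take for \<open>b\<close> the first time at which \<open>u\<close> reaches \<open>q\<close> and for \<open>a\<close> the last time before \<open>b\<close> at which it equals
  \<open>p\<close>.\<close>

lemma first_crossing:
  fixes u :: "real \<Rightarrow> real"
  assumes st: "s \<le> t" and u: "continuous_on {s..t} u" and pq: "u s \<le> p" "p < q" "q \<le> u t"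
  obtains a b where "s \<le> a" "a < b" "b \<le> t" "u a = p" "u b = q" "\<And>x. a < x \<Longrightarrow> x < b \<Longrightarrow> p < u x \<and> u x < q"
proof -
  define T where "T = {x \<in> {s..t}. u x = q}"
  have "T = {s..t} \<inter> u -` {q}" by (auto simp: T_def)
  then have cT: "compact T" using continuous_closed_preimage[OF u closed_real_atLeastAtMost closed_singleton[of q]]
    by (simp add: compact_eq_bounded_closed bounded_subset[OF bounded_closed_interval[of s t]])
  have "\<exists>x\<ge>s. x \<le> t \<and> u x = q" using pq by (intro IVT' u st) auto
  then have "T \<noteq> {}" by (auto simp: T_def)
  from compact_attains_inf[OF cT this] obtain b where b: "b \<in> T" "\<And>x. x \<in> T \<Longrightarrow> b \<le> x" by blast
  have b': "s \<le> b" "b \<le> t" "u b = q" using b(1) by (auto simp: T_def)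
  have ub: "continuous_on {s..b} u" using continuous_on_subset[OF u] b' by auto
  define R where "R = {x \<in> {s..b}. u x = p}"
  have "R = {s..b} \<inter> u -` {p}" by (auto simp: R_def)
  then have cR: "compact R" using continuous_closed_preimage[OF ub closed_real_atLeastAtMost closed_singleton[of p]]
    by (simp add: compact_eq_bounded_closed bounded_subset[OF bounded_closed_interval[of s b]])
  have "\<exists>x\<ge>s. x \<le> b \<and> u x = p" using pq b' by (intro IVT' ub) auto
  then have "R \<noteq> {}" by (auto simp: R_def)
  from compact_attains_sup[OF cR this] obtain a where a: "a \<in> R" "\<And>x. x \<in> R \<Longrightarrow> x \<le> a" by blast
  have a': "s \<le> a" "a \<le> b" "u a = p" using a(1) by (auto simp: R_def)
  have "a \<noteq> b" using a' b' pq by auto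
  then have ab: "a < b" using a' by simp
  have lt: "u x < q" if "a < x" "x < b" for x
  proof (rule ccontr)
    assume "\<not> u x < q"
    then have "\<exists>y\<ge>a. y \<le> x \<and> u y = q"
      using that a' pq by (intro IVT' continuous_on_subset[OF ub]) auto
    then obtain y where "a \<le> y" "y \<le> x" "u y = q" by blast
    then show False using b(2)[of y] that a' b' by (auto simp: T_def)
  qed
  have gt: "p < u x" if "a < x" "x < b" for x
  proof (rule ccontr)
    assume "\<not> p < u x"
    then have "\<exists>y\<ge>x. y \<le> b \<and> u y = p"
      using that b' a' pq by (intro IVT' continuous_on_subset[OF ub]) auto
    then obtain y where "x \<le> y" "y \<le> b" "u y = p" by blast
    then show False using a(2)[of y] that a' by (auto simp: R_def)
  qed
  show ?thesis using that[OF a'(1) ab b'(2) a'(3) b'(3)] lt gt by blast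
qed

text \<open>An interval contains a run of consecutive whole cells that misses at most two cell lengths.\<close>

lemma cells_inside:
  assumes "\<delta> > 0" "a < b"
  obtains z :: int and r :: nat where "a \<le> \<delta> * (of_int z - 1/2)" "\<delta> * (of_int (z + int r) - 1/2) \<le> b \<or> r = 0"
    "real r \<ge> (b - a) / \<delta> - 2"  "real r \<le> (b - a) / \<delta>" "\<delta> * (of_int z - 1/2) < a + \<delta>"
proof -
  define z where "z = \<lceil>a / \<delta> + 1/2\<rceil>"
  define y where "y = \<lfloor>b / \<delta> + 1/2\<rfloor>"
  have z: "a / \<delta> \<le> of_int z - 1/2" "of_int z - 1/2 < a / \<delta> + 1" unfolding z_def by linarith+
  have y: "of_int y - 1/2 \<le> b / \<delta>" "b / \<delta> < of_int y + 1/2" unfolding y_def by linarith+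
  have ab: "a / \<delta> < b / \<delta>" using assms by (simp add: divide_strict_right_mono)
  define r where "r = nat (y - z)"
  have 1: "a \<le> \<delta> * (of_int z - 1/2)" using z(1) assms by (simp add: field_simps)
  have 2: "\<delta> * (of_int z - 1/2) < a + \<delta>" using z(2) assms by (simp add: field_simps)
  have 3: "\<delta> * (of_int (z + int r) - 1/2) \<le> b \<or> r = 0"
  proof (cases "y \<le> z")
    case False
    then have "z + int r = y" by (simp add: r_def)
    then show ?thesis using y(1) assms by (simp add: field_simps)
  qed (simp add: r_def)
  have d: "(b - a) / \<delta> = b / \<delta> - a / \<delta>" by (simp add: diff_divide_distrib)
  have 4: "real r \<ge> (b - a) / \<delta> - 2" unfolding d r_def using z y by linarith
  have 5: "real r \<le> (b - a) / \<delta>" unfolding d r_def using z y ab by linarith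
  show ?thesis using that[OF 1 3 4 5 2] .
qed

lemma scaled_cell_subset:
  assumes "\<delta> > 0" "a \<le> \<delta> * (of_int z - 1/2)" "\<delta> * (of_int (z + int r) - 1/2) \<le> b" "i \<in> {z..<z + int r}"
  shows "scaled_cell \<delta> i \<subseteq> {a<..<b}"
proof -
  have "\<delta> * (of_int z - 1/2) \<le> \<delta> * (of_int i - 1/2)" using assms by (intro mult_left_mono) auto
  moreover have "of_int (i + 1) \<le> (of_int (z + int r) :: real)" using assms(4) unfolding of_int_le_iff by simp
  then have "\<delta> * (of_int i + 1/2) \<le> \<delta> * (of_int (z + int r) - 1/2)" using assms(1) by (intro mult_left_mono) auto
  ultimately show ?thesis using assms(2,3) by (auto simp: scaled_cell_def)
qed

context double_well
begin

text \<open>The slots near the wells, \<open>j < s\<close> and \<open>j \<ge> n - s\<close>, are left out: between the levels that remain the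
  potential is bounded below, which confines the whole transition to a length \<open>L * \<epsilon>\<close>, and it varies by a
  factor at most \<open>g\<close> on each slot. Each slot is crossed at some place, and these places are disjoint since
  the values of \<open>u\<close> there are. The function \<open>u\<close> may be far from monotone; whatever lies between the
  crossings only adds energy. Bounded energy makes every crossing long compared with \<open>\<delta>\<close>, so rounding
  to whole cells again costs at most a factor \<open>g\<close>.\<close>

lemma energy_lower_by_blocks:
  assumes eps: "\<epsilon> > 0" and del: "\<delta> > 0" and lo: "lo > 0" and \<theta>: "\<And>z. lo \<le> \<theta> z"
    and s: "0 < s" "2 * s < n" and g: "g > 1"
    and wlow: "wlow > 0" "\<And>x. x \<in> {level n s..level n (n - s)} \<Longrightarrow> wlow \<le> W x"
    and wj: "\<And>j x. j \<in> {s..<n - s} \<Longrightarrow> x \<in> {level n j..level n (Suc j)} \<Longrightarrow> slot_max W n j \<le> g * W x"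
    and u: "u \<in> H1 {A..B}" and AB: "A < B" and uA: "u A < level n s" and uB: "u B > level n (n - s)"
    and E: "energy W \<theta> \<epsilon> \<delta> {A..B} u \<le> C" and C: "C > 0"
    and fine: "\<epsilon> / \<delta> * (2 / ((real n)\<^sup>2 * C)) \<ge> 2 * g / (g - 1)"
  obtains z0 :: int and r p :: "nat \<Rightarrow> nat" where
    "z0 \<in> {\<lfloor>A / \<delta>\<rfloor>..\<lceil>B / \<delta>\<rceil> + 1}"
    "\<forall>j\<in>{s..<n - s}. r j > 0 \<and> real (p j) \<le> C / (lo * wlow) * (\<epsilon> / \<delta>) + 1 \<and> real (r j) \<le> C / (lo * wlow) * (\<epsilon> / \<delta>) + 1"
    "disjoint_family_on (\<lambda>j. {z0 + int (p j)..<z0 + int (p j) + int (r j)}) {s..<n - s}"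
    "(\<Sum>j\<in>{s..<n - s}. 2 / ((real n)\<^sup>2 * (real (r j) * \<delta> / \<epsilon>)) +
        \<delta> / \<epsilon> * slot_max W n j * (\<Sum>z\<in>{z0 + int (p j)..<z0 + int (p j) + int (r j)}. \<theta> z)) \<le> g * C"
proof -
  let ?J = "{s..<n - s}"
  let ?L = "C / (lo * wlow) * (\<epsilon> / \<delta>)"
  have n: "n > 0" using s by simp
  have \<theta>0: "\<theta> z \<ge> 0" for z using \<theta>[of z] lo by linarith
  have cu: "continuous_on {A..B} u" using u by (rule H1_continuous)
  have "n - s > s" using s by simp
  then have ls: "level n s < level n (n - s)" using level_less[OF n, of s] level_mono[of "Suc s" "n - s" n] by simp
  \<comment> \<open>One traversal of all the levels in question; the slot crossings are taken inside it.\<close>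
  obtain a0 b0 where ab0: "A \<le> a0" "a0 < b0" "b0 \<le> B" "u a0 = level n s" "u b0 = level n (n - s)"
    "\<And>x. a0 < x \<Longrightarrow> x < b0 \<Longrightarrow> level n s < u x \<and> u x < level n (n - s)"
    using first_crossing[of A B u "level n s" "level n (n - s)"] cu AB uA uB ls by auto
  have "a0 \<noteq> A" "b0 \<noteq> B" using ab0 uA uB by auto
  then have ab1: "A < a0" "b0 < B" using ab0 by auto
  have cu0: "continuous_on {a0..b0} u" using ab0 by (intro continuous_on_subset[OF cu]) auto
  have len: "b0 - a0 \<le> ?L * \<delta>"
  proof -
    have "lo * wlow / \<epsilon> * (b0 - a0) \<le> energy W \<theta> \<epsilon> \<delta> {A..B} u"
      by (rule potential_length_bound[OF u ab1(1) ab0(2) ab1(2) eps del W_cont W_nonneg \<theta> less_imp_le[OF lo] less_imp_le[OF wlow(1)]])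
        (use ab0(6) wlow(2) in \<open>auto simp: less_imp_le\<close>)
    then have "lo * wlow / \<epsilon> * (b0 - a0) \<le> C" using E by linarith
    then show ?thesis using eps del lo wlow by (simp add: field_simps)
  qed
  have "\<exists>a b. a0 \<le> a \<and> a < b \<and> b \<le> b0 \<and> u a = level n j \<and> u b = level n (Suc j) \<and>
      (\<forall>x. a < x \<longrightarrow> x < b \<longrightarrow> level n j < u x \<and> u x < level n (Suc j))" if j: "j \<in> ?J" for j
  proof -
    have "u a0 \<le> level n j" "level n (Suc j) \<le> u b0" unfolding ab0 using j by (auto intro!: level_mono)
    then obtain a b where "a0 \<le> a" "a < b" "b \<le> b0" "u a = level n j" "u b = level n (Suc j)"
      "\<And>x. a < x \<Longrightarrow> x < b \<Longrightarrow> level n j < u x \<and> u x < level n (Suc j)"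
      using first_crossing[of a0 b0 u "level n j" "level n (Suc j)"] cu0 ab0(2) level_less[OF n, of j] by auto
    then show ?thesis by blast
  qed
  then obtain a b where ab: "\<And>j. j \<in> ?J \<Longrightarrow> a0 \<le> a j \<and> a j < b j \<and> b j \<le> b0 \<and> u (a j) = level n j \<and> u (b j) = level n (Suc j) \<and>
      (\<forall>x. a j < x \<longrightarrow> x < b j \<longrightarrow> level n j < u x \<and> u x < level n (Suc j))" by metis
  have "\<exists>z r. a j \<le> \<delta> * (of_int z - 1/2) \<and> (\<delta> * (of_int (z + int r) - 1/2) \<le> b j \<or> r = 0) \<and>
     real r \<ge> (b j - a j) / \<delta> - 2 \<and> real r \<le> (b j - a j) / \<delta> \<and> \<delta> * (of_int z - 1/2) < a j + \<delta>" if "j \<in> ?J" for j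
    using ab[OF that] by (metis cells_inside[OF del])
  then obtain z r where zr: "\<And>j. j \<in> ?J \<Longrightarrow> a j \<le> \<delta> * (of_int (z j) - 1/2) \<and> (\<delta> * (of_int (z j + int (r j)) - 1/2) \<le> b j \<or> r j = 0) \<and>
     real (r j) \<ge> (b j - a j) / \<delta> - 2 \<and> real (r j) \<le> (b j - a j) / \<delta> \<and> \<delta> * (of_int (z j) - 1/2) < a j + \<delta>" by metis
  define z0 where "z0 = \<lceil>a0 / \<delta> + 1/2\<rceil>"
  have z0: "a0 / \<delta> \<le> of_int z0 - 1/2" "of_int z0 - 1/2 < a0 / \<delta> + 1" unfolding z0_def by linarith+
  define p where "p j = nat (z j - z0)" for j
  have zge: "z0 \<le> z j" if j: "j \<in> ?J" for j
  proof -
    have "a0 \<le> \<delta> * (of_int (z j) - 1/2)" using zr[OF j] ab[OF j] by linarith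
    then have "a0 / \<delta> + 1/2 \<le> of_int (z j)" using del by (simp add: field_simps)
    then show ?thesis unfolding z0_def by (rule ceiling_le)
  qed
  then have zp: "z0 + int (p j) = z j" if "j \<in> ?J" for j using that by (simp add: p_def)
  let ?Z = "\<lambda>j. {z j..<z j + int (r j)}"
  have inside: "scaled_cell \<delta> i \<subseteq> {a j<..<b j}" if "j \<in> ?J" "i \<in> ?Z j" for i j
    using zr[OF that(1)] that by (intro scaled_cell_subset[OF del]) auto
  \<comment> \<open>A common point would have a value in the interior of two different slots.\<close>
  have disj_ab: "i = j" if "i \<in> ?J" "j \<in> ?J" "x \<in> {a i<..<b i}" "x \<in> {a j<..<b j}" for i j x
  proof -
    have 1: "level n i < u x" "u x < level n (Suc i)" "level n j < u x" "u x < level n (Suc j)"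
      using ab[OF that(1)] ab[OF that(2)] that by auto
    have "\<not> Suc i \<le> j" "\<not> Suc j \<le> i" using level_mono[of "Suc i" j n] level_mono[of "Suc j" i n] 1 by linarith+
    then show ?thesis by simp
  qed
  have disj: "disjoint_family_on ?Z ?J"
    unfolding disjoint_family_on_def
  proof (intro ballI impI, rule ccontr)
    fix i j assume ij: "i \<in> ?J" "j \<in> ?J" "i \<noteq> j" "?Z i \<inter> ?Z j \<noteq> {}"
    then obtain k where k: "k \<in> ?Z i" "k \<in> ?Z j" by blast
    have "\<delta> * of_int k \<in> scaled_cell \<delta> k" using del by (simp add: scaled_cell_def)
    then show False using disj_ab[OF ij(1,2)] inside[OF ij(1) k(1)] inside[OF ij(2) k(2)] ij(3) by blast
  qed
  let ?v = "weak_deriv {A..B} u"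
  let ?e = "energy_density W \<theta> \<epsilon> \<delta> u ?v"
  define wmin where "wmin j = slot_max W n j / g" for j
  have wmin: "wmin j \<ge> 0" "x \<in> {a j<..<b j} \<Longrightarrow> wmin j \<le> W (u x)" if j: "j \<in> ?J" for j x
  proof -
    show "wmin j \<ge> 0" using slot_max_pos[OF n] g by (simp add: wmin_def less_imp_le)
    assume "x \<in> {a j<..<b j}"
    then have "u x \<in> {level n j..level n (Suc j)}" using ab[OF j] by (auto simp: less_imp_le)
    from wj[OF j this] show "wmin j \<le> W (u x)" using g by (simp add: wmin_def pos_divide_le_eq mult.commute)
  qed
  have slab: "\<epsilon> * (2 / real n)\<^sup>2 / (2 * (b j - a j)) + \<delta> / \<epsilon> * wmin j * (\<Sum>i\<in>?Z j. \<theta> i) \<le> (LINT x:{a j<..<b j}|lebesgue. ?e x)"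
    if j: "j \<in> ?J" for j
  proof -
    have "u (b j) - u (a j) = 2 / real n" using ab[OF j] level_diff[OF n, of j] by simp
    moreover have "\<epsilon> * (u (b j) - u (a j))\<^sup>2 / (2 * (b j - a j)) + \<delta> / \<epsilon> * wmin j * (\<Sum>i\<in>?Z j. \<theta> i) \<le> (LINT x:{a j<..<b j}|lebesgue. ?e x)"
      by (rule energy_slab_lower[OF u _ _ _ eps del W_cont W_nonneg \<theta>0 wmin[OF j]])
        (use ab[OF j] ab1 inside[OF j] in auto)
    ultimately show ?thesis by simp
  qed
  have "(\<Sum>j\<in>?J. LINT x:{a j<..<b j}|lebesgue. ?e x) \<le> (LINT x:{A..B}|lebesgue. ?e x)"
  proof (rule set_integral_ge_disjoint_sum)
    show "set_integrable lebesgue {A..B} ?e"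
      by (rule energy_density_integral(1)[OF del W_cont cu H1_weak_deriv_square_integrable[OF u]])
    fix x
    have "checkerboard \<theta> (x / \<delta>) \<ge> 0"
      by (rule checkerboard_nonneg[OF del \<theta>0])
    then show "?e x \<ge> 0" using eps W_nonneg by simp
  next
    fix j assume "j \<in> ?J"
    from ab[OF this] show "{a j<..<b j} \<subseteq> {A..B}" using ab0 by auto
  qed (use disj_ab in auto)
  also have "\<dots> \<le> C" using E by (simp add: energy_def)
  finally have sumC: "(\<Sum>j\<in>?J. LINT x:{a j<..<b j}|lebesgue. ?e x) \<le> C" .
  have slabnn: "0 \<le> (LINT x:{a j<..<b j}|lebesgue. ?e x)" if "j \<in> ?J" for j
  proof -
    have "0 \<le> \<epsilon> * (2 / real n)\<^sup>2 / (2 * (b j - a j)) + \<delta> / \<epsilon> * wmin j * (\<Sum>i\<in>?Z j. \<theta> i)"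
      using ab[OF that] eps del wmin[OF that] \<theta>0 by (auto intro!: add_nonneg_nonneg sum_nonneg mult_nonneg_nonneg divide_nonneg_nonneg)
    then show ?thesis using slab[OF that] by linarith
  qed
  \<comment> \<open>A crossing of length \<open>x\<close> in cells contains at least \<open>x - 2\<close> whole cells, and \<open>x - 2 \<ge> x / g\<close> as soon as \<open>x \<ge> 2 * g / (g - 1)\<close>.\<close>
  have rr: "r j > 0" "(b j - a j) / \<delta> \<le> g * real (r j)" if j: "j \<in> ?J" for j
  proof -
    have "(LINT x:{a j<..<b j}|lebesgue. ?e x) \<le> (\<Sum>j\<in>?J. LINT x:{a j<..<b j}|lebesgue. ?e x)"
      by (rule member_le_sum[OF j]) (use slabnn in auto)
    then have "\<epsilon> * (2 / real n)\<^sup>2 / (2 * (b j - a j)) + \<delta> / \<epsilon> * wmin j * (\<Sum>i\<in>?Z j. \<theta> i) \<le> C"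
      using slab[OF j] sumC by linarith
    moreover have "0 \<le> \<delta> / \<epsilon> * wmin j * (\<Sum>i\<in>?Z j. \<theta> i)"
      by (intro mult_nonneg_nonneg divide_nonneg_nonneg sum_nonneg) (use eps del wmin(1)[OF j] \<theta>0 in auto)
    ultimately have "\<epsilon> * (2 / real n)\<^sup>2 / (2 * (b j - a j)) \<le> C" by linarith
    then have "\<epsilon> * (2 / real n)\<^sup>2 \<le> C * (2 * (b j - a j))" using ab[OF j] by (simp add: pos_divide_le_eq)
    then have "\<epsilon> * (2 / real n)\<^sup>2 / (2 * C) \<le> b j - a j"
      using C by (subst pos_divide_le_eq) (auto simp: mult_ac)
    moreover have "\<epsilon> * (2 / real n)\<^sup>2 / (2 * C) = \<epsilon> * (2 / ((real n)\<^sup>2 * C))"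
      by (simp add: power_divide mult_ac)
    ultimately have "\<epsilon> * (2 / ((real n)\<^sup>2 * C)) \<le> b j - a j" by linarith
    then have "\<epsilon> * (2 / ((real n)\<^sup>2 * C)) / \<delta> \<le> (b j - a j) / \<delta>" using del by (intro divide_right_mono) auto
    then have "\<epsilon> / \<delta> * (2 / ((real n)\<^sup>2 * C)) \<le> (b j - a j) / \<delta>"
      by (simp add: mult_ac)
    then have X: "2 * g / (g - 1) \<le> (b j - a j) / \<delta>" using fine by linarith
    then have "2 * g \<le> (b j - a j) / \<delta> * (g - 1)" using g by (simp add: pos_divide_le_eq)
    moreover have "real (r j) \<ge> (b j - a j) / \<delta> - 2" using zr[OF j] by simp
    ultimately show "(b j - a j) / \<delta> \<le> g * real (r j)"
    proof -
      assume 1: "2 * g \<le> (b j - a j) / \<delta> * (g - 1)" and 2: "(b j - a j) / \<delta> - 2 \<le> real (r j)"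
      have "g * ((b j - a j) / \<delta> - 2) \<le> g * real (r j)" using 2 g by (intro mult_left_mono) auto
      moreover have "X * (g - 1) = g * X - X" "g * (X - 2) = g * X - 2 * g" for X :: real by (simp_all add: algebra_simps)
      ultimately show ?thesis using 1 by (smt (verit, best))
    qed
    moreover have "(b j - a j) / \<delta> > 0" using ab[OF j] del by simp
    ultimately have "0 < g * real (r j)" by linarith
    then show "r j > 0" using g by (simp add: zero_less_mult_iff)
  qed
  have final: "2 / ((real n)\<^sup>2 * (real (r j) * \<delta> / \<epsilon>)) + \<delta> / \<epsilon> * slot_max W n j * (\<Sum>i\<in>?Z j. \<theta> i)
     \<le> g * (LINT x:{a j<..<b j}|lebesgue. ?e x)" if j: "j \<in> ?J" for j
  proof -
    have bj: "b j - a j > 0" using ab[OF j] by simp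
    have rj: "real (r j) > 0" using rr(1)[OF j] by simp
    have "b j - a j \<le> g * (real (r j) * \<delta>)" using rr(2)[OF j] del by (simp add: pos_divide_le_eq mult.assoc)
    then have "1 / (g * (real (r j) * \<delta>)) \<le> 1 / (b j - a j)"
      using bj by (intro divide_left_mono) (auto intro: less_le_trans)
    then have "\<epsilon> * (2 / real n)\<^sup>2 / 2 * (1 / (g * (real (r j) * \<delta>))) \<le> \<epsilon> * (2 / real n)\<^sup>2 / 2 * (1 / (b j - a j))"
      using eps by (intro mult_left_mono) auto
    moreover have "g * (\<epsilon> * (2 / real n)\<^sup>2 / 2 * (1 / (g * (real (r j) * \<delta>)))) = 2 / ((real n)\<^sup>2 * (real (r j) * \<delta> / \<epsilon>))"
      using g eps del rj n by (simp add: power_divide field_simps)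
    ultimately have k: "2 / ((real n)\<^sup>2 * (real (r j) * \<delta> / \<epsilon>)) \<le> g * (\<epsilon> * (2 / real n)\<^sup>2 / (2 * (b j - a j)))"
      using mult_left_mono[of "\<epsilon> * (2 / real n)\<^sup>2 / 2 * (1 / (g * (real (r j) * \<delta>)))" "\<epsilon> * (2 / real n)\<^sup>2 / 2 * (1 / (b j - a j))" g] g
      by simp
    have "\<delta> / \<epsilon> * slot_max W n j * (\<Sum>i\<in>?Z j. \<theta> i) = g * (\<delta> / \<epsilon> * wmin j * (\<Sum>i\<in>?Z j. \<theta> i))"
      using g by (simp add: wmin_def)
    then have "2 / ((real n)\<^sup>2 * (real (r j) * \<delta> / \<epsilon>)) + \<delta> / \<epsilon> * slot_max W n j * (\<Sum>i\<in>?Z j. \<theta> i)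
      \<le> g * (\<epsilon> * (2 / real n)\<^sup>2 / (2 * (b j - a j)) + \<delta> / \<epsilon> * wmin j * (\<Sum>i\<in>?Z j. \<theta> i))"
      using k by (simp only: distrib_left)
    also have "\<dots> \<le> g * (LINT x:{a j<..<b j}|lebesgue. ?e x)" using slab[OF j] g by (intro mult_left_mono) auto
    finally show ?thesis .
  qed
  show ?thesis
  proof (rule that[of z0 r p])
    have "A / \<delta> \<le> a0 / \<delta>" "a0 / \<delta> \<le> B / \<delta>" using ab0 del by (auto intro!: divide_right_mono)
    then show "z0 \<in> {\<lfloor>A / \<delta>\<rfloor>..\<lceil>B / \<delta>\<rceil> + 1}" unfolding atLeastAtMost_iff using z0 by linarith
    show "disjoint_family_on (\<lambda>j. {z0 + int (p j)..<z0 + int (p j) + int (r j)}) ?J"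
      using disj zp by (simp add: disjoint_family_on_def)
    have L: "(b0 - a0) / \<delta> \<le> ?L" using len del by (simp add: pos_divide_le_eq)
    show "\<forall>j\<in>?J. r j > 0 \<and> real (p j) \<le> ?L + 1 \<and> real (r j) \<le> ?L + 1"
    proof
    fix j assume j: "j \<in> ?J"
    have "(b j - a j) / \<delta> \<le> (b0 - a0) / \<delta>" using ab[OF j] del by (intro divide_right_mono) auto
    then have 1: "real (r j) \<le> ?L + 1" using zr[OF j] L by linarith
    have "\<delta> * (of_int (z j) - 1/2) < b0 + \<delta>" using zr[OF j] ab[OF j] by linarith
    then have "of_int (z j) - 1/2 < b0 / \<delta> + 1" using del by (simp add: field_simps)
    then have "of_int (z j) - of_int z0 \<le> (b0 - a0) / \<delta> + 1" using z0 by (simp add: diff_divide_distrib)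
    moreover have "real (p j) = of_int (z j) - of_int z0" using zge[OF j] by (simp add: p_def)
    ultimately have 2: "real (p j) \<le> ?L + 1" using L by linarith
    show "r j > 0 \<and> real (p j) \<le> ?L + 1 \<and> real (r j) \<le> ?L + 1" using 1 2 rr(1)[OF j] by blast
    qed
  next
    have "(\<Sum>j\<in>?J. 2 / ((real n)\<^sup>2 * (real (r j) * \<delta> / \<epsilon>)) +
        \<delta> / \<epsilon> * slot_max W n j * (\<Sum>z\<in>{z0 + int (p j)..<z0 + int (p j) + int (r j)}. \<theta> z))
      \<le> (\<Sum>j\<in>?J. g * (LINT x:{a j<..<b j}|lebesgue. ?e x))"
      using final zp by (intro sum_mono) auto
    also have "\<dots> \<le> g * C" using sumC g by (simp add: sum_distrib_left[symmetric])
    finally show "(\<Sum>j\<in>?J. 2 / ((real n)\<^sup>2 * (real (r j) * \<delta> / \<epsilon>)) +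
        \<delta> / \<epsilon> * slot_max W n j * (\<Sum>z\<in>{z0 + int (p j)..<z0 + int (p j) + int (r j)}. \<theta> z)) \<le> g * C" .
  qed
qed

end


lemma admissible_interval:
  assumes "A < B"
  shows "admissible q \<epsilon> 1 {A..B} = {u \<in> H1 {A..B}. u A = q ((A - B) / 2 / \<epsilon>) \<and> u B = q ((B - A) / 2 / \<epsilon>)}"
proof -
  have "{A<..<B} \<subseteq> {A..B}" "frontier {A..B} = {A, B}" using assms by (auto simp: frontier_def)
  then show ?thesis
    using surface_tension_interval(2)[of "{A..B}" A B q \<epsilon> 1] assms by (simp add: midpoint_of_def)
qed

lemma surface_tension_bdd_below:
  assumes "\<delta> > 0" "\<epsilon> > 0" "\<And>s. W s \<ge> 0" "\<And>z. \<theta> z \<ge> 0"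
  shows "bdd_below (energy W \<theta> \<epsilon> \<delta> {A..B} ` X)"
proof (rule bdd_belowI2[of _ 0])
  fix u
  have "checkerboard \<theta> (x / \<delta>) \<ge> 0" for x
    by (rule checkerboard_nonneg[OF assms(1,4)])
  then show "0 \<le> energy W \<theta> \<epsilon> \<delta> {A..B} u"
    unfolding energy_def set_lebesgue_integral_def using assms(2,3)
    by (intro Bochner_Integration.integral_nonneg) (auto simp: indicator_def)
qed

locale random_double_well = double_well W + iid_bounded M \<Theta> lo hi
  for W :: "real \<Rightarrow> real" and M :: "'a measure" and \<Theta> :: "int \<Rightarrow> 'a \<Rightarrow> real" and lo hi :: real +
  assumes lo_mean: "lo < mean"
begin

sublocale rate_bounds W rate lo mean "2 / (hi - lo)\<^sup>2"
proof
  show "rate m \<ge> 2 / (hi - lo)\<^sup>2 * (mean - m)\<^sup>2" if "lo < m" "m \<le> mean" for m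
    by (rule rate_quadratic[OF that])
  show "rate m = 0" if "mean < m" for m using that lo_mean by (intro rate_zero) auto
qed (use lo_pos lo_mean lo_hi rate_nonneg in auto)

text \<open>Union bound. For fixed blocks the probability factorises and is at most the exponential of minus the
  cost, exactly and not only asymptotically; the number of choices of offsets, lengths and coefficients
  is polynomial in \<open>N\<close>.\<close>

lemma prob_costly_blocks:
  assumes Z: "finite Z" and G: "finite G" "\<And>m. m \<in> G \<Longrightarrow> lo < m" and J: "finite J"
  defines "blocks \<equiv> \<lambda>(z0::int) (p::nat \<Rightarrow> nat) (r::nat \<Rightarrow> nat) (j::nat). {z0 + int (p j)..<z0 + int (p j) + int (r j)}"
  shows "prob {\<omega> \<in> space M. \<exists>z0\<in>Z. \<exists>p\<in>PiE J (\<lambda>_. {..N}). \<exists>r\<in>PiE J (\<lambda>_. {..N}). \<exists>m\<in>PiE J (\<lambda>_. G).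
      disjoint_family_on (blocks z0 p r) J \<and> K < (\<Sum>j\<in>J. real (r j) * rate (m j)) \<and>
      (\<forall>j\<in>J. (\<Sum>z\<in>blocks z0 p r j. \<Theta> z \<omega>) \<le> real (r j) * m j)}
    \<le> real (card Z) * real (N + 1) ^ (2 * card J) * real (card G) ^ card J * exp (- K)"
proof -
  define T where "T = {(z0, p, r, m). (z0, p, r, m) \<in> Z \<times> PiE J (\<lambda>_. {..N}) \<times> PiE J (\<lambda>_. {..N}) \<times> PiE J (\<lambda>_. G) \<and>
      disjoint_family_on (blocks z0 p r) J \<and> K < (\<Sum>j\<in>J. real (r j) * rate (m j))}"
  let ?P = "Z \<times> PiE J (\<lambda>_. {..N}) \<times> PiE J (\<lambda>_. {..N}) \<times> PiE J (\<lambda>_. G)"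
  have finP: "finite ?P" using Z G J by (intro finite_cartesian_product finite_PiE) auto
  have sub: "T \<subseteq> ?P" by (auto simp: T_def)
  have finT: "finite T" using finite_subset[OF sub finP] .
  have "card T \<le> card ?P" by (rule card_mono[OF finP sub])
  also have "card ?P = card Z * ((N + 1) ^ card J * ((N + 1) ^ card J * card G ^ card J))"
    using J by (simp add: card_cartesian_product card_PiE)
  finally have "card T \<le> card Z * ((N + 1) ^ card J * ((N + 1) ^ card J * card G ^ card J))" .
  then have "real (card T) \<le> real (card Z * ((N + 1) ^ card J * ((N + 1) ^ card J * card G ^ card J)))"
    by (simp only: of_nat_le_iff)
  also have "\<dots> = real (card Z) * real (N + 1) ^ (2 * card J) * real (card G) ^ card J"
    unfolding mult_2[of "card J"] power_add by (simp add: mult_ac)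
  finally have card: "real (card T) \<le> real (card Z) * real (N + 1) ^ (2 * card J) * real (card G) ^ card J" .
  define E where "E = (\<lambda>(z0, p, r, m). {\<omega> \<in> space M. \<forall>j\<in>J. (\<Sum>z\<in>blocks z0 p r j. \<Theta> z \<omega>) \<le> real (r j) * m j})"
  have Em: "E t \<in> sets M" for t
    unfolding E_def using J by (cases t) (auto intro!: sets.sets_Collect_finite_All)
  have "prob (\<Union>t\<in>T. E t) \<le> (\<Sum>t\<in>T. prob (E t))"
    using finT Em by (intro finite_measure_subadditive_finite) auto
  also have "\<dots> \<le> (\<Sum>t\<in>T. exp (- K))"
  proof (rule sum_mono)
    fix t assume t: "t \<in> T"
    obtain z0 p r m where tt: "t = (z0, p, r, m)" by (cases t) auto
    have 1: "disjoint_family_on (blocks z0 p r) J" "K < (\<Sum>j\<in>J. real (r j) * rate (m j))" "m \<in> PiE J (\<lambda>_. G)"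
      using t by (auto simp: tt T_def)
    have "prob (E t) = (\<Prod>j\<in>J. prob {\<omega> \<in> space M. (\<Sum>z\<in>blocks z0 p r j. \<Theta> z \<omega>) \<le> real (r j) * m j})"
      unfolding E_def tt by (simp add: prob_sums[OF J 1(1)])
    also have "\<dots> = (\<Prod>j\<in>J. tail_prob (r j) (m j))"
    proof (rule prod.cong)
      fix j
      have "card (blocks z0 p r j) = r j" "finite (blocks z0 p r j)" by (auto simp: blocks_def)
      then show "prob {\<omega> \<in> space M. (\<Sum>z\<in>blocks z0 p r j. \<Theta> z \<omega>) \<le> real (r j) * m j} = tail_prob (r j) (m j)"
        using prob_sum_le[of "blocks z0 p r j" "m j"] by simp
    qed simp
    also have "\<dots> \<le> (\<Prod>j\<in>J. exp (- (real (r j) * rate (m j))))"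
    proof (rule prod_mono)
      fix j assume "j \<in> J"
      then have "lo < m j" using 1(3) G(2) by auto
      then show "0 \<le> tail_prob (r j) (m j) \<and> tail_prob (r j) (m j) \<le> exp (- (real (r j) * rate (m j)))"
        using tail_prob_nonneg tail_prob_upper[of "m j" "r j"] by simp
    qed
    also have "\<dots> = exp (- (\<Sum>j\<in>J. real (r j) * rate (m j)))" using J by (simp add: exp_sum sum_negf[symmetric])
    also have "\<dots> \<le> exp (- K)" using 1(2) by simp
    finally show "prob (E t) \<le> exp (- K)" .
  qed
  also have "\<dots> = real (card T) * exp (- K)" by simp
  also have "\<dots> \<le> real (card Z) * real (N + 1) ^ (2 * card J) * real (card G) ^ card J * exp (- K)"
    using card by (intro mult_right_mono) auto
  finally have le: "prob (\<Union>t\<in>T. E t) \<le> real (card Z) * real (N + 1) ^ (2 * card J) * real (card G) ^ card J * exp (- K)" .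
  have "(\<Union>t\<in>T. E t) = {\<omega> \<in> space M. \<exists>z0\<in>Z. \<exists>p\<in>PiE J (\<lambda>_. {..N}). \<exists>r\<in>PiE J (\<lambda>_. {..N}). \<exists>m\<in>PiE J (\<lambda>_. G).
      disjoint_family_on (blocks z0 p r) J \<and> K < (\<Sum>j\<in>J. real (r j) * rate (m j)) \<and>
      (\<forall>j\<in>J. (\<Sum>z\<in>blocks z0 p r j. \<Theta> z \<omega>) \<le> real (r j) * m j)}"
    unfolding T_def E_def by (auto simp del: PiE_iff; blast)
  then show ?thesis using le by simp
qed

text \<open>A finite set of admissible coefficients, fine enough to round every possible average upwards within
  a factor \<open>g\<close>. Rounding upwards is what the event ``average at most \<open>m\<close>'' requires.\<close>

lemma geometric_grid:
  assumes g: "g > 1"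
  obtains G where "finite G" "\<forall>m\<in>G. lo < m" "\<forall>y\<in>{lo..hi}. \<exists>m\<in>G. y \<le> m \<and> m \<le> g * y"
proof -
  obtain I where I: "hi / lo < g ^ I" using real_arch_pow[OF g] by blast
  define G where "G = (\<lambda>i. lo * g ^ Suc i) ` {..I}"
  have "\<exists>m\<in>G. y \<le> m \<and> m \<le> g * y" if y: "lo \<le> y" "y \<le> hi" for y
  proof -
    define i where "i = (LEAST i. y \<le> lo * g ^ Suc i)"
    have "hi \<le> lo * g ^ I" using I lo_pos by (simp add: pos_divide_less_eq mult.commute)
    also have "\<dots> \<le> lo * g ^ Suc I" using g lo_pos by (intro mult_left_mono power_increasing) auto
    finally have yI: "y \<le> lo * g ^ Suc I" using y by linarith
    have i: "y \<le> lo * g ^ Suc i" "i \<le> I"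
      unfolding i_def using LeastI[of "\<lambda>i. y \<le> lo * g ^ Suc i", OF yI] Least_le[of "\<lambda>i. y \<le> lo * g ^ Suc i", OF yI] by auto
    have "lo * g ^ i \<le> y"
    proof (cases i)
      case 0
      then show ?thesis using y by simp
    next
      case (Suc i')
      then have "\<not> y \<le> lo * g ^ Suc i'" unfolding i_def by (intro not_less_Least) simp
      then show ?thesis using Suc by simp
    qed
    then have "g * (lo * g ^ i) \<le> g * y" using g by (intro mult_left_mono) auto
    then show ?thesis using i by (intro bexI[of _ "lo * g ^ Suc i"]) (auto simp: G_def mult_ac)
  qed
  moreover have "lo < m" if "m \<in> G" for m
  proof -
    from that obtain i where "m = lo * g ^ Suc i" by (auto simp: G_def)
    then show ?thesis using one_less_power[OF g, of "Suc i"] lo_pos by simp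
  qed
  moreover have "finite G" by (simp add: G_def)
  ultimately show ?thesis using that by auto
qed

text \<open>An upper bound for the energy of crossing the \<open>2 * s\<close> slots next to the wells, each over the width
  \<open>1 / n\<close>, in a medium of coefficient \<open>hi + 1\<close>.\<close>

definition end_cost :: "nat \<Rightarrow> nat \<Rightarrow> real" where
  "end_cost n s = 2 * real s * ((2 + (hi + 1) * W_max) / real n)"

text \<open>The slots next to the wells are completed with the coefficient \<open>hi + 1\<close>, which lies above the mean
  and so has rate 0.\<close>

lemma profile_from_blocks:
  assumes s: "0 < s" "2 * s < n"
    and h: "\<And>j. j \<in> {s..<n - s} \<Longrightarrow> 0 < h j" and m: "\<And>j. j \<in> {s..<n - s} \<Longrightarrow> lo < m j"
    and cost: "ennreal (\<Sum>j\<in>{s..<n - s}. h j * rate (m j)) \<le> \<kappa>"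
    and E: "(\<Sum>j\<in>{s..<n - s}. 2 / ((real n)\<^sup>2 * h j) + h j * m j * slot_max W n j) \<le> E"
  shows "\<sigma> \<kappa> \<le> E + end_cost n s"
proof -
  let ?J = "{s..<n - s}"
  define h' where "h' j = (if j \<in> ?J then h j else 1 / real n)" for j
  define m' where "m' j = (if j \<in> ?J then m j else hi + 1)" for j
  have n: "n > 0" using s by simp
  have J: "?J \<subseteq> {..<n}" by auto
  have hi: "rate (hi + 1) = 0" using mean_bounds lo_hi by (intro rate_zero) auto
  have "(\<Sum>j<n. h' j * rate (m' j)) = (\<Sum>j\<in>?J. h j * rate (m j))"
    using J hi by (intro sum.mono_neutral_cong_right) (auto simp: h'_def m'_def)
  then have "is_profile lo rate \<kappa> n h' m'"
    using n h m cost lo_hi by (auto simp: is_profile_def h'_def m'_def)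
  from \<sigma>_le[OF this] have "\<sigma> \<kappa> \<le> profile_energy W n h' m'" .
  also have "\<dots> = (\<Sum>j\<in>?J. 2 / ((real n)\<^sup>2 * h' j) + h' j * m' j * slot_max W n j)
      + (\<Sum>j\<in>{..<n} - ?J. 2 / ((real n)\<^sup>2 * h' j) + h' j * m' j * slot_max W n j)"
    unfolding profile_energy_def using sum.subset_diff[OF J] by (simp add: add.commute)
  also have "(\<Sum>j\<in>?J. 2 / ((real n)\<^sup>2 * h' j) + h' j * m' j * slot_max W n j)
     = (\<Sum>j\<in>?J. 2 / ((real n)\<^sup>2 * h j) + h j * m j * slot_max W n j)"
    by (intro sum.cong) (auto simp: h'_def m'_def)
  also have "\<dots> \<le> E" by (rule E)
  also have "(\<Sum>j\<in>{..<n} - ?J. 2 / ((real n)\<^sup>2 * h' j) + h' j * m' j * slot_max W n j)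
     \<le> (\<Sum>j\<in>{..<n} - ?J. (2 + (hi + 1) * W_max) / real n)"
  proof (rule sum_mono)
    fix j assume j: "j \<in> {..<n} - ?J"
    then have "2 / ((real n)\<^sup>2 * h' j) + h' j * m' j * slot_max W n j = (2 + (hi + 1) * slot_max W n j) / real n"
      using n by (auto simp: h'_def m'_def power2_eq_square add_divide_distrib[of 2])
    also have "\<dots> \<le> (2 + (hi + 1) * W_max) / real n"
      using slot_max_le[OF n] j lo_hi lo_pos by (intro divide_right_mono add_left_mono mult_left_mono) auto
    finally show "2 / ((real n)\<^sup>2 * h' j) + h' j * m' j * slot_max W n j \<le> (2 + (hi + 1) * W_max) / real n" .
  qed
  also have "\<dots> = real (2 * s) * ((2 + (hi + 1) * W_max) / real n)"
  proof -
    have "card ({..<n} - ?J) = 2 * s" using J s by (subst card_Diff_subset) auto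
    then show ?thesis by simp
  qed
  finally show ?thesis by (simp add: end_cost_def)
qed

text \<open>The averages over the blocks of a competitor of low energy, rounded up to the grid, form the
  coefficients of a profile of hardly larger energy.\<close>

lemma low_energy_profile:
  assumes eps: "\<epsilon> > 0" and del: "\<delta> > 0" and AB: "A < B"
    and s: "0 < s" "2 * s < n" and g: "g > 1"
    and wlow: "wlow > 0" "\<And>x. x \<in> {level n s..level n (n - s)} \<Longrightarrow> wlow \<le> W x"
    and wj: "\<And>j x. j \<in> {s..<n - s} \<Longrightarrow> x \<in> {level n j..level n (Suc j)} \<Longrightarrow> slot_max W n j \<le> g * W x"
    and qA: "q ((A - B) / 2 / \<epsilon>) < level n s" and qB: "q ((B - A) / 2 / \<epsilon>) > level n (n - s)"
    and C: "C > 0" and fine: "\<epsilon> / \<delta> * (2 / ((real n)\<^sup>2 * C)) \<ge> 2 * g / (g - 1)"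
    and G: "finite G" "\<And>m. m \<in> G \<Longrightarrow> lo < m" "\<And>y. lo \<le> y \<Longrightarrow> y \<le> hi \<Longrightarrow> \<exists>m\<in>G. y \<le> m \<and> m \<le> g * y"
    and N: "C / (lo * wlow) * (\<epsilon> / \<delta>) + 1 \<le> real N"
    and \<omega>: "\<omega> \<in> space M" "\<forall>z. lo \<le> \<Theta> z \<omega> \<and> \<Theta> z \<omega> \<le> hi"
    and st: "surface_tension W q (\<lambda>z. \<Theta> z \<omega>) \<epsilon> \<delta> 1 {A..B} < C"
  shows "\<exists>z0\<in>{\<lfloor>A / \<delta>\<rfloor>..\<lceil>B / \<delta>\<rceil> + 1}. \<exists>p\<in>PiE {s..<n - s} (\<lambda>_. {..N}). \<exists>r\<in>PiE {s..<n - s} (\<lambda>_. {..N}). \<exists>m\<in>PiE {s..<n - s} (\<lambda>_. G).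
      disjoint_family_on (\<lambda>j. {z0 + int (p j)..<z0 + int (p j) + int (r j)}) {s..<n - s} \<and>
      (\<forall>j\<in>{s..<n - s}. (\<Sum>z\<in>{z0 + int (p j)..<z0 + int (p j) + int (r j)}. \<Theta> z \<omega>) \<le> real (r j) * m j) \<and>
      \<sigma> (ennreal (\<delta> / \<epsilon> * (\<Sum>j\<in>{s..<n - s}. real (r j) * rate (m j)))) \<le> g * (g * C) + end_cost n s"
proof -
  let ?J = "{s..<n - s}"
  let ?blocks = "\<lambda>(z0::int) (p::nat \<Rightarrow> nat) (r::nat \<Rightarrow> nat) (j::nat). {z0 + int (p j)..<z0 + int (p j) + int (r j)}"
  let ?\<theta> = "\<lambda>z. \<Theta> z \<omega>"
  have adm: "admissible q \<epsilon> 1 {A..B} = {u \<in> H1 {A..B}. u A = q ((A - B) / 2 / \<epsilon>) \<and> u B = q ((B - A) / 2 / \<epsilon>)}"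
    by (rule admissible_interval[OF AB])
  have lo_le: "lo \<le> \<Theta> z \<omega>" for z using \<omega>(2) by blast
  have \<theta>0: "?\<theta> z \<ge> 0" for z using \<omega>(2) lo_pos by (meson less_imp_le order_trans)
  have "admissible q \<epsilon> 1 {A..B} \<noteq> {}"
  proof -
    let ?p = "q ((A - B) / 2 / \<epsilon>)" and ?q = "q ((B - A) / 2 / \<epsilon>)"
    have "compact (W ` closed_segment ?p ?q)" by (intro compact_continuous_image W_cont_on) simp
    then obtain V where V: "\<And>x. x \<in> closed_segment ?p ?q \<Longrightarrow> W x \<le> V"
      by (meson bounded_imp_bdd_above compact_imp_bounded bdd_above.E imageI)
    have "0 \<le> V" using V[of ?p] W_nonneg[of ?p] by simp
    from path_within_energy[OF path_within_linear[OF AB eps del W_cont \<theta>0 V order_refl this] AB W_cont del]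
    show ?thesis unfolding adm by blast
  qed
  moreover have "bdd_below (energy W ?\<theta> \<epsilon> \<delta> {A..B} ` admissible q \<epsilon> 1 {A..B})"
    by (rule surface_tension_bdd_below[OF del eps W_nonneg \<theta>0])
  ultimately obtain u where u: "u \<in> admissible q \<epsilon> 1 {A..B}" "energy W ?\<theta> \<epsilon> \<delta> {A..B} u < C"
    using st unfolding surface_tension_def by (subst (asm) cINF_less_iff) auto
  then have uH: "u \<in> H1 {A..B}" "u A < level n s" "u B > level n (n - s)" using qA qB by (auto simp: adm)
  obtain z0 :: int and p r :: "nat \<Rightarrow> nat" where
    z0: "z0 \<in> {\<lfloor>A / \<delta>\<rfloor>..\<lceil>B / \<delta>\<rceil> + 1}"
    and pr': "\<forall>j\<in>?J. r j > 0 \<and> real (p j) \<le> C / (lo * wlow) * (\<epsilon> / \<delta>) + 1 \<and> real (r j) \<le> C / (lo * wlow) * (\<epsilon> / \<delta>) + 1"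
    and disj: "disjoint_family_on (?blocks z0 p r) ?J"
    and sum: "(\<Sum>j\<in>?J. 2 / ((real n)\<^sup>2 * (real (r j) * \<delta> / \<epsilon>)) +
      \<delta> / \<epsilon> * slot_max W n j * (\<Sum>z\<in>?blocks z0 p r j. ?\<theta> z)) \<le> g * C"
    by (rule energy_lower_by_blocks[where \<theta>="\<lambda>z. \<Theta> z \<omega>", OF eps del lo_pos lo_le s g wlow wj uH(1) AB uH(2,3) less_imp_le[OF u(2)] C fine])
  note pr = bspec[OF pr']
  define S where "S j = (\<Sum>z\<in>?blocks z0 p r j. ?\<theta> z)" for j
  have cb: "card (?blocks z0 p r j) = r j" for j by simp
  have "\<exists>m\<in>G. S j / real (r j) \<le> m \<and> m \<le> g * (S j / real (r j))" if j: "j \<in> ?J" for j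
  proof (rule G(3))
    have r: "real (r j) > 0" using pr[OF j] by simp
    have "real (r j) * lo \<le> S j" unfolding S_def using \<omega>(2) sum_bounded_below[of "?blocks z0 p r j" lo ?\<theta>] cb[of j] by simp
    then show "lo \<le> S j / real (r j)" using r by (simp add: pos_le_divide_eq mult.commute)
    have "S j \<le> real (r j) * hi" unfolding S_def using \<omega>(2) sum_bounded_above[of "?blocks z0 p r j" ?\<theta> hi] cb[of j] by simp
    then show "S j / real (r j) \<le> hi" using r by (simp add: pos_divide_le_eq mult.commute)
  qed
  then obtain m where m: "\<And>j. j \<in> ?J \<Longrightarrow> m j \<in> G \<and> S j / real (r j) \<le> m j \<and> m j \<le> g * (S j / real (r j))" by metis
  have m1: "S j \<le> real (r j) * m j" "real (r j) * m j \<le> g * S j" if j: "j \<in> ?J" for j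
  proof -
    have r: "real (r j) > 0" using pr[OF j] by simp
    show "S j \<le> real (r j) * m j" using m[OF j] r by (simp add: pos_divide_le_eq mult.commute)
    have "real (r j) * m j \<le> real (r j) * (g * (S j / real (r j)))" using m[OF j] r by (intro mult_left_mono) auto
    then show "real (r j) * m j \<le> g * S j" using r by simp
  qed
  let ?R = "\<lambda>f. restrict f ?J"
  have dR: "disjoint_family_on (?blocks z0 (?R p) (?R r)) ?J"
    using disj by (simp add: disjoint_family_on_def)
  have PiEs: "?R p \<in> PiE ?J (\<lambda>_. {..N})" "?R r \<in> PiE ?J (\<lambda>_. {..N})" "?R m \<in> PiE ?J (\<lambda>_. G)"
  proof -
    have "p j \<le> N \<and> r j \<le> N" if "j \<in> ?J" for j using pr[OF that] N by linarith
    then show "?R p \<in> PiE ?J (\<lambda>_. {..N})" "?R r \<in> PiE ?J (\<lambda>_. {..N})" by (auto simp: PiE_iff)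
    show "?R m \<in> PiE ?J (\<lambda>_. G)" using m by (auto simp: PiE_iff)
  qed
  have "\<sigma> (ennreal (\<delta> / \<epsilon> * (\<Sum>j\<in>?J. real (r j) * rate (m j)))) \<le> g * (g * C) + end_cost n s"
  proof (rule profile_from_blocks[OF s, where h="\<lambda>j. real (r j) * \<delta> / \<epsilon>" and m=m])
    show "0 < real (r j) * \<delta> / \<epsilon>" if "j \<in> ?J" for j using pr[OF that] eps del by simp
    show "lo < m j" if "j \<in> ?J" for j using m[OF that] G(2) by blast
    have "(\<Sum>j\<in>?J. real (r j) * \<delta> / \<epsilon> * rate (m j)) = \<delta> / \<epsilon> * (\<Sum>j\<in>?J. real (r j) * rate (m j))"
      by (simp add: sum_distrib_left mult_ac)
    then show "ennreal (\<Sum>j\<in>?J. real (r j) * \<delta> / \<epsilon> * rate (m j)) \<le> ennreal (\<delta> / \<epsilon> * (\<Sum>j\<in>?J. real (r j) * rate (m j)))" by simp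
    have "(\<Sum>j\<in>?J. 2 / ((real n)\<^sup>2 * (real (r j) * \<delta> / \<epsilon>)) + real (r j) * \<delta> / \<epsilon> * m j * slot_max W n j)
      \<le> (\<Sum>j\<in>?J. g * (2 / ((real n)\<^sup>2 * (real (r j) * \<delta> / \<epsilon>)) + \<delta> / \<epsilon> * slot_max W n j * S j))"
    proof (rule sum_mono)
      fix j assume j: "j \<in> ?J"
      have pos: "0 \<le> slot_max W n j" using slot_max_pos[of n j] s by (simp add: less_imp_le)
      have "real (r j) * \<delta> / \<epsilon> * m j * slot_max W n j = (\<delta> / \<epsilon> * slot_max W n j) * (real (r j) * m j)" by simp
      also have "\<dots> \<le> (\<delta> / \<epsilon> * slot_max W n j) * (g * S j)"
        using m1(2)[OF j] pos eps del by (intro mult_left_mono) auto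
      finally have 1: "real (r j) * \<delta> / \<epsilon> * m j * slot_max W n j \<le> g * (\<delta> / \<epsilon> * slot_max W n j * S j)" by (simp add: mult_ac)
      have "0 \<le> 2 / ((real n)\<^sup>2 * (real (r j) * \<delta> / \<epsilon>))" using eps del by simp
      then have "1 * (2 / ((real n)\<^sup>2 * (real (r j) * \<delta> / \<epsilon>))) \<le> g * (2 / ((real n)\<^sup>2 * (real (r j) * \<delta> / \<epsilon>)))"
        using g by (intro mult_right_mono) auto
      then show "2 / ((real n)\<^sup>2 * (real (r j) * \<delta> / \<epsilon>)) + real (r j) * \<delta> / \<epsilon> * m j * slot_max W n j
        \<le> g * (2 / ((real n)\<^sup>2 * (real (r j) * \<delta> / \<epsilon>)) + \<delta> / \<epsilon> * slot_max W n j * S j)"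
        using 1 unfolding distrib_left by linarith
    qed
    also have "\<dots> \<le> g * (g * C)" unfolding sum_distrib_left[symmetric] S_def using sum g by (intro mult_left_mono) auto
    finally show "(\<Sum>j\<in>?J. 2 / ((real n)\<^sup>2 * (real (r j) * \<delta> / \<epsilon>)) + real (r j) * \<delta> / \<epsilon> * m j * slot_max W n j) \<le> g * (g * C)" .
  qed
  then have "\<sigma> (ennreal (\<delta> / \<epsilon> * (\<Sum>j\<in>?J. real (?R r j) * rate (?R m j)))) \<le> g * (g * C) + end_cost n s" by simp
  moreover have "\<forall>j\<in>?J. (\<Sum>z\<in>?blocks z0 (?R p) (?R r) j. \<Theta> z \<omega>) \<le> real (?R r j) * ?R m j"
    using m1(1) by (simp add: S_def)
  ultimately show ?thesis
    using z0 dR PiEs by (intro bexI[of _ z0] bexI[of _ "?R p"] bexI[of _ "?R r"] bexI[of _ "?R m"] conjI)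
qed

text \<open>If the blocks found by \<open>low_energy_profile\<close> had cost at most \<open>k\<close>, the profile would contradict the
  hypothesis on \<open>\<sigma> k\<close>; so low energy forces costly blocks.\<close>

lemma prob_low_energy:
  assumes eps: "\<epsilon> > 0" and del: "\<delta> > 0" and AB: "A < B"
    and s: "0 < s" "2 * s < n" and g: "g > 1"
    and wlow: "wlow > 0" "\<And>x. x \<in> {level n s..level n (n - s)} \<Longrightarrow> wlow \<le> W x"
    and wj: "\<And>j x. j \<in> {s..<n - s} \<Longrightarrow> x \<in> {level n j..level n (Suc j)} \<Longrightarrow> slot_max W n j \<le> g * W x"
    and qA: "q ((A - B) / 2 / \<epsilon>) < level n s" and qB: "q ((B - A) / 2 / \<epsilon>) > level n (n - s)"
    and C: "C > 0" and fine: "\<epsilon> / \<delta> * (2 / ((real n)\<^sup>2 * C)) \<ge> 2 * g / (g - 1)"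
    and G: "finite G" "\<And>m. m \<in> G \<Longrightarrow> lo < m" "\<And>y. lo \<le> y \<Longrightarrow> y \<le> hi \<Longrightarrow> \<exists>m\<in>G. y \<le> m \<and> m \<le> g * y"
    and N: "C / (lo * wlow) * (\<epsilon> / \<delta>) + 1 \<le> real N"
    and k: "k \<ge> 0" "g * (g * C) + end_cost n s < \<sigma> (ennreal k)"
  shows "prob {\<omega> \<in> space M. surface_tension W q (\<lambda>z. \<Theta> z \<omega>) \<epsilon> \<delta> 1 {A..B} < C}
    \<le> ((B - A) / \<delta> + 4) * real (N + 1) ^ (2 * (n - 2 * s)) * real (card G) ^ (n - 2 * s) * exp (- (k * (\<epsilon> / \<delta>)))"
proof -
  let ?J = "{s..<n - s}"
  define Z where "Z = {\<lfloor>A / \<delta>\<rfloor>..\<lceil>B / \<delta>\<rceil> + 1}"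
  have Zf: "finite Z" by (simp add: Z_def)
  have cZ: "real (card Z) \<le> (B - A) / \<delta> + 4"
  proof -
    have AB': "A / \<delta> \<le> B / \<delta>" using AB del by (intro divide_right_mono) auto
    have 0: "\<lceil>B / \<delta>\<rceil> + 1 - \<lfloor>A / \<delta>\<rfloor> + 1 \<ge> 0" using AB' by linarith
    have "card Z = nat (\<lceil>B / \<delta>\<rceil> + 1 - \<lfloor>A / \<delta>\<rfloor> + 1)" by (simp add: Z_def)
    then have "real (card Z) = of_int (\<lceil>B / \<delta>\<rceil> + 1 - \<lfloor>A / \<delta>\<rfloor> + 1)" using 0 by simp
    also have "\<dots> \<le> B / \<delta> - A / \<delta> + 4" by linarith
    finally show ?thesis by (simp add: diff_divide_distrib)
  qed
  have cJ: "card ?J = n - 2 * s" by simp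
  let ?blocks = "\<lambda>(z0::int) (p::nat \<Rightarrow> nat) (r::nat \<Rightarrow> nat) (j::nat). {z0 + int (p j)..<z0 + int (p j) + int (r j)}"
  define Bad where "Bad = {\<omega> \<in> space M. \<exists>z0\<in>Z. \<exists>p\<in>PiE ?J (\<lambda>_. {..N}). \<exists>r\<in>PiE ?J (\<lambda>_. {..N}). \<exists>m\<in>PiE ?J (\<lambda>_. G).
      disjoint_family_on (?blocks z0 p r) ?J \<and> k * (\<epsilon> / \<delta>) < (\<Sum>j\<in>?J. real (r j) * rate (m j)) \<and>
      (\<forall>j\<in>?J. (\<Sum>z\<in>?blocks z0 p r j. \<Theta> z \<omega>) \<le> real (r j) * m j)}"
  have pBad: "prob Bad \<le> real (card Z) * real (N + 1) ^ (2 * card ?J) * real (card G) ^ card ?J * exp (- (k * (\<epsilon> / \<delta>)))"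
    unfolding Bad_def by (rule prob_costly_blocks[OF Zf G(1,2)]) simp_all
  also have "\<dots> \<le> ((B - A) / \<delta> + 4) * real (N + 1) ^ (2 * card ?J) * real (card G) ^ card ?J * exp (- (k * (\<epsilon> / \<delta>)))"
    using cZ by (intro mult_right_mono) auto
  finally have pB: "prob Bad \<le> ((B - A) / \<delta> + 4) * real (N + 1) ^ (2 * (n - 2 * s)) * real (card G) ^ (n - 2 * s) * exp (- (k * (\<epsilon> / \<delta>)))"
    unfolding cJ .
  have det: "\<omega> \<in> Bad" if \<omega>: "\<omega> \<in> space M" "\<forall>z. lo \<le> \<Theta> z \<omega> \<and> \<Theta> z \<omega> \<le> hi"
    and st: "surface_tension W q (\<lambda>z. \<Theta> z \<omega>) \<epsilon> \<delta> 1 {A..B} < C" for \<omega>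
  proof -
    obtain z0 p r m where z0: "z0 \<in> Z" and PiEs: "p \<in> PiE ?J (\<lambda>_. {..N})" "r \<in> PiE ?J (\<lambda>_. {..N})" "m \<in> PiE ?J (\<lambda>_. G)"
      and dis: "disjoint_family_on (?blocks z0 p r) ?J"
      and le: "\<forall>j\<in>?J. (\<Sum>z\<in>?blocks z0 p r j. \<Theta> z \<omega>) \<le> real (r j) * m j"
      and \<sigma>: "\<sigma> (ennreal (\<delta> / \<epsilon> * (\<Sum>j\<in>?J. real (r j) * rate (m j)))) \<le> g * (g * C) + end_cost n s"
      using low_energy_profile[OF eps del AB s g wlow wj qA qB C fine G N \<omega> st] unfolding Z_def by blast
    have "k * (\<epsilon> / \<delta>) < (\<Sum>j\<in>?J. real (r j) * rate (m j))"
    proof (rule ccontr)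
      assume "\<not> ?thesis"
      then have "\<delta> / \<epsilon> * (\<Sum>j\<in>?J. real (r j) * rate (m j)) \<le> \<delta> / \<epsilon> * (k * (\<epsilon> / \<delta>))"
        using eps del by (intro mult_left_mono) auto
      also have "\<dots> = k" using eps del by simp
      finally have "\<sigma> (ennreal k) \<le> g * (g * C) + end_cost n s"
        using \<sigma>_antimono[OF ennreal_leI] \<sigma> by (meson order_trans)
      then show False using k by linarith
    qed
    then show ?thesis using \<omega>(1) z0 PiEs dis le unfolding Bad_def by blast
  qed
  have "prob {\<omega> \<in> space M. surface_tension W q (\<lambda>z. \<Theta> z \<omega>) \<epsilon> \<delta> 1 {A..B} < C} \<le> prob Bad"
  proof (rule finite_measure_mono_AE)
    show "AE \<omega> in M. \<omega> \<in> {\<omega> \<in> space M. surface_tension W q (\<lambda>z. \<Theta> z \<omega>) \<epsilon> \<delta> 1 {A..B} < C} \<longrightarrow> \<omega> \<in> Bad"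
      using AE_bounds by (rule eventually_mono) (use det in blast)
    have fin: "finite (PiE ?J (\<lambda>_. {..N}))" "finite (PiE ?J (\<lambda>_. G))" using G by (auto intro!: finite_PiE)
    show "Bad \<in> sets M" unfolding Bad_def
      by (intro sets.sets_Collect_finite_Ex Zf fin sets.sets_Collect_conj sets.sets_Collect_const
          sets.sets_Collect_finite_All borel_measurable_le borel_measurable_sum measurable_\<Theta>) auto
  qed
  then show ?thesis using pB by linarith
qed

end

section \<open>Low block averages allow low energy\<close>

text \<open>The first cell of the \<open>k\<close>th of consecutive blocks of lengths \<open>r 0\<close>, \<open>r 1\<close>, ..., counted from the
  start of the window.\<close>

definition offset :: "(nat \<Rightarrow> nat) \<Rightarrow> nat \<Rightarrow> nat" where
  "offset r k = (\<Sum>i<k. r i)"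

lemma offset_0: "offset r 0 = 0" and offset_Suc: "offset r (Suc k) = offset r k + r k"
  by (simp_all add: offset_def)

lemma offset_mono: "i \<le> j \<Longrightarrow> offset r i \<le> offset r j"
  unfolding offset_def by (rule sum_mono2) auto

context double_well
begin

lemma W_wells: "W (-1) = 0" "W 1 = 0"
  using W_zeros[of "-1"] W_zeros[of 1] by simp_all

text \<open>The function stays at \<open>-1\<close>, where the potential vanishes, until the first block, and then crosses
  slot \<open>j\<close> linearly over block \<open>j\<close>.\<close>

lemma path_through_blocks:
  assumes eps: "\<epsilon> > 0" and del: "\<delta> > 0" and \<theta>: "\<And>z. \<theta> z \<ge> 0" and n: "n > 0"
    and r: "\<And>j. j < n \<Longrightarrow> r j > 0" and x0: "x0 < \<delta> * (of_int z - 1/2)" and k: "k \<le> n"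
  shows "path_within W \<theta> \<epsilon> \<delta> x0 (\<delta> * (of_int (z + int (offset r k)) - 1/2)) (-1) (level n k)
     (\<Sum>j<k. 2 / ((real n)\<^sup>2 * (real (r j) * \<delta> / \<epsilon>)) +
        \<delta> / \<epsilon> * slot_max W n j * (\<Sum>i\<in>{z + int (offset r j)..<z + int (offset r j) + int (r j)}. \<theta> i))"
  using k
proof (induction k)
  case 0
  have "path_within W \<theta> \<epsilon> \<delta> x0 (\<delta> * (of_int z - 1/2)) (-1) (-1) (\<epsilon> * (-1 - (-1))\<^sup>2 / (2 * (\<delta> * (of_int z - 1/2) - x0)) + 0 * (LINT x:{x0..\<delta> * (of_int z - 1/2)}|lebesgue. checkerboard \<theta> (x / \<delta>)) / \<epsilon>)"
    by (rule path_within_linear[OF x0 eps del W_cont \<theta>]) (auto simp: W_wells)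
  then show ?case by (simp add: offset_0 level_0)
next
  case (Suc k)
  let ?y = "\<lambda>k. \<delta> * (of_int (z + int (offset r k)) - 1/2)"
  let ?S = "\<Sum>i\<in>{z + int (offset r k)..<z + int (offset r k) + int (r k)}. \<theta> i"
  have rk: "r k > 0" using r Suc by simp
  have yy: "?y k < ?y (Suc k)" using rk del by (simp add: offset_Suc)
  have x0y: "x0 < ?y k"
  proof -
    have "\<delta> * (of_int z - 1/2) \<le> ?y k" using del by simp
    then show ?thesis using x0 by linarith
  qed
  have len: "?y (Suc k) - ?y k = real (r k) * \<delta>" by (simp add: offset_Suc algebra_simps)
  have T: "(LINT x:{?y k..?y (Suc k)}|lebesgue. checkerboard \<theta> (x / \<delta>)) = \<delta> * ?S"
    using checkerboard_integral_cells[OF del, of "z + int (offset r k)" "r k" \<theta>] by (simp add: offset_Suc add.assoc)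
  have "path_within W \<theta> \<epsilon> \<delta> (?y k) (?y (Suc k)) (level n k) (level n (Suc k))
    (\<epsilon> * (level n (Suc k) - level n k)\<^sup>2 / (2 * (?y (Suc k) - ?y k)) + slot_max W n k * (\<delta> * ?S) / \<epsilon>)"
  proof (rule path_within_linear[OF yy eps del W_cont \<theta>])
    show "W s \<le> slot_max W n k" if "s \<in> closed_segment (level n k) (level n (Suc k))" for s
      using that level_less[OF n, of k] by (intro slot_max_upper) (simp add: closed_segment_eq_real_ivl)
    show "0 \<le> slot_max W n k" using slot_max_pos[OF n] by (simp add: less_imp_le)
  qed (use T in simp)
  moreover have "\<epsilon> * (level n (Suc k) - level n k)\<^sup>2 / (2 * (?y (Suc k) - ?y k)) + slot_max W n k * (\<delta> * ?S) / \<epsilon>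
     = 2 / ((real n)\<^sup>2 * (real (r k) * \<delta> / \<epsilon>)) + \<delta> / \<epsilon> * slot_max W n k * ?S"
    unfolding level_diff[OF n] len by (simp add: power_divide mult_ac)
  ultimately have step: "path_within W \<theta> \<epsilon> \<delta> (?y k) (?y (Suc k)) (level n k) (level n (Suc k))
     (2 / ((real n)\<^sup>2 * (real (r k) * \<delta> / \<epsilon>)) + \<delta> / \<epsilon> * slot_max W n k * ?S)" by simp
  from path_within_join[OF Suc.IH step x0y yy del W_cont] Suc.prems show ?case by simp
qed

text \<open>The boundary values are near but not equal to the wells; two further linear pieces of length \<open>\<epsilon>\<close> at
  the ends connect them to the wells, and \<open>V\<close> bounds the potential there. In between, the profile is placed on
  the given blocks.\<close>

lemma surface_tension_upper:
  assumes eps: "\<epsilon> > 0" and del: "\<delta> > 0" and \<theta>: "\<And>z. \<theta> z \<ge> 0" "\<And>z. \<theta> z \<le> hi" and n: "n > 0"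
    and r: "\<And>j. j < n \<Longrightarrow> r j > 0" and AB: "A < B"
    and left: "A + \<epsilon> < \<delta> * (of_int z - 1/2)" and right: "\<delta> * (of_int (z + int (offset r n)) - 1/2) < B - \<epsilon>"
    and V: "V \<ge> 0" "\<And>s. s \<in> closed_segment (q ((A - B) / 2 / \<epsilon>)) (-1) \<Longrightarrow> W s \<le> V"
       "\<And>s. s \<in> closed_segment 1 (q ((B - A) / 2 / \<epsilon>)) \<Longrightarrow> W s \<le> V"
    and m: "\<And>j. j < n \<Longrightarrow> (\<Sum>i\<in>{z + int (offset r j)..<z + int (offset r j) + int (r j)}. \<theta> i) \<le> real (r j) * m j"
  shows "surface_tension W q \<theta> \<epsilon> \<delta> 1 {A..B} \<le> (1 + q ((A - B) / 2 / \<epsilon>))\<^sup>2 / 2 + (1 - q ((B - A) / 2 / \<epsilon>))\<^sup>2 / 2 + 2 * V * hi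
     + profile_energy W n (\<lambda>j. real (r j) * \<delta> / \<epsilon>) m"
proof -
  let ?p = "q ((A - B) / 2 / \<epsilon>)" and ?q = "q ((B - A) / 2 / \<epsilon>)"
  let ?yn = "\<delta> * (of_int (z + int (offset r n)) - 1/2)"
  have yle: "\<delta> * (of_int z - 1/2) \<le> ?yn" using del by simp
  then have y: "A + \<epsilon> < ?yn" using left by linarith
  let ?e = "\<Sum>j<n. 2 / ((real n)\<^sup>2 * (real (r j) * \<delta> / \<epsilon>)) +
        \<delta> / \<epsilon> * slot_max W n j * (\<Sum>i\<in>{z + int (offset r j)..<z + int (offset r j) + int (r j)}. \<theta> i)"
  have p1: "path_within W \<theta> \<epsilon> \<delta> A (A + \<epsilon>) ?p (-1) (\<epsilon> * (-1 - ?p)\<^sup>2 / (2 * (A + \<epsilon> - A)) + V * (hi * (A + \<epsilon> - A)) / \<epsilon>)"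
    by (rule path_within_linear[OF _ eps del W_cont \<theta>(1) V(2) checkerboard_integral_le[OF del _ \<theta>] V(1)]) (use eps in auto)
  have p2: "path_within W \<theta> \<epsilon> \<delta> (A + \<epsilon>) ?yn (-1) 1 ?e"
    using path_through_blocks[OF eps del \<theta>(1) n r left order_refl] by (simp add: level_n[OF n])
  have p3: "path_within W \<theta> \<epsilon> \<delta> ?yn (B - \<epsilon>) 1 1 (\<epsilon> * (1 - 1)\<^sup>2 / (2 * (B - \<epsilon> - ?yn)) + 0 * (LINT x:{?yn..B - \<epsilon>}|lebesgue. checkerboard \<theta> (x / \<delta>)) / \<epsilon>)"
    by (rule path_within_linear[OF right eps del W_cont \<theta>(1)]) (auto simp: W_wells)
  have p4: "path_within W \<theta> \<epsilon> \<delta> (B - \<epsilon>) B 1 ?q (\<epsilon> * (?q - 1)\<^sup>2 / (2 * (B - (B - \<epsilon>))) + V * (hi * (B - (B - \<epsilon>))) / \<epsilon>)"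
    by (rule path_within_linear[OF _ eps del W_cont \<theta>(1) V(3) checkerboard_integral_le[OF del _ \<theta>] V(1)]) (use eps in auto)
  have p12: "path_within W \<theta> \<epsilon> \<delta> A ?yn ?p 1 (\<epsilon> * (-1 - ?p)\<^sup>2 / (2 * (A + \<epsilon> - A)) + V * (hi * (A + \<epsilon> - A)) / \<epsilon> + ?e)"
    by (rule path_within_join[OF p1 p2 _ y del W_cont]) (use eps in simp)
  have "A < ?yn" "A < B - \<epsilon>" using y eps right by linarith+
  then have "path_within W \<theta> \<epsilon> \<delta> A B ?p ?q (\<epsilon> * (-1 - ?p)\<^sup>2 / (2 * (A + \<epsilon> - A)) + V * (hi * (A + \<epsilon> - A)) / \<epsilon> + ?e
     + (\<epsilon> * (1 - 1)\<^sup>2 / (2 * (B - \<epsilon> - ?yn)) + 0 * (LINT x:{?yn..B - \<epsilon>}|lebesgue. checkerboard \<theta> (x / \<delta>)) / \<epsilon>)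
     + (\<epsilon> * (?q - 1)\<^sup>2 / (2 * (B - (B - \<epsilon>))) + V * (hi * (B - (B - \<epsilon>))) / \<epsilon>))"
    using eps by (intro path_within_join[OF path_within_join[OF p12 p3] p4] right del W_cont) auto
  from path_within_energy[OF this AB W_cont del]
  obtain u where u: "u \<in> H1 {A..B}" "u A = ?p" "u B = ?q" and "energy W \<theta> \<epsilon> \<delta> {A..B} u \<le> \<epsilon> * (-1 - ?p)\<^sup>2 / (2 * (A + \<epsilon> - A)) + V * (hi * (A + \<epsilon> - A)) / \<epsilon> + ?e
     + (\<epsilon> * (1 - 1)\<^sup>2 / (2 * (B - \<epsilon> - ?yn)) + 0 * (LINT x:{?yn..B - \<epsilon>}|lebesgue. checkerboard \<theta> (x / \<delta>)) / \<epsilon>)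
     + (\<epsilon> * (?q - 1)\<^sup>2 / (2 * (B - (B - \<epsilon>))) + V * (hi * (B - (B - \<epsilon>))) / \<epsilon>)" by blast
  moreover have "(-1 - ?p)\<^sup>2 = (1 + ?p)\<^sup>2" "(?q - 1)\<^sup>2 = (1 - ?q)\<^sup>2" by (simp_all add: power2_eq_square algebra_simps)
  ultimately have E: "energy W \<theta> \<epsilon> \<delta> {A..B} u \<le> (1 + ?p)\<^sup>2 / 2 + (1 - ?q)\<^sup>2 / 2 + 2 * V * hi + ?e"
    using eps by simp
  have "u \<in> admissible q \<epsilon> 1 {A..B}" unfolding admissible_interval[OF AB] using u by simp
  then have "surface_tension W q \<theta> \<epsilon> \<delta> 1 {A..B} \<le> energy W \<theta> \<epsilon> \<delta> {A..B} u"
    unfolding surface_tension_def by (intro cINF_lower surface_tension_bdd_below[OF del eps W_nonneg \<theta>(1)])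
  moreover have "?e \<le> profile_energy W n (\<lambda>j. real (r j) * \<delta> / \<epsilon>) m"
    unfolding profile_energy_def
  proof (rule sum_mono)
    fix j assume j: "j \<in> {..<n}"
    have "\<delta> / \<epsilon> * slot_max W n j * (\<Sum>i\<in>{z + int (offset r j)..<z + int (offset r j) + int (r j)}. \<theta> i)
       \<le> \<delta> / \<epsilon> * slot_max W n j * (real (r j) * m j)"
      using m[of j] j slot_max_pos[OF n, of j] eps del by (intro mult_left_mono) (auto simp: less_imp_le)
    then show "2 / ((real n)\<^sup>2 * (real (r j) * \<delta> / \<epsilon>)) + \<delta> / \<epsilon> * slot_max W n j * (\<Sum>i\<in>{z + int (offset r j)..<z + int (offset r j) + int (r j)}. \<theta> i)
      \<le> 2 / ((real n)\<^sup>2 * (real (r j) * \<delta> / \<epsilon>)) + real (r j) * \<delta> / \<epsilon> * m j * slot_max W n j"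
      by (simp add: mult_ac)
  qed
  ultimately show ?thesis using E by linarith
qed

end

context random_double_well
begin

text \<open>It is enough that one of \<open>Q\<close> disjoint consecutive windows is good.\<close>

lemma prob_high_energy:
  assumes eps: "\<epsilon> > 0" and del: "\<delta> > 0" and n: "n > 0"
    and r: "\<And>j. j < n \<Longrightarrow> r j > 0" and AB: "A < B"
    and left: "A + \<epsilon> < \<delta> * (of_int z - 1/2)"
    and right: "\<delta> * (of_int (z + int (Q * offset r n)) - 1/2) < B - \<epsilon>"
    and V: "V \<ge> 0" "\<And>s. s \<in> closed_segment (q ((A - B) / 2 / \<epsilon>)) (-1) \<Longrightarrow> W s \<le> V"
       "\<And>s. s \<in> closed_segment 1 (q ((B - A) / 2 / \<epsilon>)) \<Longrightarrow> W s \<le> V"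
    and C: "(1 + q ((A - B) / 2 / \<epsilon>))\<^sup>2 / 2 + (1 - q ((B - A) / 2 / \<epsilon>))\<^sup>2 / 2 + 2 * V * hi
       + profile_energy W n (\<lambda>j. real (r j) * \<delta> / \<epsilon>) m \<le> C"
  shows "prob {\<omega> \<in> space M. surface_tension W q (\<lambda>z. \<Theta> z \<omega>) \<epsilon> \<delta> 1 {A..B} > C}
    \<le> (1 - (\<Prod>j<n. tail_prob (r j) (m j))) ^ Q"
proof -
  define R where "R = offset r n"
  define K where "K w j = {z + int (w * R + offset r j)..<z + int (w * R + offset r j) + int (r j)}" for w j
  have Kup: "x < z + int (w * R + offset r (Suc j))" if "x \<in> K w j" for x w j
    using that by (simp add: K_def offset_Suc)
  have Klow: "z + int (w * R + offset r j) \<le> x" if "x \<in> K w j" for x w j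
    using that by (simp add: K_def)
  have ordered: "x < y" if "x \<in> K w j" "y \<in> K w' j'" "w < w' \<or> w = w' \<and> j < j'" "j < n" for x y w j w' j'
  proof -
    have "w * R + offset r (Suc j) \<le> w' * R + offset r j'"
    proof (cases "w < w'")
      case True
      have "w * R + offset r (Suc j) \<le> w * R + R" using that(4) by (simp add: R_def offset_mono)
      also have "\<dots> = Suc w * R" by simp
      also have "\<dots> \<le> w' * R" using True by (intro mult_right_mono) auto
      finally show ?thesis by simp
    next
      case False
      then show ?thesis using that(3) by (simp add: offset_mono)
    qed
    then have "z + int (w * R + offset r (Suc j)) \<le> z + int (w' * R + offset r j')" by (simp only: add_le_cancel_left of_nat_le_iff)
    then show ?thesis using Kup[OF that(1)] Klow[OF that(2)] by linarith
  qed
  have disj: "disjoint_family_on (\<lambda>(w, j). K w j) ({..<Q} \<times> {..<n})"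
    unfolding disjoint_family_on_def
  proof (intro ballI impI, rule ccontr)
    fix a b assume ab: "a \<in> {..<Q} \<times> {..<n}" "b \<in> {..<Q} \<times> {..<n}" "a \<noteq> b"
      "(case a of (w, j) \<Rightarrow> K w j) \<inter> (case b of (w, j) \<Rightarrow> K w j) \<noteq> {}"
    obtain w j w' j' where e: "a = (w, j)" "b = (w', j')" by (cases a, cases b)
    obtain x where x: "x \<in> K w j" "x \<in> K w' j'" using ab(4) by (auto simp: e)
    have "j < n" "j' < n" using ab by (auto simp: e)
    moreover have "(w < w' \<or> w = w' \<and> j < j') \<or> (w' < w \<or> w' = w \<and> j' < j)" using ab(3) by (auto simp: e)
    ultimately show False using ordered[OF x] ordered[OF x(2,1)] by blast
  qed
  define Bad where "Bad = {\<omega> \<in> space M. \<forall>w\<in>{..<Q}. \<not> (\<forall>j\<in>{..<n}. (\<Sum>i\<in>K w j. \<Theta> i \<omega>) \<le> real (r j) * m j)}"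
  have "prob Bad = (\<Prod>w\<in>{..<Q}. 1 - (\<Prod>j\<in>{..<n}. prob {\<omega> \<in> space M. (\<Sum>i\<in>K w j. \<Theta> i \<omega>) \<le> real (r j) * m j}))"
    unfolding Bad_def by (rule prob_no_window[OF _ _ disj]) auto
  also have "\<dots> = (\<Prod>w\<in>{..<Q}. 1 - (\<Prod>j<n. tail_prob (r j) (m j)))"
  proof -
    have "prob {\<omega> \<in> space M. (\<Sum>i\<in>K w j. \<Theta> i \<omega>) \<le> real (r j) * m j} = tail_prob (r j) (m j)" for w j
      using prob_sum_le[of "K w j" "m j"] by (simp add: K_def)
    then show ?thesis by simp
  qed
  finally have pB: "prob Bad = (1 - (\<Prod>j<n. tail_prob (r j) (m j))) ^ Q" by simp
  have det: "\<omega> \<in> Bad" if \<omega>: "\<omega> \<in> space M" "\<forall>z. lo \<le> \<Theta> z \<omega> \<and> \<Theta> z \<omega> \<le> hi"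
    and st: "surface_tension W q (\<lambda>z. \<Theta> z \<omega>) \<epsilon> \<delta> 1 {A..B} > C" for \<omega>
  proof (rule ccontr)
    assume "\<omega> \<notin> Bad"
    then obtain w where w: "w < Q" "\<And>j. j < n \<Longrightarrow> (\<Sum>i\<in>K w j. \<Theta> i \<omega>) \<le> real (r j) * m j"
      using \<omega>(1) by (auto simp: Bad_def)
    have \<theta>: "\<Theta> z \<omega> \<ge> 0" "\<Theta> z \<omega> \<le> hi" for z using \<omega>(2) lo_pos by (meson less_imp_le order_trans)+
    have "surface_tension W q (\<lambda>z. \<Theta> z \<omega>) \<epsilon> \<delta> 1 {A..B} \<le> (1 + q ((A - B) / 2 / \<epsilon>))\<^sup>2 / 2 + (1 - q ((B - A) / 2 / \<epsilon>))\<^sup>2 / 2 + 2 * V * hi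
       + profile_energy W n (\<lambda>j. real (r j) * \<delta> / \<epsilon>) m"
    proof (rule surface_tension_upper[OF eps del \<theta> n r AB _ _ V, where z="z + int (w * R)"])
      have "\<delta> * (of_int z - 1/2) \<le> \<delta> * (of_int (z + int (w * R)) - 1/2)" using del by (intro mult_left_mono) auto
      then show "A + \<epsilon> < \<delta> * (of_int (z + int (w * R)) - 1/2)" using left by linarith
      have "w * R + offset r n = Suc w * R" by (simp add: R_def)
      also have "\<dots> \<le> Q * R" using w by (intro mult_right_mono) auto
      finally have "z + int (w * R) + int (offset r n) \<le> z + int (Q * R)" by (simp del: of_nat_mult add: of_nat_add[symmetric] del: of_nat_add)
      then have "\<delta> * (of_int (z + int (w * R) + int (offset r n)) - 1/2) \<le> \<delta> * (of_int (z + int (Q * R)) - 1/2)"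
        using del by (intro mult_left_mono diff_right_mono of_int_le_iff[THEN iffD2]) auto
      then show "\<delta> * (of_int (z + int (w * R) + int (offset r n)) - 1/2) < B - \<epsilon>" using right by (simp add: R_def)
    qed (use w(2) in \<open>auto simp: K_def add.assoc\<close>)
    then show False using C st by linarith
  qed
  have "prob {\<omega> \<in> space M. surface_tension W q (\<lambda>z. \<Theta> z \<omega>) \<epsilon> \<delta> 1 {A..B} > C} \<le> prob Bad"
  proof (rule finite_measure_mono_AE)
    show "AE \<omega> in M. \<omega> \<in> {\<omega> \<in> space M. surface_tension W q (\<lambda>z. \<Theta> z \<omega>) \<epsilon> \<delta> 1 {A..B} > C} \<longrightarrow> \<omega> \<in> Bad"
      using AE_bounds by (rule eventually_mono) (use det in blast)
    show "Bad \<in> sets M" unfolding Bad_def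
      by (intro sets.sets_Collect_finite_All sets.sets_Collect_neg borel_measurable_le borel_measurable_sum measurable_\<Theta>) auto
  qed
  then show ?thesis using pB by simp
qed

end

section \<open>Convergence in probability\<close>

lemma poly_exp_tendsto_0:
  fixes c :: real
  assumes "c > 0"
  shows "((\<lambda>x. (x + 1) ^ D * exp (- (c * x))) \<longlongrightarrow> 0) at_top"
proof -
  have "filterlim (\<lambda>x. c * (x + 1)) at_top at_top"
    using assms by real_asymp
  from filterlim_compose[OF tendsto_power_div_exp_0[of D] this]
  have "((\<lambda>x. (c * (x + 1)) ^ D / exp (c * (x + 1))) \<longlongrightarrow> 0) at_top" .
  then have "((\<lambda>x. exp c / c ^ D * ((c * (x + 1)) ^ D / exp (c * (x + 1)))) \<longlongrightarrow> exp c / c ^ D * 0) at_top"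
    by (intro tendsto_intros)
  moreover have "exp c / c ^ D * ((c * (x + 1)) ^ D / exp (c * (x + 1))) = (x + 1) ^ D * exp (- (c * x))" for x
  proof -
    have "exp c / c ^ D * ((c * (x + 1)) ^ D / exp (c * (x + 1))) = (x + 1) ^ D * (exp c / exp (c * (x + 1)))"
      using assms by (simp add: power_mult_distrib)
    also have "exp c / exp (c * (x + 1)) = exp (- (c * x))" by (simp add: exp_diff[symmetric] algebra_simps)
    finally show ?thesis .
  qed
  ultimately show ?thesis by simp
qed

lemma eventually_at_right_less_bound: "\<forall>\<^sub>F \<epsilon> in at_right (0::real). \<epsilon> < 1"
  by (auto simp: eventually_at_right_field intro: exI[of _ 1])

lemma filterlim_ratio_at_top:
  fixes \<delta> :: "real \<Rightarrow> real"
  assumes "\<forall>\<epsilon>>0. \<delta> \<epsilon> > 0" "((\<lambda>\<epsilon>. \<delta> \<epsilon> / \<epsilon>) \<longlongrightarrow> 0) (at_right 0)"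
  shows "filterlim (\<lambda>\<epsilon>. \<epsilon> / \<delta> \<epsilon>) at_top (at_right 0)"
proof -
  have "\<forall>\<^sub>F \<epsilon> in at_right 0. 0 < \<delta> \<epsilon> / \<epsilon>"
    using assms(1) by (auto simp: eventually_at_filter)
  from filterlim_inverse_at_top[OF assms(2) this] show ?thesis by simp
qed

lemma boundary_limits:
  fixes q :: "real \<Rightarrow> real" and A B :: real
  assumes "(q \<longlongrightarrow> 1) at_top" "(q \<longlongrightarrow> -1) at_bot" "A < B"
  shows "((\<lambda>\<epsilon>. q ((A - B) / 2 / \<epsilon>)) \<longlongrightarrow> -1) (at_right 0)" "((\<lambda>\<epsilon>. q ((B - A) / 2 / \<epsilon>)) \<longlongrightarrow> 1) (at_right 0)"
proof -
  have "filterlim (\<lambda>\<epsilon>. (A - B) / 2 * inverse \<epsilon>) at_bot (at_right (0::real))"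
    by (rule filterlim_tendsto_neg_mult_at_bot[OF tendsto_const _ filterlim_inverse_at_top_right]) (use assms in simp)
  from filterlim_compose[OF assms(2) this]
  show "((\<lambda>\<epsilon>. q ((A - B) / 2 / \<epsilon>)) \<longlongrightarrow> -1) (at_right 0)" by (simp only: divide_inverse)
  have "filterlim (\<lambda>\<epsilon>. (B - A) / 2 * inverse \<epsilon>) at_top (at_right (0::real))"
    by (rule filterlim_tendsto_pos_mult_at_top[OF tendsto_const _ filterlim_inverse_at_top_right]) (use assms in simp)
  from filterlim_compose[OF assms(1) this]
  show "((\<lambda>\<epsilon>. q ((B - A) / 2 / \<epsilon>)) \<longlongrightarrow> 1) (at_right 0)" by (simp only: divide_inverse)
qed

context random_double_well
begin

text \<open>First fix the proportion \<open>1 / b\<close> of slots near each well, so that the end cost is small; then refine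
  until the potential, which is bounded below on the remaining range, varies by a factor at most \<open>g\<close> on
  every slot.\<close>

lemma choose_slots:
  assumes g: "g > 1" and e: "e > 0"
  obtains n s wlow where "0 < s" "2 * s < n" "wlow > 0" "\<forall>x\<in>{level n s..level n (n - s)}. wlow \<le> W x"
    "\<forall>j\<in>{s..<n - s}. \<forall>x\<in>{level n j..level n (Suc j)}. slot_max W n j \<le> g * W x"
    "end_cost n s < e"
proof -
  define D where "D = 2 * (2 + (hi + 1) * W_max)"
  obtain b' :: nat where b': "real b' > D / e" using reals_Archimedean2 by blast
  define b where "b = max b' 3"
  have b: "real b > D / e" "b \<ge> 3" using b' by (auto simp: b_def)
  define I where "I = {-1 + 2 / real b..1 - 2 / real b}"
  have bb: "0 < 2 / real b" "2 / real b < 1" using b by (auto simp: field_simps)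
  have "-1 + 2 / real b \<in> I" using bb unfolding I_def atLeastAtMost_iff by linarith
  then have "compact I" "I \<noteq> {}" by (auto simp: I_def)
  from continuous_attains_inf[OF this W_cont_on] obtain x0 where x0: "x0 \<in> I" "\<And>y. y \<in> I \<Longrightarrow> W x0 \<le> W y" by blast
  have wpos: "W x0 > 0" using x0(1) bb by (intro W_pos) (auto simp: I_def)
  have "uniformly_continuous_on I W" by (intro compact_uniformly_continuous W_cont_on) (simp add: I_def)
  moreover have "(g - 1) * W x0 > 0" using g wpos by simp
  ultimately obtain d where d: "d > 0" "\<And>x x'. x \<in> I \<Longrightarrow> x' \<in> I \<Longrightarrow> dist x' x < d \<Longrightarrow> dist (W x') (W x) < (g - 1) * W x0"
    unfolding uniformly_continuous_on_def by blast
  obtain s' :: nat where s': "real s' > 2 / d" using reals_Archimedean2 by blast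
  define s where "s = Suc s'"
  define n where "n = b * s"
  have sp: "real s > 0" "real b > 0" using b by (auto simp: s_def)
  have n: "n > 0" using b by (simp add: n_def s_def)
  have nr: "real n = real b * real s" by (simp add: n_def)
  have "3 * s \<le> n" using b by (simp add: n_def)
  then have s2: "0 < s" "2 * s < n" by (auto simp: s_def)
  have l1: "level n s = -1 + 2 / real b" using sp by (simp add: level_def nr)
  have l2: "level n (n - s) = 1 - 2 / real b"
    using sp s2 by (simp add: level_def nr of_nat_diff right_diff_distrib diff_divide_distrib)
  have small: "2 / real n < d"
  proof -
    have "2 / d < real s" using s' by (simp add: s_def)
    also have "\<dots> \<le> real n" using s2 by simp
    finally show ?thesis using d n by (simp add: field_simps)
  qed
  have slots: "slot_max W n j \<le> g * W x" if j: "j \<in> {s..<n - s}" and x: "x \<in> {level n j..level n (Suc j)}" for j x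
  proof -
    obtain y where y: "y \<in> {level n j..level n (Suc j)}" "slot_max W n j = W y" using slot_max_attained[OF n] by blast
    have "level n s \<le> level n j" "level n (Suc j) \<le> level n (n - s)" using j by (auto intro!: level_mono)
    then have xyI: "x \<in> I" "y \<in> I" using x y l1 l2 by (auto simp: I_def)
    have "\<bar>y - x\<bar> \<le> 2 / real n" using x y level_diff[OF n, of j] by auto
    then have "dist (W y) (W x) < (g - 1) * W x0" using d(2)[OF xyI] small by (simp add: dist_real_def)
    then have "W y \<le> W x + (g - 1) * W x0" by (simp add: dist_real_def)
    also have "\<dots> \<le> W x + (g - 1) * W x" using x0(2)[OF xyI(1)] g by (intro add_left_mono mult_left_mono) auto
    finally show ?thesis using y by (simp add: algebra_simps)
  qed
  have "end_cost n s = D / real b"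
    using sp by (simp add: end_cost_def nr D_def)
  also have "\<dots> < e" using b e sp by (simp add: field_simps)
  finally have ec: "end_cost n s < e" .
  have "\<forall>x\<in>{level n s..level n (n - s)}. W x0 \<le> W x"
    using l1 l2 x0(2) by (simp add: I_def)
  moreover have "\<forall>j\<in>{s..<n - s}. \<forall>x\<in>{level n j..level n (Suc j)}. slot_max W n j \<le> g * W x"
    using slots by blast
  ultimately show ?thesis by (rule that[OF s2 wpos _ _ ec])
qed

context
  fixes \<delta> :: "real \<Rightarrow> real" and q :: "real \<Rightarrow> real" and A B :: real and \<kappa> :: ennreal
  assumes dpos: "\<forall>\<epsilon>>0. \<delta> \<epsilon> > 0" and d0: "((\<lambda>\<epsilon>. \<delta> \<epsilon> / \<epsilon>) \<longlongrightarrow> 0) (at_right 0)"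
    and dlim: "((\<lambda>\<epsilon>. ennreal (\<delta> \<epsilon> * \<bar>ln \<epsilon>\<bar> / \<epsilon>)) \<longlongrightarrow> \<kappa>) (at_right 0)"
    and AB: "A < B" and q_top: "(q \<longlongrightarrow> 1) at_top" and q_bot: "(q \<longlongrightarrow> -1) at_bot"
begin

lemma ev_pos: "\<forall>\<^sub>F \<epsilon> in at_right (0::real). 0 < \<epsilon>"
  by (simp add: eventually_at_right_less)

text \<open>For finite \<open>\<kappa>\<close> choose a slightly larger budget \<open>k'\<close> that still has a value above \<open>C\<close>. The union bound
  is polynomial in \<open>N\<close> times \<open>(1 / \<epsilon>) * exp (- k' * N)\<close>, and \<open>1 / \<epsilon> \<le> exp (k2 * N)\<close> for some \<open>k2 < k'\<close>.
  For infinite \<open>\<kappa>\<close> the estimate is deterministic: already the best conceivable profile has energy above \<open>C\<close>.\<close>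

lemma tendsto_low_energy:
  assumes C: "0 < C" "C < \<sigma> \<kappa>"
  shows "((\<lambda>\<epsilon>. prob {\<omega> \<in> space M. surface_tension W q (\<lambda>z. \<Theta> z \<omega>) \<epsilon> (\<delta> \<epsilon>) 1 {A..B} < C}) \<longlongrightarrow> 0) (at_right 0)"
proof -
  have "\<exists>C'>C. C' < \<sigma> \<kappa> \<and> (\<kappa> = top \<or> (\<exists>k k'. \<kappa> = ennreal k \<and> 0 \<le> k \<and> k < k' \<and> C' < \<sigma> (ennreal k')))"
  proof -
    obtain C' where C': "C < C'" "C' < \<sigma> \<kappa>" using dense[OF C(2)] by blast
    show ?thesis
    proof (cases \<kappa>)
      case (real k)
      then show ?thesis using \<sigma>_right_continuous[of C' k] C' by auto
    qed (use C' in auto)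
  qed
  then obtain C' where C': "C < C'" "C' < \<sigma> \<kappa>" 
    and fin: "\<kappa> = top \<or> (\<exists>k k'. \<kappa> = ennreal k \<and> 0 \<le> k \<and> k < k' \<and> C' < \<sigma> (ennreal k'))" by blast
  have "((\<lambda>g. g * (g * C)) \<longlongrightarrow> 1 * (1 * C)) (at_right 1)" by (intro tendsto_intros)
  then have "\<forall>\<^sub>F g in at_right 1. g * (g * C) < (C + C') / 2" by (rule order_tendstoD) (use C' in simp)
  then obtain g where g: "g > 1" "g * (g * C) < (C + C') / 2" by (rule eventually_at_right_obtain)
  have e: "(C' - C) / 2 > 0" using C' by simp
  obtain n s wlow where s: "0 < s" "2 * s < n"
    and wpos: "wlow > 0" and wlow': "\<forall>x\<in>{level n s..level n (n - s)}. wlow \<le> W x"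
    and wj': "\<forall>j\<in>{s..<n - s}. \<forall>x\<in>{level n j..level n (Suc j)}. slot_max W n j \<le> g * W x"
    and ec: "end_cost n s < (C' - C) / 2"
    by (rule choose_slots[OF g(1) e]) (rule that; assumption)
  note wlow = wpos wlow'[rule_format] and wj = wj'[rule_format]
  have "g * (g * C) + end_cost n s < (C + C') / 2 + (C' - C) / 2" by (rule add_strict_mono[OF g(2) ec])
  also have "\<dots> = C'" by (simp add: field_simps)
  finally have gC: "g * (g * C) + end_cost n s < C'" .
  obtain G where G': "finite G" "\<forall>m\<in>G. lo < m" "\<forall>y\<in>{lo..hi}. \<exists>m\<in>G. y \<le> m \<and> m \<le> g * y"
    by (rule geometric_grid[OF g(1)]) (rule that; assumption)
  have G: "finite G" "\<And>m. m \<in> G \<Longrightarrow> lo < m" "\<And>y. lo \<le> y \<Longrightarrow> y \<le> hi \<Longrightarrow> \<exists>m\<in>G. y \<le> m \<and> m \<le> g * y"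
    using G' by simp_all
  have n: "n > 0" using s by simp
  define L where "L = C / (lo * wlow)"
  have L: "L > 0" using C lo_pos wlow by (simp add: L_def)
  let ?N = "\<lambda>\<epsilon>. \<epsilon> / \<delta> \<epsilon>"
  have Ninf: "filterlim ?N at_top (at_right 0)" by (rule filterlim_ratio_at_top[OF dpos d0])
  have evA: "\<forall>\<^sub>F \<epsilon> in at_right 0. q ((A - B) / 2 / \<epsilon>) < level n s"
    by (rule order_tendstoD(2)[OF boundary_limits(1)[OF q_top q_bot AB]]) (use s in \<open>simp add: level_def\<close>)
  have "level n (n - s) < level n n"
    unfolding level_def using s by (intro add_strict_left_mono divide_strict_right_mono mult_strict_left_mono) auto
  then have "level n (n - s) < 1" using level_n[OF n] by simp
  from order_tendstoD(1)[OF boundary_limits(2)[OF q_top q_bot AB] this]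
  have evB: "\<forall>\<^sub>F \<epsilon> in at_right 0. level n (n - s) < q ((B - A) / 2 / \<epsilon>)" .
  define c0 where "c0 = 2 / ((real n)\<^sup>2 * C)"
  have c0: "c0 > 0" using n C by (simp add: c0_def)
  have "\<forall>\<^sub>F \<epsilon> in at_right 0. 2 * g / (g - 1) / c0 \<le> ?N \<epsilon>"
    using Ninf by (simp add: filterlim_at_top)
  then have evF: "\<forall>\<^sub>F \<epsilon> in at_right 0. ?N \<epsilon> * (2 / ((real n)\<^sup>2 * C)) \<ge> 2 * g / (g - 1)"
    unfolding c0_def[symmetric] by (rule eventually_mono) (rule pos_divide_le_eq[OF c0, THEN iffD1])
  have Nat: "C / (lo * wlow) * x + 1 \<le> real (nat \<lceil>L * x + 1\<rceil>)" for x unfolding L_def by linarith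
  show ?thesis
  proof (cases "\<kappa> = top")
    case True
    have "\<forall>\<^sub>F \<epsilon> in at_right 0. prob {\<omega> \<in> space M. surface_tension W q (\<lambda>z. \<Theta> z \<omega>) \<epsilon> (\<delta> \<epsilon>) 1 {A..B} < C} = 0"
      using ev_pos evA evB evF
    proof eventually_elim
      case (elim \<epsilon>)
      then have del: "\<delta> \<epsilon> > 0" using dpos by simp
      have "\<not> surface_tension W q (\<lambda>z. \<Theta> z \<omega>) \<epsilon> (\<delta> \<epsilon>) 1 {A..B} < C"
        if "\<omega> \<in> space M" "\<forall>z. lo \<le> \<Theta> z \<omega> \<and> \<Theta> z \<omega> \<le> hi" for \<omega>
      proof
        assume st: "surface_tension W q (\<lambda>z. \<Theta> z \<omega>) \<epsilon> (\<delta> \<epsilon>) 1 {A..B} < C"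
        have "\<exists>x. \<sigma> (ennreal x) \<le> g * (g * C) + end_cost n s"
          using low_energy_profile[OF elim(1) del AB s g(1) wlow wj elim(2,3) C(1) elim(4) G Nat that st]
          by blast
        then obtain x where "\<sigma> (ennreal x) \<le> g * (g * C) + end_cost n s" by blast
        moreover have "\<sigma> \<kappa> \<le> \<sigma> (ennreal x)" using True by (intro \<sigma>_antimono) simp
        ultimately show False using gC C' by linarith
      qed
      then have "AE \<omega> in M. \<omega> \<in> {\<omega> \<in> space M. surface_tension W q (\<lambda>z. \<Theta> z \<omega>) \<epsilon> (\<delta> \<epsilon>) 1 {A..B} < C} \<longrightarrow> \<omega> \<in> {}"
        using AE_bounds by (auto elim: eventually_mono)
      from finite_measure_mono_AE[OF this] show ?case by (simp add: measure_le_0_iff)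
    qed
    then show ?thesis by (rule tendsto_eventually)
  next
    case False
    then obtain k k' where k: "\<kappa> = ennreal k" "0 \<le> k" "k < k'" "C' < \<sigma> (ennreal k')" using fin by blast
    obtain k2 where k2: "k < k2" "k2 < k'" using dense[OF k(3)] by blast
    have "ennreal k < ennreal k2" using k k2 by (simp add: ennreal_less_iff)
    then have "\<forall>\<^sub>F \<epsilon> in at_right 0. ennreal (\<delta> \<epsilon> * \<bar>ln \<epsilon>\<bar> / \<epsilon>) < ennreal k2"
      using order_tendstoD(2)[OF dlim] k by simp
    then have evL: "\<forall>\<^sub>F \<epsilon> in at_right 0. \<bar>ln \<epsilon>\<bar> \<le> k2 * ?N \<epsilon>"
      using ev_pos
    proof eventually_elim
      case (elim \<epsilon>)
      then have "\<delta> \<epsilon> > 0" using dpos by simp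
      then have "\<delta> \<epsilon> * \<bar>ln \<epsilon>\<bar> / \<epsilon> < k2" using elim by (subst (asm) ennreal_less_iff) auto
      then show ?case using elim \<open>\<delta> \<epsilon> > 0\<close> by (simp add: field_simps)
    qed
    have ev1: "\<forall>\<^sub>F \<epsilon> in at_right (0::real). \<epsilon> < 1" by (rule eventually_at_right_less_bound)
    define d where "d = n - 2 * s"
    define c where "c = k' - k2"
    have c: "c > 0" using k2 by (simp add: c_def)
    define Cst where "Cst = (B - A + 4) * (L + 3) ^ (2 * d) * real (card G) ^ d"
    have Cst: "Cst \<ge> 0" using AB L by (simp add: Cst_def)
    have bound: "\<forall>\<^sub>F \<epsilon> in at_right 0. prob {\<omega> \<in> space M. surface_tension W q (\<lambda>z. \<Theta> z \<omega>) \<epsilon> (\<delta> \<epsilon>) 1 {A..B} < C}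
       \<le> Cst * ((?N \<epsilon> + 1) ^ (2 * d + 1) * exp (- (c * ?N \<epsilon>)))"
      using ev_pos ev1 evA evB evF evL
    proof eventually_elim
      case (elim \<epsilon>)
      then have del: "\<delta> \<epsilon> > 0" using dpos by simp
      let ?M = "nat \<lceil>L * ?N \<epsilon> + 1\<rceil>"
      have x: "?N \<epsilon> > 0" using elim del by simp
      have "prob {\<omega> \<in> space M. surface_tension W q (\<lambda>z. \<Theta> z \<omega>) \<epsilon> (\<delta> \<epsilon>) 1 {A..B} < C}
        \<le> ((B - A) / \<delta> \<epsilon> + 4) * real (?M + 1) ^ (2 * (n - 2 * s)) * real (card G) ^ (n - 2 * s) * exp (- (k' * ?N \<epsilon>))"
        by (rule prob_low_energy[OF elim(1) del AB s g(1) wlow wj elim(3,4) C(1) elim(5) G Nat]) (use k gC in auto)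
      also have "\<dots> \<le> ((B - A + 4) * ((?N \<epsilon> + 1) * exp (k2 * ?N \<epsilon>))) * ((L + 3) * (?N \<epsilon> + 1)) ^ (2 * d) * real (card G) ^ d * exp (- (k' * ?N \<epsilon>))"
        unfolding d_def[symmetric]
      proof (intro mult_right_mono mult_mono power_mono)
        have "1 / \<epsilon> = exp \<bar>ln \<epsilon>\<bar>" using elim(1,2) by (simp add: exp_minus inverse_eq_divide)
        also have "\<dots> \<le> exp (k2 * ?N \<epsilon>)" using elim(6) by simp
        finally have e1: "1 / \<epsilon> \<le> exp (k2 * ?N \<epsilon>)" .
        have "(B - A) / \<delta> \<epsilon> = (B - A) * (?N \<epsilon> * (1 / \<epsilon>))" using elim(1) by simp
        also have "\<dots> \<le> (B - A) * ((?N \<epsilon> + 1) * exp (k2 * ?N \<epsilon>))"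
          using e1 x AB elim(1) by (intro mult_left_mono mult_mono) auto
        finally have 1: "(B - A) / \<delta> \<epsilon> \<le> (B - A) * ((?N \<epsilon> + 1) * exp (k2 * ?N \<epsilon>))" .
        have "1 * 1 \<le> (?N \<epsilon> + 1) * exp (k2 * ?N \<epsilon>)" 
        proof (rule mult_mono)
          have "0 \<le> k2 * ?N \<epsilon>" using x k k2 by (intro mult_nonneg_nonneg) linarith+
          then show "1 \<le> exp (k2 * ?N \<epsilon>)" by (simp only: one_le_exp_iff)
        qed (use x in simp_all)
        then have "4 \<le> 4 * ((?N \<epsilon> + 1) * exp (k2 * ?N \<epsilon>))" by simp
        then show "(B - A) / \<delta> \<epsilon> + 4 \<le> (B - A + 4) * ((?N \<epsilon> + 1) * exp (k2 * ?N \<epsilon>))"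
          using 1 unfolding distrib_right[of "B - A"] by linarith
        have "real (?M + 1) \<le> L * ?N \<epsilon> + 3" 
        proof -
          have "0 \<le> L * ?N \<epsilon>" using L x by (intro mult_nonneg_nonneg) linarith+
          then show ?thesis unfolding of_nat_add by linarith
        qed
        also have "\<dots> \<le> (L + 3) * (?N \<epsilon> + 1)"
        proof -
          have "(L + 3) * (y + 1) = L * y + L + 3 * y + 3" for y :: real by (simp add: algebra_simps)
          then show ?thesis using L x by simp
        qed
        finally show "real (?M + 1) \<le> (L + 3) * (?N \<epsilon> + 1)" .
      qed (use AB L x in auto)
      also have "\<dots> = Cst * ((?N \<epsilon> + 1) ^ (2 * d + 1) * (exp (k2 * ?N \<epsilon>) * exp (- (k' * ?N \<epsilon>))))"
        unfolding Cst_def power_mult_distrib power_add power_one_right by (simp only: mult_ac)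
      also have "exp (k2 * ?N \<epsilon>) * exp (- (k' * ?N \<epsilon>)) = exp (- (c * ?N \<epsilon>))"
        unfolding exp_add[symmetric] c_def left_diff_distrib by (simp only: minus_diff_eq diff_conv_add_uminus minus_add_distrib minus_minus add.commute)
      finally show ?case .
    qed
    have "((\<lambda>\<epsilon>. Cst * ((?N \<epsilon> + 1) ^ (2 * d + 1) * exp (- (c * ?N \<epsilon>)))) \<longlongrightarrow> Cst * 0) (at_right 0)"
      by (rule tendsto_mult_left[OF filterlim_compose[OF poly_exp_tendsto_0[OF c] Ninf]])
    then have "((\<lambda>\<epsilon>. Cst * ((?N \<epsilon> + 1) ^ (2 * d + 1) * exp (- (c * ?N \<epsilon>)))) \<longlongrightarrow> 0) (at_right 0)" by simp
    from tendsto_sandwich[OF always_eventually[OF allI[OF measure_nonneg]] bound tendsto_const this] show ?thesis .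
  qed
qed

text \<open>For \<open>\<kappa> = 0\<close> take coefficients above the mean: a single window is good with probability tending to 1
  by the law of large numbers, while \<open>\<bar>ln \<epsilon>\<bar>\<close> is negligible compared with \<open>N\<close>. For \<open>\<kappa> > 0\<close> take a near-optimal profile of cost at most \<open>k < \<kappa>\<close>. A window is good with
  probability at least \<open>exp (- (k + c2) * N)\<close>, and the number of windows is of order
  \<open>1 / \<epsilon> \<ge> exp (k1 * N)\<close> with \<open>k1 > k + c2\<close>.\<close>

lemma tendsto_high_energy:
  assumes C: "\<sigma> \<kappa> < C"
  shows "((\<lambda>\<epsilon>. prob {\<omega> \<in> space M. surface_tension W q (\<lambda>z. \<Theta> z \<omega>) \<epsilon> (\<delta> \<epsilon>) 1 {A..B} > C}) \<longlongrightarrow> 0) (at_right 0)"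
proof -
  let ?N = "\<lambda>\<epsilon>. \<epsilon> / \<delta> \<epsilon>"
  have Ninf: "filterlim ?N at_top (at_right 0)" by (rule filterlim_ratio_at_top[OF dpos d0])
  have "\<exists>n h m. n > 0 \<and> (\<forall>j<n. 0 < h j \<and> lo < m j) \<and> profile_energy W n h m < C \<and>
     ((\<forall>j<n. mean < m j) \<or> (\<exists>k\<ge>0. ennreal k < \<kappa> \<and> (\<Sum>j<n. h j * rate (m j)) \<le> k))"
  proof (cases "\<kappa> = 0")
    case True
    have "((\<lambda>t. sqrt (mean + t) * (sigma_W W + t)) \<longlongrightarrow> sqrt mean * sigma_W W) (at_right 0)"
      by (auto intro!: tendsto_eq_intros)
    then have "\<forall>\<^sub>F t in at_right 0. sqrt (mean + t) * (sigma_W W + t) < C"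
      by (rule order_tendstoD) (use C \<sigma>_0 True in simp)
    then obtain t where t: "t > 0" "sqrt (mean + t) * (sigma_W W + t) < C" by (rule eventually_at_right_obtain)
    from upper_sum_close[OF t(1)] obtain n0 where "\<forall>n\<ge>n0. n > 0 \<longrightarrow> upper_sum n \<le> sigma_W W + t" by blast
    then have n0: "upper_sum (Suc n0) \<le> sigma_W W + t" by simp
    let ?n = "Suc n0"
    have "sqrt (mean + t) * upper_sum ?n \<le> sqrt (mean + t) * (sigma_W W + t)"
      using n0 t lo_pos lo_mean by (intro mult_left_mono) auto
    then have "profile_energy W ?n (best_width ?n (\<lambda>_. mean + t)) (\<lambda>_. mean + t) < C"
      using profile_above_mean(2)[of ?n t] t by simp
    moreover have "is_profile lo rate 0 ?n (best_width ?n (\<lambda>_. mean + t)) (\<lambda>_. mean + t)"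
      by (rule profile_above_mean(1)) (use t in auto)
    ultimately show ?thesis using t
      by (intro exI[of _ ?n] exI[of _ "best_width ?n (\<lambda>_. mean + t)"] exI[of _ "\<lambda>_. mean + t"]) (auto simp: is_profile_def)
  next
    case False
    then obtain k where k: "k \<ge> 0" "ennreal k < \<kappa>" "\<sigma> (ennreal k) < C"
      using \<sigma>_left_continuous[OF C] by (auto simp: zero_less_iff_neq_zero)
    from \<sigma>_less[OF k(3)] obtain n h m where p: "is_profile lo rate (ennreal k) n h m" "profile_energy W n h m < C" .
    then have "(\<Sum>j<n. h j * rate (m j)) \<le> k" using k by (simp add: is_profile_def)
    then show ?thesis using p k
      by (intro exI[of _ n] exI[of _ h] exI[of _ m]) (auto simp: is_profile_def)
  qed
  then obtain n h m where n: "n > 0" and h: "\<And>j. j < n \<Longrightarrow> 0 < h j" and m: "\<And>j. j < n \<Longrightarrow> lo < m j"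
    and E: "profile_energy W n h m < C"
    and cases: "(\<forall>j<n. mean < m j) \<or> (\<exists>k\<ge>0. ennreal k < \<kappa> \<and> (\<Sum>j<n. h j * rate (m j)) \<le> k)" by blast
  define H where "H = (\<Sum>j<n. h j)"
  have H: "H > 0" unfolding H_def using n h by (intro sum_pos) auto
  define r where "r \<epsilon> j = nat \<lfloor>h j * ?N \<epsilon>\<rfloor>" for \<epsilon> j
  have rle: "real (r \<epsilon> j) \<le> h j * ?N \<epsilon>" if "j < n" "\<epsilon> > 0" for \<epsilon> j
  proof -
    have "0 < \<delta> \<epsilon>" using that dpos by simp
    then have "0 \<le> h j * ?N \<epsilon>" using that h[OF that(1)] by simp
    then show ?thesis unfolding r_def by linarith
  qed
  have rge: "h j * ?N \<epsilon> - 1 \<le> real (r \<epsilon> j)" for \<epsilon> j unfolding r_def by linarith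
  have rinf: "filterlim (\<lambda>\<epsilon>. r \<epsilon> j) at_top (at_right 0)" if "j < n" for j
  proof -
    have "filterlim (\<lambda>\<epsilon>. h j * ?N \<epsilon>) at_top (at_right 0)"
      by (rule filterlim_tendsto_pos_mult_at_top[OF tendsto_const h[OF that] Ninf])
    then have "filterlim (\<lambda>\<epsilon>. -1 + h j * ?N \<epsilon>) at_top (at_right 0)"
      by (rule filterlim_tendsto_add_at_top[OF tendsto_const])
    then have "filterlim (\<lambda>\<epsilon>. real (r \<epsilon> j)) at_top (at_right 0)"
      by (rule filterlim_at_top_mono) (use rge[of j] in \<open>auto intro!: always_eventually simp: algebra_simps\<close>)
    then show ?thesis by (simp add: filterlim_sequentially_iff_filterlim_real)
  qed
  have rlim: "((\<lambda>\<epsilon>. real (r \<epsilon> j) * \<delta> \<epsilon> / \<epsilon>) \<longlongrightarrow> h j) (at_right 0)" if j: "j < n" for j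
  proof (rule tendsto_sandwich)
    show "((\<lambda>\<epsilon>. h j - \<delta> \<epsilon> / \<epsilon>) \<longlongrightarrow> h j) (at_right 0)" using tendsto_diff[OF tendsto_const d0, of "h j"] by simp
    show "\<forall>\<^sub>F \<epsilon> in at_right 0. h j - \<delta> \<epsilon> / \<epsilon> \<le> real (r \<epsilon> j) * \<delta> \<epsilon> / \<epsilon>"
      using ev_pos
    proof eventually_elim
      case (elim \<epsilon>)
      then have del: "\<delta> \<epsilon> > 0" using dpos by simp
      have "(h j * ?N \<epsilon> - 1) * (\<delta> \<epsilon> / \<epsilon>) \<le> real (r \<epsilon> j) * (\<delta> \<epsilon> / \<epsilon>)"
        using rge del elim by (intro mult_right_mono) auto
      moreover have "(h j * ?N \<epsilon> - 1) * (\<delta> \<epsilon> / \<epsilon>) = h j - \<delta> \<epsilon> / \<epsilon>"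
        using del elim by (simp add: left_diff_distrib del: times_divide_eq_right times_divide_eq_left) (simp add: field_simps)
      ultimately show ?case by simp
    qed
    show "\<forall>\<^sub>F \<epsilon> in at_right 0. real (r \<epsilon> j) * \<delta> \<epsilon> / \<epsilon> \<le> h j"
      using ev_pos
    proof eventually_elim
      case (elim \<epsilon>)
      then have del: "\<delta> \<epsilon> > 0" using dpos by simp
      have "real (r \<epsilon> j) * (\<delta> \<epsilon> / \<epsilon>) \<le> h j * ?N \<epsilon> * (\<delta> \<epsilon> / \<epsilon>)"
        using rle[OF j elim] del elim by (intro mult_right_mono) auto
      then show ?case using del elim by simp
    qed
  qed simp
  have Elim: "((\<lambda>\<epsilon>. profile_energy W n (\<lambda>j. real (r \<epsilon> j) * \<delta> \<epsilon> / \<epsilon>) m) \<longlongrightarrow> profile_energy W n h m) (at_right 0)"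
    unfolding profile_energy_def
  proof (intro tendsto_sum tendsto_add tendsto_divide tendsto_mult tendsto_const rlim)
    fix j assume "j \<in> {..<n}"
    then show "(real n)\<^sup>2 * h j \<noteq> 0" using h[of j] n by simp
  qed auto
  define e where "e = (C - profile_energy W n h m) / 2"
  have e: "e > 0" using E by (simp add: e_def)
  define V where "V = e / (2 * (2 * hi))"
  have hi: "hi > 0" using lo_pos lo_hi by simp
  have V: "V > 0" "2 * V * hi = e / 2" using e hi by (auto simp: V_def)
  have WV: "\<exists>d>0. \<forall>s. \<bar>s - x\<bar> < d \<longrightarrow> W s \<le> V" if "W x = 0" for x
  proof -
    have "isCont W x" using W_cont by (simp add: continuous_on_eq_continuous_at)
    then obtain d where "d > 0" "\<And>s. dist s x < d \<Longrightarrow> dist (W s) (W x) < V"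
      using V(1) unfolding continuous_at_eps_delta by blast
    then show ?thesis using that by (intro exI[of _ d]) (auto simp: dist_real_def abs_less_iff intro: less_imp_le)
  qed
  obtain dl where dl: "dl > 0" "\<And>s. \<bar>s - (-1)\<bar> < dl \<Longrightarrow> W s \<le> V" using WV[OF W_wells(1)] by blast
  obtain dr where dr: "dr > 0" "\<And>s. \<bar>s - 1\<bar> < dr \<Longrightarrow> W s \<le> V" using WV[OF W_wells(2)] by blast
  let ?p = "\<lambda>\<epsilon>. q ((A - B) / 2 / \<epsilon>)" and ?q = "\<lambda>\<epsilon>. q ((B - A) / 2 / \<epsilon>)"
  note lims = boundary_limits[OF q_top q_bot AB]
  have evl: "\<forall>\<^sub>F \<epsilon> in at_right 0. dist (?p \<epsilon>) (-1) < dl" using tendstoD[OF lims(1) dl(1)] .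
  have evr: "\<forall>\<^sub>F \<epsilon> in at_right 0. dist (?q \<epsilon>) 1 < dr" using tendstoD[OF lims(2) dr(1)] .
  have "((\<lambda>\<epsilon>. (1 + ?p \<epsilon>)\<^sup>2 / 2 + (1 - ?q \<epsilon>)\<^sup>2 / 2 + 2 * V * hi + profile_energy W n (\<lambda>j. real (r \<epsilon> j) * \<delta> \<epsilon> / \<epsilon>) m)
    \<longlongrightarrow> (1 + (-1))\<^sup>2 / 2 + (1 - 1)\<^sup>2 / 2 + 2 * V * hi + profile_energy W n h m) (at_right 0)"
    by (intro tendsto_intros lims Elim) auto
  then have evC: "\<forall>\<^sub>F \<epsilon> in at_right 0. (1 + ?p \<epsilon>)\<^sup>2 / 2 + (1 - ?q \<epsilon>)\<^sup>2 / 2 + 2 * V * hi + profile_energy W n (\<lambda>j. real (r \<epsilon> j) * \<delta> \<epsilon> / \<epsilon>) m < C"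
    by (rule order_tendstoD) (use V e in \<open>simp add: e_def\<close>)
  have dz: "(\<delta> \<longlongrightarrow> 0) (at_right 0)"
  proof -
    have "((\<lambda>\<epsilon>. \<epsilon> * (\<delta> \<epsilon> / \<epsilon>)) \<longlongrightarrow> 0 * 0) (at_right 0)" by (intro tendsto_mult d0 tendsto_ident_at)
    moreover have "\<forall>\<^sub>F \<epsilon> in at_right 0. \<epsilon> * (\<delta> \<epsilon> / \<epsilon>) = \<delta> \<epsilon>" using ev_pos by eventually_elim simp
    ultimately show ?thesis using tendsto_cong by fastforce
  qed
  \<comment> \<open>A window has length at most \<open>H * \<epsilon>\<close>, so the windows together occupy at most a quarter of the interval.\<close>
  define Q where "Q \<epsilon> = nat \<lfloor>(B - A) / (4 * H * \<epsilon>)\<rfloor>" for \<epsilon>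
  define z where "z \<epsilon> = \<lceil>(A + \<epsilon>) / \<delta> \<epsilon> + 1 / 2\<rceil> + 1" for \<epsilon>
  have "((\<lambda>\<epsilon>. 2 * \<epsilon> + 2 * \<delta> \<epsilon>) \<longlongrightarrow> 2 * 0 + 2 * 0) (at_right 0)" by (intro tendsto_intros dz)
  then have evs: "\<forall>\<^sub>F \<epsilon> in at_right 0. 2 * \<epsilon> + 2 * \<delta> \<epsilon> < (B - A) / 2"
    by (rule order_tendstoD) (use AB in simp)
  have evrp: "\<forall>\<^sub>F \<epsilon> in at_right 0. \<forall>j\<in>{..<n}. r \<epsilon> j > 0"
  proof (intro eventually_ball_finite ballI)
    fix j assume "j \<in> {..<n}"
    then have "\<forall>\<^sub>F \<epsilon> in at_right 0. 1 \<le> r \<epsilon> j" using rinf by (simp add: filterlim_at_top)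
    then show "\<forall>\<^sub>F \<epsilon> in at_right 0. r \<epsilon> j > 0" by (rule eventually_mono) simp
  qed simp
  have main: "\<forall>\<^sub>F \<epsilon> in at_right 0. prob {\<omega> \<in> space M. surface_tension W q (\<lambda>z. \<Theta> z \<omega>) \<epsilon> (\<delta> \<epsilon>) 1 {A..B} > C}
    \<le> (1 - (\<Prod>j<n. tail_prob (r \<epsilon> j) (m j))) ^ Q \<epsilon>"
    using ev_pos evl evr evC evs evrp
  proof eventually_elim
    case (elim \<epsilon>)
    then have del: "\<delta> \<epsilon> > 0" using dpos by simp
    have z: "(A + \<epsilon>) / \<delta> \<epsilon> < of_int (z \<epsilon>) - 1/2" "of_int (z \<epsilon>) - 1/2 < (A + \<epsilon>) / \<delta> \<epsilon> + 2" unfolding z_def by linarith+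
    have "real (offset (r \<epsilon>) n) = (\<Sum>j<n. real (r \<epsilon> j))" by (simp add: offset_def)
    also have "\<dots> \<le> (\<Sum>j<n. h j * ?N \<epsilon>)" using rle elim(1) by (intro sum_mono) auto
    also have "\<dots> = H * ?N \<epsilon>" unfolding H_def by (rule sum_distrib_right[symmetric])
    finally have R: "real (offset (r \<epsilon>) n) \<le> H * ?N \<epsilon>" .
    have Q: "real (Q \<epsilon>) \<le> (B - A) / (4 * H * \<epsilon>)"
    proof -
      have "0 \<le> (B - A) / (4 * H * \<epsilon>)" using AB H elim(1) by simp
      then show ?thesis unfolding Q_def by linarith
    qed
    have "real (Q \<epsilon> * offset (r \<epsilon>) n) \<le> (B - A) / (4 * H * \<epsilon>) * (H * ?N \<epsilon>)"
      unfolding of_nat_mult using Q R by (intro mult_mono) auto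
    also have "\<dots> = (B - A) / 4 / \<delta> \<epsilon>" using H elim(1) by simp
    finally have QR: "\<delta> \<epsilon> * real (Q \<epsilon> * offset (r \<epsilon>) n) \<le> (B - A) / 4" using del by (simp add: pos_le_divide_eq mult.commute)
    show ?case
    proof (rule prob_high_energy[OF elim(1) del n _ AB _ _ less_imp_le[OF V(1)]])
      show "A + \<epsilon> < \<delta> \<epsilon> * (of_int (z \<epsilon>) - 1/2)" using z(1) del by (simp add: pos_divide_less_eq mult.commute)
      have "\<delta> \<epsilon> * (of_int (z \<epsilon>) - 1/2) < \<delta> \<epsilon> * ((A + \<epsilon>) / \<delta> \<epsilon> + 2)" using z(2) del by (intro mult_strict_left_mono) auto
      also have "\<dots> = A + \<epsilon> + 2 * \<delta> \<epsilon>"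
        unfolding distrib_left[of "\<delta> \<epsilon>" "(A + \<epsilon>) / \<delta> \<epsilon>" 2] using del by simp
      finally have "\<delta> \<epsilon> * (of_int (z \<epsilon>) - 1/2) < A + \<epsilon> + 2 * \<delta> \<epsilon>" .
      moreover have "\<delta> \<epsilon> * (of_int (z \<epsilon> + int (Q \<epsilon> * offset (r \<epsilon>) n)) - 1/2) = \<delta> \<epsilon> * (of_int (z \<epsilon>) - 1/2) + \<delta> \<epsilon> * real (Q \<epsilon> * offset (r \<epsilon>) n)"
        by (simp add: algebra_simps)
      moreover have "X + Y < B - \<epsilon>" if "X < A + \<epsilon> + 2 * \<delta> \<epsilon>" "Y \<le> (B - A) / 4" for X Y
        using that elim(5) AB by argo
      ultimately show "\<delta> \<epsilon> * (of_int (z \<epsilon> + int (Q \<epsilon> * offset (r \<epsilon>) n)) - 1/2) < B - \<epsilon>"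
        using QR by (simp only:)
      show "W s \<le> V" if "s \<in> closed_segment (?p \<epsilon>) (-1)" for s
      proof (rule dl(2))
        have "\<bar>s - (-1)\<bar> \<le> \<bar>?p \<epsilon> - (-1)\<bar>" using that by (auto simp: closed_segment_eq_real_ivl split: if_splits)
        then show "\<bar>s - (-1)\<bar> < dl" using elim(2) by (simp add: dist_real_def)
      qed
      show "W s \<le> V" if "s \<in> closed_segment 1 (?q \<epsilon>)" for s
      proof (rule dr(2))
        have "\<bar>s - 1\<bar> \<le> \<bar>?q \<epsilon> - 1\<bar>" using that by (auto simp: closed_segment_eq_real_ivl split: if_splits)
        then show "\<bar>s - 1\<bar> < dr" using elim(3) by (simp add: dist_real_def)
      qed
      show "0 < r \<epsilon> j" if "j < n" for j using elim(6) that by simp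
    qed (use elim(4) in linarith)
  qed
  let ?P = "\<lambda>\<epsilon>. \<Prod>j<n. tail_prob (r \<epsilon> j) (m j)"
  have P01: "0 \<le> ?P \<epsilon>" "?P \<epsilon> \<le> 1" for \<epsilon>
    using tail_prob_nonneg tail_prob_le_1 by (auto intro!: prod_nonneg prod_le_1)
  have Qge: "\<forall>\<^sub>F \<epsilon> in at_right 0. (B - A) / (8 * H) / \<epsilon> \<le> real (Q \<epsilon>)"
  proof -
    have "((\<lambda>\<epsilon>. \<epsilon>) \<longlongrightarrow> 0) (at_right (0::real))" by (rule tendsto_ident_at)
    then have "\<forall>\<^sub>F \<epsilon> in at_right 0. \<epsilon> < (B - A) / (8 * H)" by (rule order_tendstoD) (use AB H in simp)
    then show ?thesis using ev_pos
    proof eventually_elim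
      case (elim \<epsilon>)
      have "1 \<le> (B - A) / (8 * H) / \<epsilon>"
        unfolding le_divide_eq_1_pos[OF elim(2)] by (rule less_imp_le[OF elim(1)])
      moreover have "X / (4 * H * \<epsilon>) = 2 * (X / (8 * H) / \<epsilon>)" for X using elim H by (simp add: field_simps)
      note this[of "B - A"]
      ultimately show ?case unfolding Q_def by linarith
    qed
  qed
  have lim0: "((\<lambda>\<epsilon>. (1 - ?P \<epsilon>) ^ Q \<epsilon>) \<longlongrightarrow> 0) (at_right 0)"
  proof (cases "\<forall>j<n. mean < m j")
    case True
    have "((\<lambda>\<epsilon>. tail_prob (r \<epsilon> j) (m j)) \<longlongrightarrow> 1) (at_right 0)" if "j < n" for j
      using filterlim_compose[OF tail_prob_tendsto_1 rinf[OF that]] True that by simp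
    then have "((\<lambda>\<epsilon>. 1 - ?P \<epsilon>) \<longlongrightarrow> 1 - (\<Prod>j<n. 1)) (at_right 0)" by (intro tendsto_intros) auto
    then have t0: "((\<lambda>\<epsilon>. 1 - ?P \<epsilon>) \<longlongrightarrow> 0) (at_right 0)" by simp
    have "\<forall>\<^sub>F \<epsilon> in at_right 0. (1 - ?P \<epsilon>) ^ Q \<epsilon> \<le> 1 - ?P \<epsilon>"
      using Qge ev_pos
    proof eventually_elim
      case (elim \<epsilon>)
      have "0 < (B - A) / (8 * H) / \<epsilon>" using AB H elim by simp
      then have "Q \<epsilon> \<ge> 1" using elim(1) by (cases "Q \<epsilon>") auto
      then have "(1 - ?P \<epsilon>) ^ Q \<epsilon> \<le> (1 - ?P \<epsilon>) ^ 1" using P01[of \<epsilon>] by (intro power_decreasing) auto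
      then show ?case by simp
    qed
    then show ?thesis using P01 by (intro tendsto_sandwich[OF _ _ tendsto_const t0]) (auto intro!: always_eventually)
  next
    case False
    then obtain k where k: "k \<ge> 0" "ennreal k < \<kappa>" "(\<Sum>j<n. h j * rate (m j)) \<le> k" using cases by blast
    obtain k1 where k1: "k < k1" "ennreal k1 < \<kappa>"
    proof -
      obtain x where x: "ennreal k < x" "x < \<kappa>" using dense[OF k(2)] by blast
      then obtain k1 where "x = ennreal k1" "k1 \<ge> 0" by (cases x) auto
      then show ?thesis using x that[of k1] k by (simp add: ennreal_less_iff)
    qed
    \<comment> \<open>Chosen so that an error \<open>e0\<close> in every rate uses up half of the gap between \<open>k\<close> and \<open>k1\<close>.\<close>
    define e0 where "e0 = (k1 - k) / (2 * H)"
    have e0: "e0 > 0" using k1 H by (simp add: e0_def)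
    have evk: "\<forall>\<^sub>F \<epsilon> in at_right 0. k1 * ?N \<epsilon> \<le> \<bar>ln \<epsilon>\<bar>"
      using order_tendstoD(1)[OF dlim k1(2)] ev_pos
    proof eventually_elim
      case (elim \<epsilon>)
      then have "\<delta> \<epsilon> > 0" using dpos by simp
      then have "k1 < \<delta> \<epsilon> * \<bar>ln \<epsilon>\<bar> / \<epsilon>" using elim k k1 by (subst (asm) ennreal_less_iff) auto
      then show ?case using elim \<open>\<delta> \<epsilon> > 0\<close> by (simp add: field_simps)
    qed
    have evt: "\<forall>\<^sub>F \<epsilon> in at_right 0. \<forall>j\<in>{..<n}. exp (- real (r \<epsilon> j) * (rate (m j) + e0)) \<le> tail_prob (r \<epsilon> j) (m j)"
    proof (intro eventually_ball_finite ballI)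
      fix j assume "j \<in> {..<n}"
      then have j: "j < n" by simp
      obtain R where R: "\<And>r. r \<ge> R \<Longrightarrow> tail_prob r (m j) \<ge> exp (- real r * (rate (m j) + e0))"
        using tail_prob_lower[OF m[OF j] e0] by blast
      have "\<forall>\<^sub>F \<epsilon> in at_right 0. R \<le> r \<epsilon> j" using rinf[OF j] by (simp add: filterlim_at_top)
      then show "\<forall>\<^sub>F \<epsilon> in at_right 0. exp (- real (r \<epsilon> j) * (rate (m j) + e0)) \<le> tail_prob (r \<epsilon> j) (m j)"
        by (rule eventually_mono) (rule R)
    qed simp
    define c1 where "c1 = (B - A) / (8 * H)"
    have c1: "c1 > 0" using AB H by (simp add: c1_def)
    define c2 where "c2 = (k1 - k) / 2"
    have c2: "c2 > 0" using k1 by (simp add: c2_def)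
    have ev1: "\<forall>\<^sub>F \<epsilon> in at_right (0::real). \<epsilon> < 1" by (rule eventually_at_right_less_bound)
    have up: "\<forall>\<^sub>F \<epsilon> in at_right 0. (1 - ?P \<epsilon>) ^ Q \<epsilon> \<le> exp (- (c1 * exp (c2 * ?N \<epsilon>)))"
      using ev_pos ev1 Qge evk evt
    proof eventually_elim
      case (elim \<epsilon>)
      then have del: "\<delta> \<epsilon> > 0" using dpos by simp
      have "exp (- (k + c2) * ?N \<epsilon>) \<le> exp (\<Sum>j<n. - (h j * ?N \<epsilon>) * (rate (m j) + e0))"
      proof -
        have "(\<Sum>j<n. (h j * x) * (rate (m j) + e0)) = x * ((\<Sum>j<n. h j * rate (m j)) + e0 * H)" for x
          by (simp add: H_def sum.distrib sum_distrib_left distrib_left mult_ac)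
        then have "(\<Sum>j<n. (h j * ?N \<epsilon>) * (rate (m j) + e0)) = ?N \<epsilon> * ((\<Sum>j<n. h j * rate (m j)) + e0 * H)" .
        also have "e0 * H = c2" using H by (simp add: e0_def c2_def)
        also have "?N \<epsilon> * ((\<Sum>j<n. h j * rate (m j)) + c2) \<le> ?N \<epsilon> * (k + c2)"
          using k(3) del elim(1) by (intro mult_left_mono) auto
        finally have le: "(\<Sum>j<n. (h j * ?N \<epsilon>) * (rate (m j) + e0)) \<le> ?N \<epsilon> * (k + c2)" .
        have 1: "(\<Sum>j<n. - (h j * ?N \<epsilon>) * (rate (m j) + e0)) = - (\<Sum>j<n. (h j * ?N \<epsilon>) * (rate (m j) + e0))"
          unfolding mult_minus_left by (rule sum_negf)
        have 2: "- (k + c2) * x = - (x * (k + c2))" for x by (simp add: algebra_simps)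
        show ?thesis unfolding 1 2 exp_le_cancel_iff neg_le_iff_le by (rule le)
      qed
      also have "\<dots> = (\<Prod>j<n. exp (- (h j * ?N \<epsilon>) * (rate (m j) + e0)))" by (simp add: exp_sum)
      also have "\<dots> \<le> ?P \<epsilon>"
      proof (rule prod_mono)
        fix j assume "j \<in> {..<n}"
        then have j: "j < n" by simp
        have "real (r \<epsilon> j) * (rate (m j) + e0) \<le> (h j * ?N \<epsilon>) * (rate (m j) + e0)"
          using rle[OF j elim(1)] rate_nonneg[OF m[OF j]] e0 by (intro mult_right_mono) auto
        then have X: "exp (- (h j * ?N \<epsilon>) * (rate (m j) + e0)) \<le> exp (- real (r \<epsilon> j) * (rate (m j) + e0))" by simp
        then show "0 \<le> exp (- (h j * ?N \<epsilon>) * (rate (m j) + e0)) \<and> exp (- (h j * ?N \<epsilon>) * (rate (m j) + e0)) \<le> tail_prob (r \<epsilon> j) (m j)"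
          by (intro conjI exp_ge_zero order_trans[OF X bspec[OF elim(5)]]) (use j in simp)
      qed
      finally have P: "exp (- (k + c2) * ?N \<epsilon>) \<le> ?P \<epsilon>" .
      have "exp (k1 * ?N \<epsilon>) \<le> exp \<bar>ln \<epsilon>\<bar>" using elim(4) by simp
      also have "\<dots> = 1 / \<epsilon>" using elim(1,2) by (simp add: exp_minus inverse_eq_divide)
      finally have "c1 * exp (k1 * ?N \<epsilon>) \<le> c1 * (1 / \<epsilon>)" using c1 by (intro mult_left_mono) auto
      also have "\<dots> \<le> real (Q \<epsilon>)" using elim(3) by (simp add: c1_def)
      finally have "c1 * exp (k1 * ?N \<epsilon>) * exp (- (k + c2) * ?N \<epsilon>) \<le> real (Q \<epsilon>) * ?P \<epsilon>"
        using P c1 by (intro mult_mono) auto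
      moreover have "c1 * exp (k1 * ?N \<epsilon>) * exp (- (k + c2) * ?N \<epsilon>) = c1 * exp (c2 * ?N \<epsilon>)"
      proof -
        have "k1 * x + - (k + c2) * x = c2 * x" for x by (simp add: c2_def field_simps)
        then show ?thesis by (simp only: mult.assoc exp_add[symmetric])
      qed
      ultimately have QP: "c1 * exp (c2 * ?N \<epsilon>) \<le> real (Q \<epsilon>) * ?P \<epsilon>" by (simp only:)
      have "1 - ?P \<epsilon> \<le> exp (- ?P \<epsilon>)" using exp_ge_add_one_self[of "- ?P \<epsilon>"] by simp
      then have "(1 - ?P \<epsilon>) ^ Q \<epsilon> \<le> exp (- ?P \<epsilon>) ^ Q \<epsilon>" using P01[of \<epsilon>] by (intro power_mono) auto
      also have "\<dots> = exp (- (real (Q \<epsilon>) * ?P \<epsilon>))" by (simp add: exp_of_nat_mult[symmetric])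
      also have "\<dots> \<le> exp (- (c1 * exp (c2 * ?N \<epsilon>)))" using QP by simp
      finally show ?case .
    qed
    have lim: "((\<lambda>\<epsilon>. exp (- (c1 * exp (c2 * ?N \<epsilon>)))) \<longlongrightarrow> 0) (at_right 0)"
    proof -
      have "((\<lambda>x. exp (- (c1 * exp (c2 * x)))) \<longlongrightarrow> 0) at_top" using c1 c2 by real_asymp
      from filterlim_compose[OF this Ninf] show ?thesis .
    qed
    have "0 \<le> (1 - ?P \<epsilon>) ^ Q \<epsilon>" for \<epsilon> using P01[of \<epsilon>] by simp
    from tendsto_sandwich[OF always_eventually[OF allI[OF this]] up tendsto_const lim] show ?thesis .
  qed
  show ?thesis
    by (rule tendsto_sandwich[OF always_eventually[OF allI[OF measure_nonneg]] main tendsto_const lim0])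
qed

end

end

section \<open>Reflection and the limit theorem\<close>

lemma energy_reflect:
  assumes "u \<in> H1 {A..B}" "continuous_on UNIV W" "\<delta> > 0"
  shows "energy (\<lambda>s. W (- s)) \<theta> \<epsilon> \<delta> {A..B} (\<lambda>x. - u x) = energy W \<theta> \<epsilon> \<delta> {A..B} u"
proof -
  have v: "has_L2_weak_deriv {A<..<B} u (weak_deriv {A..B} u)"
    using has_L2_weak_deriv_weak_deriv[OF assms(1)] by simp
  have "continuous_on UNIV (\<lambda>s. W (- s))"
    by (rule continuous_on_compose2[OF assms(2)]) (auto intro!: continuous_intros)
  from energy_eq_weak_deriv[OF H1_uminus[OF assms(1)] has_L2_weak_deriv_uminus[OF v] this assms(3)]
    energy_eq_weak_deriv[OF assms(1) v assms(2,3)]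
  show ?thesis by simp
qed

text \<open>The map from \<open>u\<close> to \<open>- u\<close> exchanges the two orientations and turns \<open>W\<close> into its mirror image.\<close>

lemma surface_tension_reflect:
  assumes "A < B" "continuous_on UNIV W" "\<delta> > 0"
  shows "surface_tension W q \<theta> \<epsilon> \<delta> (-1) {A..B}
    = surface_tension (\<lambda>s. W (- s)) (\<lambda>s. - q (- s)) \<theta> \<epsilon> \<delta> 1 {A..B}"
proof -
  let ?q = "\<lambda>s. - q (- s)" and ?W = "\<lambda>s. W (- s)"
  have I: "interior {A..B} = {A<..<B}" "closure {A..B} = {A..B}" "frontier {A..B} = {A, B}"
    "{A<..<B} \<subseteq> {A..B}" "{A..B} \<subseteq> {A..B}" "midpoint_of {A..B} = (A + B) / 2"
    using assms(1) by (auto simp: frontier_def midpoint_of_def)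
  have a1: "admissible q \<epsilon> (-1) {A..B} = {u \<in> H1 {A..B}. u A = q ((A - B) / 2 * -1 / \<epsilon>) \<and> u B = q ((B - A) / 2 * -1 / \<epsilon>)}"
    by (rule surface_tension_interval(2)[OF I assms(1)])
  have a2: "admissible ?q \<epsilon> 1 {A..B} = {u \<in> H1 {A..B}. u A = ?q ((A - B) / 2 / \<epsilon>) \<and> u B = ?q ((B - A) / 2 / \<epsilon>)}"
    by (rule admissible_interval[OF assms(1)])
  have "energy W \<theta> \<epsilon> \<delta> {A..B} ` admissible q \<epsilon> (-1) {A..B} = energy ?W \<theta> \<epsilon> \<delta> {A..B} ` admissible ?q \<epsilon> 1 {A..B}"
  proof (intro equalityI subsetI)
    fix y assume "y \<in> energy W \<theta> \<epsilon> \<delta> {A..B} ` admissible q \<epsilon> (-1) {A..B}"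
    then obtain u where u: "u \<in> admissible q \<epsilon> (-1) {A..B}" "y = energy W \<theta> \<epsilon> \<delta> {A..B} u" by blast
    then have "u \<in> H1 {A..B}" by (simp add: a1)
    moreover from this have "(\<lambda>x. - u x) \<in> admissible ?q \<epsilon> 1 {A..B}"
      using u(1) H1_uminus by (simp add: a1 a2)
    ultimately show "y \<in> energy ?W \<theta> \<epsilon> \<delta> {A..B} ` admissible ?q \<epsilon> 1 {A..B}"
      using u(2) energy_reflect[of u A B W \<delta> \<theta> \<epsilon>] assms by (intro image_eqI[of _ _ "\<lambda>x. - u x"]) simp_all
  next
    fix y assume "y \<in> energy ?W \<theta> \<epsilon> \<delta> {A..B} ` admissible ?q \<epsilon> 1 {A..B}"
    then obtain u where u: "u \<in> admissible ?q \<epsilon> 1 {A..B}" "y = energy ?W \<theta> \<epsilon> \<delta> {A..B} u" by blast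
    then have H: "u \<in> H1 {A..B}" by (simp add: a2)
    have "(\<lambda>x. - u x) \<in> admissible q \<epsilon> (-1) {A..B}"
      using u(1) H1_uminus[OF H] by (simp add: a1 a2)
    moreover have "y = energy W \<theta> \<epsilon> \<delta> {A..B} (\<lambda>x. - u x)"
      using u(2) energy_reflect[OF H1_uminus[OF H] assms(2,3), of \<theta> \<epsilon>] by simp
    ultimately show "y \<in> energy W \<theta> \<epsilon> \<delta> {A..B} ` admissible q \<epsilon> (-1) {A..B}" by blast
  qed
  then show ?thesis by (simp add: surface_tension_def)
qed

lemma level_reflect: "n > 0 \<Longrightarrow> j \<le> n \<Longrightarrow> level n (n - j) = - level n j"
  by (simp add: level_def of_nat_diff field_simps)

lemma slot_max_reflect:
  assumes "j < n"
  shows "slot_max (\<lambda>s. W (- s)) n j = slot_max W n (n - Suc j)"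
proof -
  have "n - j = Suc (n - Suc j)" using assms by simp
  then have "{- level n (Suc j)..- level n j} = {level n (n - Suc j)..level n (Suc (n - Suc j))}"
    using level_reflect[of n j] level_reflect[of n "Suc j"] assms by simp
  moreover have "(\<lambda>s. W (- s)) ` {level n j..level n (Suc j)} = W ` {- level n (Suc j)..- level n j}"
    by (simp only: image_image[of W uminus, symmetric] image_uminus_atLeastAtMost)
  ultimately show ?thesis unfolding slot_max_def by (simp only:)
qed

lemma profile_reflect:
  assumes "is_profile lo J \<kappa> n h m"
  shows "is_profile lo J \<kappa> n (\<lambda>j. h (n - Suc j)) (\<lambda>j. m (n - Suc j))"
    and "profile_energy (\<lambda>s. W (- s)) n (\<lambda>j. h (n - Suc j)) (\<lambda>j. m (n - Suc j)) = profile_energy W n h m"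
proof -
  have "(\<Sum>j<n. h (n - Suc j) * J (m (n - Suc j))) = (\<Sum>j<n. h j * J (m j))"
    by (rule sum.nat_diff_reindex)
  then show "is_profile lo J \<kappa> n (\<lambda>j. h (n - Suc j)) (\<lambda>j. m (n - Suc j))"
    using assms by (auto simp: is_profile_def)
  have "profile_energy (\<lambda>s. W (- s)) n (\<lambda>j. h (n - Suc j)) (\<lambda>j. m (n - Suc j))
    = (\<Sum>j<n. 2 / ((real n)\<^sup>2 * h (n - Suc j)) + h (n - Suc j) * m (n - Suc j) * slot_max W n (n - Suc j))"
    unfolding profile_energy_def by (rule sum.cong) (auto simp: slot_max_reflect)
  also have "\<dots> = profile_energy W n h m"
    unfolding profile_energy_def by (rule sum.nat_diff_reindex)
  finally show "profile_energy (\<lambda>s. W (- s)) n (\<lambda>j. h (n - Suc j)) (\<lambda>j. m (n - Suc j)) = profile_energy W n h m" .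
qed

text \<open>Reversing the order of the slots maps profiles for \<open>W\<close> to profiles for its mirror image.\<close>

lemma check_sigma_reflect: "check_sigma (\<lambda>s. W (- s)) lo J \<kappa> = check_sigma W lo J \<kappa>"
proof -
  have sub: "{profile_energy W n h m | n h m. is_profile lo J \<kappa> n h m}
    \<subseteq> {profile_energy (\<lambda>s. W (- s)) n h m | n h m. is_profile lo J \<kappa> n h m}" for W :: "real \<Rightarrow> real"
  proof
    fix y assume "y \<in> {profile_energy W n h m | n h m. is_profile lo J \<kappa> n h m}"
    then obtain n h m where p: "is_profile lo J \<kappa> n h m" "y = profile_energy W n h m" by blast
    show "y \<in> {profile_energy (\<lambda>s. W (- s)) n h m | n h m. is_profile lo J \<kappa> n h m}"
      unfolding p(2) profile_reflect(2)[OF p(1), of W, symmetric] using profile_reflect(1)[OF p(1)] by blast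
  qed
  show ?thesis
    unfolding check_sigma_def using sub[of W] sub[of "\<lambda>s. W (- s)"] by (intro arg_cong[of _ _ Inf] equalityI) simp_all
qed

lemma (in random_double_well) surface_tension_converges:
  fixes I :: "real set"
  assumes dpos: "\<forall>\<epsilon>>0. \<delta> \<epsilon> > 0" and d0: "((\<lambda>\<epsilon>. \<delta> \<epsilon> / \<epsilon>) \<longlongrightarrow> 0) (at_right 0)"
    and dlim: "((\<lambda>\<epsilon>. ennreal (\<delta> \<epsilon> * \<bar>ln \<epsilon>\<bar> / \<epsilon>)) \<longlongrightarrow> \<kappa>) (at_right 0)"
    and AB: "A < B" and q: "(q \<longlongrightarrow> 1) at_top" "(q \<longlongrightarrow> -1) at_bot"
  shows "tendsto_in_probability M (\<lambda>\<epsilon> \<omega>. surface_tension W q (\<lambda>z. \<Theta> z \<omega>) \<epsilon> (\<delta> \<epsilon>) 1 {A..B}) (\<sigma> \<kappa>) (at_right 0)"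
  unfolding tendsto_in_probability_def
proof (intro conjI allI impI)
  let ?X = "\<lambda>\<epsilon> \<omega>. surface_tension W q (\<lambda>z. \<Theta> z \<omega>) \<epsilon> (\<delta> \<epsilon>) 1 {A..B}"
  have meas: "\<forall>\<^sub>F \<epsilon> in at_right 0. ?X \<epsilon> \<in> borel_measurable M"
    using eventually_at_right_less[of "0::real"]
  proof eventually_elim
    case (elim \<epsilon>)
    show ?case
      by (rule borel_measurable_surface_tension[OF _ W_cont measurable_\<Theta>]) (use elim dpos in simp)
  qed
  then show "\<forall>\<^sub>F \<epsilon> in at_right 0. ?X \<epsilon> \<in> borel_measurable M" .
  fix \<eta> :: real assume \<eta>: "\<eta> > 0"
  define C where "C = max (\<sigma> \<kappa> - \<eta>) (\<sigma> \<kappa> / 2)"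
  have C: "0 < C" "C < \<sigma> \<kappa>" "\<sigma> \<kappa> - \<eta> \<le> C" using \<sigma>_pos[of \<kappa>] \<eta> by (auto simp: C_def)
  have "\<sigma> \<kappa> < \<sigma> \<kappa> + \<eta>" using \<eta> by simp
  from tendsto_add[OF tendsto_low_energy[OF dpos d0 dlim AB q C(1,2)] tendsto_high_energy[OF dpos d0 dlim AB q this]]
  have lim: "((\<lambda>\<epsilon>. prob {\<omega> \<in> space M. ?X \<epsilon> \<omega> < C} + prob {\<omega> \<in> space M. ?X \<epsilon> \<omega> > \<sigma> \<kappa> + \<eta>}) \<longlongrightarrow> 0) (at_right 0)" by simp
  have "\<forall>\<^sub>F \<epsilon> in at_right 0. prob {\<omega> \<in> space M. \<bar>?X \<epsilon> \<omega> - \<sigma> \<kappa>\<bar> > \<eta>}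
     \<le> prob {\<omega> \<in> space M. ?X \<epsilon> \<omega> < C} + prob {\<omega> \<in> space M. ?X \<epsilon> \<omega> > \<sigma> \<kappa> + \<eta>}"
    using meas
  proof eventually_elim
    case (elim \<epsilon>)
    note [measurable] = elim
    have "prob {\<omega> \<in> space M. \<bar>?X \<epsilon> \<omega> - \<sigma> \<kappa>\<bar> > \<eta>}
      \<le> prob ({\<omega> \<in> space M. ?X \<epsilon> \<omega> < C} \<union> {\<omega> \<in> space M. ?X \<epsilon> \<omega> > \<sigma> \<kappa> + \<eta>})"
      by (rule finite_measure_mono) (use C(3) in auto)
    also have "\<dots> \<le> prob {\<omega> \<in> space M. ?X \<epsilon> \<omega> < C} + prob {\<omega> \<in> space M. ?X \<epsilon> \<omega> > \<sigma> \<kappa> + \<eta>}"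
      by (rule measure_Un_le) simp_all
    finally show ?case .
  qed
  from tendsto_sandwich[OF always_eventually[OF allI[OF measure_nonneg]] this tendsto_const lim]
  show "((\<lambda>\<epsilon>. prob {\<omega> \<in> space M. \<bar>?X \<epsilon> \<omega> - \<sigma> \<kappa>\<bar> > \<eta>}) \<longlongrightarrow> 0) (at_right 0)" .
qed

lemma tendsto_in_probability_cong:
  assumes "\<forall>\<^sub>F i in F. X i = Y i" "tendsto_in_probability M X c F"
  shows "tendsto_in_probability M Y c F"
  unfolding tendsto_in_probability_def
proof (intro conjI allI impI)
  have "\<forall>\<^sub>F i in F. X i \<in> borel_measurable M" using assms(2) by (simp add: tendsto_in_probability_def)
  with assms(1) show "\<forall>\<^sub>F i in F. Y i \<in> borel_measurable M" by eventually_elim simp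
  fix \<eta> :: real assume "\<eta> > 0"
  then have lim: "((\<lambda>i. measure M {\<omega> \<in> space M. \<bar>X i \<omega> - c\<bar> > \<eta>}) \<longlongrightarrow> 0) F"
    using assms(2) by (simp add: tendsto_in_probability_def)
  have "\<forall>\<^sub>F i in F. measure M {\<omega> \<in> space M. \<bar>X i \<omega> - c\<bar> > \<eta>} = measure M {\<omega> \<in> space M. \<bar>Y i \<omega> - c\<bar> > \<eta>}"
    using assms(1) by eventually_elim simp
  from Lim_transform_eventually[OF lim this]
  show "((\<lambda>i. measure M {\<omega> \<in> space M. \<bar>Y i \<omega> - c\<bar> > \<eta>}) \<longlongrightarrow> 0) F" .
qed

text \<open>Otherwise \<open>m\<close> would be an almost sure lower bound above the essential infimum.\<close>

lemma prob_le_pos_if_essinf_less: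
  assumes M: "prob_space M" and X: "X \<in> borel_measurable M" and "essinf M (\<lambda>\<omega>. ereal (X \<omega>)) < ereal m"
  shows "measure M {\<omega> \<in> space M. X \<omega> \<le> m} > 0"
proof (rule ccontr)
  interpret prob_space M by (rule M)
  assume "\<not> ?thesis"
  then have "prob {\<omega> \<in> space M. X \<omega> \<le> m} = 0" using measure_nonneg[of M "{\<omega> \<in> space M. X \<omega> \<le> m}"] by linarith
  then have "AE \<omega> in M. \<not> X \<omega> \<le> m" using X by (subst (asm) prob_eq_0) (auto elim: eventually_mono)
  then have "AE \<omega> in M. - ereal (X \<omega>) \<le> - ereal m" by (rule eventually_mono) simp
  then have "esssup M (\<lambda>\<omega>. - ereal (X \<omega>)) \<le> - ereal m" using X by (intro esssup_I) auto
  then have "ereal m \<le> essinf M (\<lambda>\<omega>. ereal (X \<omega>))" 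
    unfolding essinf_def by (simp only: ereal_minus_le_minus[symmetric, of _ "- ereal m"] ereal_uminus_uminus)
  then show False using assms(3) by simp
qed

lemma random_double_well_intro:
  fixes W :: "real \<Rightarrow> real" and M :: "'a measure" and \<Theta> :: "int \<Rightarrow> 'a \<Rightarrow> real" and lo hi :: real
  assumes W: "double_well W"
    and prob: "prob_space M"
    and indep: "prob_space.indep_vars M (\<lambda>_. borel) \<Theta> UNIV"
    and ident: "\<And>z. distr M borel (\<Theta> z) = distr M borel (\<Theta> 0)"
    and bounds: "\<And>z. AE \<omega> in M. lo \<le> \<Theta> z \<omega> \<and> \<Theta> z \<omega> \<le> hi"
    and nonconst: "\<not> (\<exists>c. AE \<omega> in M. \<Theta> 0 \<omega> = c)"
    and lo: "lo > 0"
    and ess_inf: "essinf M (\<lambda>\<omega>. ereal (\<Theta> 0 \<omega>)) = ereal lo"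
  shows "random_double_well W M \<Theta> lo hi"
proof -
  interpret prob_space M by (rule prob)
  have meas: "\<Theta> z \<in> borel_measurable M" for z using indep by (simp add: indep_vars_def)
  have "lo < hi"
  proof (rule ccontr)
    assume "\<not> lo < hi"
    then have "AE \<omega> in M. \<Theta> 0 \<omega> = lo" using bounds[of 0] by (auto elim: eventually_mono)
    then show False using nonconst by blast
  qed
  then interpret iid_bounded M \<Theta> lo hi
    by unfold_locales (use indep ident bounds lo prob_le_pos_if_essinf_less[OF prob meas] ess_inf in auto)
  have "lo < mean"
  proof (rule ccontr)
    assume "\<not> lo < mean"
    then have "expectation (\<lambda>\<omega>. \<Theta> 0 \<omega> - lo) = 0"
      using mean_bounds(1) integrable_\<Theta>[of 0] by (simp add: prob_space)
    moreover have "integrable M (\<lambda>\<omega>. \<Theta> 0 \<omega> - lo)" using integrable_\<Theta>[of 0] by simp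
    moreover have "AE \<omega> in M. 0 \<le> \<Theta> 0 \<omega> - lo" using bounds[of 0] by (auto elim: eventually_mono)
    ultimately have "AE \<omega> in M. \<Theta> 0 \<omega> - lo = 0" by (simp add: integral_nonneg_eq_0_iff_AE)
    then have "AE \<omega> in M. \<Theta> 0 \<omega> = lo" by (auto elim: eventually_mono)
    then show False using nonconst by blast
  qed
  then show ?thesis
    by (intro random_double_well.intro W iid_bounded_axioms random_double_well_axioms.intro)
qed

theorem theorem1:
  fixes W q :: "real \<Rightarrow> real"
    and M :: "'a measure"
    and \<Theta> :: "int \<Rightarrow> 'a \<Rightarrow> real"
    and \<theta>min \<theta>max \<theta>bar \<sigma>bar \<sigma>star :: real
  assumes W_cont: "continuous_on UNIV W"
    and W_nonneg: "\<And>s. W s \<ge> 0"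
    and W_zeros: "\<And>s. W s = 0 \<longleftrightarrow> s = -1 \<or> s = 1"
    and q_smooth: "smooth q"
    and q_range: "\<And>s. q s \<in> {-1..1}"
    and q_top: "(q \<longlongrightarrow> 1) at_top"
    and q_bot: "(q \<longlongrightarrow> -1) at_bot"
    and prob: "prob_space M"
    and indep: "prob_space.indep_vars M (\<lambda>_. borel) \<Theta> UNIV"
    and ident: "\<And>z. distr M borel (\<Theta> z) = distr M borel (\<Theta> 0)"
    and bounds: "\<And>z. AE \<omega> in M. \<theta>min \<le> \<Theta> z \<omega> \<and> \<Theta> z \<omega> \<le> \<theta>max"
    and nonconst: "\<not> (\<exists>c. AE \<omega> in M. \<Theta> 0 \<omega> = c)"
    and min_pos: "\<theta>min > 0"
    and ess_inf: "essinf M (\<lambda>\<omega>. ereal (\<Theta> 0 \<omega>)) = ereal \<theta>min"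
    and \<theta>bar: "\<theta>bar = prob_space.expectation M (\<Theta> 0)"
    and \<sigma>bar: "\<sigma>bar = sigma_W W * sqrt \<theta>bar"
    and \<sigma>star: "\<sigma>star = sigma_W W * sqrt \<theta>min"
  shows "\<exists>\<sigma> :: ennreal \<Rightarrow> real.
    antimono \<sigma> \<and> continuous_on UNIV \<sigma> \<and> range \<sigma> \<subseteq> {\<sigma>star..\<sigma>bar} \<and>
    (\<forall>(\<delta> :: real \<Rightarrow> real) (\<kappa> :: ennreal).
      (\<forall>\<epsilon>>0. \<delta> \<epsilon> > 0) \<longrightarrow>
      ((\<lambda>\<epsilon>. \<delta> \<epsilon> / \<epsilon>) \<longlongrightarrow> 0) (at_right 0) \<longrightarrow>
      ((\<lambda>\<epsilon>. ennreal (\<delta> \<epsilon> * \<bar>ln \<epsilon>\<bar> / \<epsilon>)) \<longlongrightarrow> \<kappa>) (at_right 0) \<longrightarrow>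
      (\<forall>I :: real set. is_interval I \<longrightarrow> bounded I \<longrightarrow> interior I \<noteq> {} \<longrightarrow>
        tendsto_in_probability M
          (\<lambda>\<epsilon> \<omega>. surface_tension W q (\<lambda>z. \<Theta> z \<omega>) \<epsilon> (\<delta> \<epsilon>) 1 I) (\<sigma> \<kappa>) (at_right 0) \<and>
        tendsto_in_probability M
          (\<lambda>\<epsilon> \<omega>. surface_tension W q (\<lambda>z. \<Theta> z \<omega>) \<epsilon> (\<delta> \<epsilon>) (-1) I) (\<sigma> \<kappa>) (at_right 0))) \<and>
    \<sigma> 0 = \<sigma>bar \<and> (\<forall>\<kappa>>0. \<sigma> \<kappa> < \<sigma>bar) \<and> \<sigma> top = \<sigma>star"
proof -
  have dw: "double_well W" using W_cont W_nonneg W_zeros by unfold_locales auto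
  have Wr: "double_well (\<lambda>s. W (- s))"
  proof
    show "continuous_on UNIV (\<lambda>s. W (- s))"
      by (rule continuous_on_compose2[OF W_cont]) (auto intro!: continuous_intros)
    show "W (- s) = 0 \<longleftrightarrow> s = -1 \<or> s = 1" for s using W_zeros[of "- s"] by auto
  qed (rule W_nonneg)
  interpret R: random_double_well W M \<Theta> \<theta>min \<theta>max
    by (rule random_double_well_intro[OF dw prob indep ident bounds nonconst min_pos ess_inf])
  interpret R': random_double_well "\<lambda>s. W (- s)" M \<Theta> \<theta>min \<theta>max
    by (rule random_double_well_intro[OF Wr prob indep ident bounds nonconst min_pos ess_inf])
  have q'_top: "((\<lambda>s. - q (- s)) \<longlongrightarrow> 1) at_top"
    using tendsto_minus[OF filterlim_compose[OF q_bot filterlim_uminus_at_bot_at_top]] by simp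
  have q'_bot: "((\<lambda>s. - q (- s)) \<longlongrightarrow> -1) at_bot"
    using tendsto_minus[OF filterlim_compose[OF q_top filterlim_uminus_at_top_at_bot]] by simp
  let ?\<sigma> = "check_sigma W \<theta>min R.rate"
  have bar: "\<sigma>bar = sqrt R.mean * sigma_W W" by (simp add: \<sigma>bar \<theta>bar mult.commute)
  have star: "\<sigma>star = sqrt \<theta>min * sigma_W W" by (simp add: \<sigma>star mult.commute)
  show ?thesis
  proof (intro exI[of _ ?\<sigma>] conjI allI impI)
    show "antimono ?\<sigma>" by (intro antimonoI R.\<sigma>_antimono)
    show "continuous_on UNIV ?\<sigma>" by (rule R.\<sigma>_continuous)
    show "range ?\<sigma> \<subseteq> {\<sigma>star..\<sigma>bar}" using R.\<sigma>_ge R.\<sigma>_le_bar by (auto simp: bar star)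
    show "?\<sigma> 0 = \<sigma>bar" using R.\<sigma>_0 by (simp add: bar)
    show "?\<sigma> top = \<sigma>star" using R.\<sigma>_top by (simp add: star)
    show "?\<sigma> \<kappa> < \<sigma>bar" if \<kappa>: "\<kappa> > 0" for \<kappa>
    proof -
      obtain x where x: "0 < x" "x < \<kappa>" using dense[OF \<kappa>] by blast
      then obtain k where k: "x = ennreal k" "k > 0" by (cases x) auto
      have "?\<sigma> \<kappa> \<le> ?\<sigma> x" using x by (intro R.\<sigma>_antimono) simp
      also have "\<dots> < \<sigma>bar" unfolding k(1) bar by (rule R.\<sigma>_strict[OF k(2)])
      finally show ?thesis .
    qed
  next
    fix \<delta> :: "real \<Rightarrow> real" and \<kappa> :: ennreal and I :: "real set"
    assume dpos: "\<forall>\<epsilon>>0. \<delta> \<epsilon> > 0" and d0: "((\<lambda>\<epsilon>. \<delta> \<epsilon> / \<epsilon>) \<longlongrightarrow> 0) (at_right 0)"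
      and dlim: "((\<lambda>\<epsilon>. ennreal (\<delta> \<epsilon> * \<bar>ln \<epsilon>\<bar> / \<epsilon>)) \<longlongrightarrow> \<kappa>) (at_right 0)"
      and I: "is_interval I" "bounded I" "interior I \<noteq> {}"
    from bounded_interval_shape[OF I] obtain A B where AB: "A < B" and
      sh: "interior I = {A<..<B}" "closure I = {A..B}" "frontier I = {A, B}"
        "{A<..<B} \<subseteq> I" "I \<subseteq> {A..B}" "midpoint_of I = (A + B) / 2" .
    note st = surface_tension_interval(1)[OF sh AB]
    show "tendsto_in_probability M (\<lambda>\<epsilon> \<omega>. surface_tension W q (\<lambda>z. \<Theta> z \<omega>) \<epsilon> (\<delta> \<epsilon>) 1 I) (?\<sigma> \<kappa>) (at_right 0)"
      unfolding st by (rule R.surface_tension_converges[OF dpos d0 dlim AB q_top q_bot])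
    have "\<forall>\<^sub>F \<epsilon> in at_right 0. (\<lambda>\<omega>. surface_tension (\<lambda>s. W (- s)) (\<lambda>s. - q (- s)) (\<lambda>z. \<Theta> z \<omega>) \<epsilon> (\<delta> \<epsilon>) 1 {A..B})
       = (\<lambda>\<omega>. surface_tension W q (\<lambda>z. \<Theta> z \<omega>) \<epsilon> (\<delta> \<epsilon>) (-1) {A..B})"
      using eventually_at_right_less[of "0::real"]
      by (rule eventually_mono) (use dpos surface_tension_reflect[OF AB W_cont] in auto)
    moreover have "tendsto_in_probability M (\<lambda>\<epsilon> \<omega>. surface_tension (\<lambda>s. W (- s)) (\<lambda>s. - q (- s)) (\<lambda>z. \<Theta> z \<omega>) \<epsilon> (\<delta> \<epsilon>) 1 {A..B}) (?\<sigma> \<kappa>) (at_right 0)"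
      using R'.surface_tension_converges[OF dpos d0 dlim AB q'_top q'_bot] by (simp add: check_sigma_reflect)
    ultimately show "tendsto_in_probability M (\<lambda>\<epsilon> \<omega>. surface_tension W q (\<lambda>z. \<Theta> z \<omega>) \<epsilon> (\<delta> \<epsilon>) (-1) I) (?\<sigma> \<kappa>) (at_right 0)"
      unfolding st by (rule tendsto_in_probability_cong)
  qed
qed

end
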